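(* Let $A,B\in\mathbb C^{n,n}$ be such that $A-\lambda B$ is a singular pencil of normal rank $n-k$ (so $k\ge 1$), let $U,V\in\mathbb C^{n,k}$ have full column rank, and let $D_A,D_B\in\mathbb C^{k,k}$ be diagonal matrices such that $D_A-\lambda D_B$ is regular and all eigenvalues of $D_A-\lambda D_B$ are distinct from the eigenvalues of $A-\lambda B$ (finite or infinite). For $\tau\in\mathbb C\setminus\{0\}$ put $$\widetilde A-\lambda\widetilde B:=A-\lambda B+\tau\,(UD_AV^*-\lambda\,UD_BV^* ).$$ Then, generically with respect to the entries of $U$ and $V^*$, the following statements hold: 1. For each $\tau\neq 0$ there exist nonsingular matrices $\widetilde P$ and $\widetilde Q$ such that $$\widetilde P\big(\widetilde A-\lambda\widetilde B\big)\widetilde Q=\begin{bmatrix}R(\lambda)&0\\0&R_{\rm new}(\lambda)\end{bmatrix},$$ where $R(\lambda)$ is the regular part of the original pencil $A-\lambda B$, and $R_{\rm new}(\lambda)$ is regular and all its eigenvalues are distinct from the eigenvalues of $R(\lambda)$. 2. If $\lambda_0\in\mathbb C$ is a finite eigenvalue of $A-\lambda B$, i.e., $\operatorname{rank}(A-\lambda_0B)<n-k$, then $\lambda_0$ is an eigenvalue of $\widetilde A-\lambda\widetilde B$ for each $\tau\ne0$. Furthermore, the right null space $\mathcal N_r(\lambda_0):=\ker(\widetilde A-\lambda_0\widetilde B)$ and the left null space $\mathcal N_l(\lambda_0):=\ker\big((\widetilde A-\lambda_0\widetilde B)^*\big)$ are both constant in $\tau\neq0$. In addition: (a) $\mathcal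 N_r(\lambda_0)\perp\operatorname{span}(V)$, i.e., if $x$ is a right eigenvector of $\widetilde A-\lambda\widetilde B$ associated with $\lambda_0$, then $V^*x=0$; (b) $\mathcal N_l(\lambda_0)\perp\operatorname{span}(U)$, i.e., if $y$ is a left eigenvector of $\widetilde A-\lambda\widetilde B$ associated with $\lambda_0$, then $U^*y=0$. 3. If $\infty$ is an eigenvalue of $A-\lambda B$, i.e., $\operatorname{rank}(B)<n-k$, then $\infty$ is an eigenvalue of $\widetilde A-\lambda\widetilde B$ for each $\tau\neq0$. The right and left null spaces $\mathcal N_r(\infty):=\ker(\widetilde B)$ and $\mathcal N_l(\infty):=\ker(\widetilde B^* )$ are both constant in $\tau\ne0$. In addition: (a) $\mathcal N_r(\infty)\perp\operatorname{span}(V)$, i.e., if $x$ is a right eigenvector of $\widetilde A-\lambda\widetilde B$ associated with $\infty$, then $V^*x=0$; (b) $\mathcal N_l(\infty)\perp\operatorname{span}(U)$, i.e., if $y$ is a left eigenvector of $\widetilde A-\lambda\widetilde B$ associated with $\infty$, then $U^*y=0$.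
   Context: $\mathbb C^{n,m}$ is the set of complex $n\times m$ matrices and $X^*$ is the conjugate transpose; $\operatorname{span}(V)$ is the column space of $V$. The normal rank of a pencil is $\operatorname{nrank}(A,B):=\max_{\zeta\in\mathbb C}\operatorname{rank}(A-\zeta B)$. A square pencil is singular if $\det(A-\lambda B)\equiv0$, and regular otherwise. A finite eigenvalue of a (possibly singular) pencil is $\lambda_0\in\mathbb C$ with $\operatorname{rank}(A-\lambda_0B)<\operatorname{nrank}(A,B)$; $\infty$ is an eigenvalue if $\operatorname{rank}(B)<\operatorname{nrank}(A,B)$. Right (left) eigenvectors of a regular pencil $\widetilde A-\lambda\widetilde B$ for a finite eigenvalue $\lambda_0$ are nonzero $x$ (resp. $y$) with $(\widetilde A-\lambda_0\widetilde B)x=0$ (resp. $y^*(\widetilde A-\lambda_0\widetilde B)=0$); for $\infty$ they are nonzero $x$ (resp. $y$) with $\widetilde Bx=0$ (resp. $y^*\widetilde B=0$). Kronecker canonical form (KCF): for every complex pencil $A-\lambda B$ there are nonsingular $P,Q$ with $P(A-\lambda B)Q=\operatorname{diag}(R(\lambda),S(\lambda))$, where $R(\lambda)=\operatorname{diag}(J-\lambda I,\,I-\lambda N)$ with $J,N$ in Jordan normal form and $N$ nilpotent, and $S(\lambda)=\operatorname{diag}(L_{m_1}(\lambda),\dots,L_{m_p}(\lambda),L_{n_1}(\lambda)^\top,\dots,L_{n_q}(\lambda)^\top)$ with $L_j(\lambda)=[0\ \ I_j]-\lambda[I_j\ \ 0]$ of size $j\times(j+1)$, $j\ge0$. $R(\lambda)$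 is called the regular part and $S(\lambda)$ the singular part of $A-\lambda B$. Genericity: a subset of $\mathbb C^m$ is algebraic if it is the set of common zeros of finitely many complex polynomials in $m$ variables, and proper if it is not all of $\mathbb C^m$. A set $\Omega\subseteq\mathbb C^m$ is generic if its complement is contained in a proper algebraic set. A property holds generically with respect to the entries of $U$ and $V^*$ if there is a generic set $\Omega\subseteq\mathbb C^{2nk}$ (identified with pairs $(U,V^* )$, $U\in\mathbb C^{n,k}$, $V^*\in\mathbb C^{k,n}$) such that the property holds whenever $(U,V^* )\in\Omega$; here $A,B,D_A,D_B$ are fixed, and the statements quantified over all $\tau\neq0$ hold for each such $(U,V^* )$. *)

theory Defs
  imports
    Complex_Main
    "HOL-Library.Poly_Mapping"
    "Jordan_Normal_Form.Matrix_Kernel"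
    "Jordan_Normal_Form.DL_Rank"
    "Jordan_Normal_Form.Schur_Decomposition"
    "Jordan_Normal_Form.Jordan_Normal_Form"
begin

section \<open>Matrix pencils\<close>

definition mrank :: "complex mat \<Rightarrow> nat" where
  "mrank M = vec_space.rank (dim_row M) M"

definition pencil :: "complex mat \<Rightarrow> complex mat \<Rightarrow> complex \<Rightarrow> complex mat" where
  "pencil A B z = A - z \<cdot>\<^sub>m B"

text \<open>The range below is bounded by the number of columns, so the maximum exists.\<close>

definition nrank :: "complex mat \<Rightarrow> complex mat \<Rightarrow> nat" where
  "nrank A B = Max (range (\<lambda>z. mrank (pencil A B z)))"

definition square_pencil :: "complex mat \<Rightarrow> complex mat \<Rightarrow> bool" where
  "square_pencil A B \<longleftrightarrow> (\<exists>m. A \<in> carrier_mat m m \<and> B \<in> carrier_mat m m)"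

definition singular_pencil :: "complex mat \<Rightarrow> complex mat \<Rightarrow> bool" where
  "singular_pencil A B \<longleftrightarrow> square_pencil A B \<and> (\<forall>z. det (pencil A B z) = 0)"

definition regular_pencil :: "complex mat \<Rightarrow> complex mat \<Rightarrow> bool" where
  "regular_pencil A B \<longleftrightarrow> square_pencil A B \<and> \<not> (\<forall>z. det (pencil A B z) = 0)"

datatype point = Fin complex | Infty

fun pencil_at :: "complex mat \<Rightarrow> complex mat \<Rightarrow> point \<Rightarrow> complex mat" where
  "pencil_at A B (Fin z) = pencil A B z"
| "pencil_at A B Infty = B"

definition eigenvalues :: "complex mat \<Rightarrow> complex mat \<Rightarrow> point set" where
  "eigenvalues A B = {\<mu>. mrank (pencil_at A B \<mu>) < nrank A B}"

definition right_eigenvector :: "complex mat \<Rightarrow> complex mat \<Rightarrow> point \<Rightarrow> complex vec \<Rightarrow> bool" where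
  "right_eigenvector A B \<mu> x \<longleftrightarrow>
     x \<in> carrier_vec (dim_col A) \<and> x \<noteq> 0\<^sub>v (dim_col A) \<and>
     pencil_at A B \<mu> *\<^sub>v x = 0\<^sub>v (dim_row A)"

text \<open>The row vector \<open>y\<^sup>*\<close> is the \<open>1 \<times> n\<close> matrix \<open>mat_of_row (conjugate y)\<close>.\<close>

definition left_eigenvector :: "complex mat \<Rightarrow> complex mat \<Rightarrow> point \<Rightarrow> complex vec \<Rightarrow> bool" where
  "left_eigenvector A B \<mu> y \<longleftrightarrow>
     y \<in> carrier_vec (dim_row A) \<and> y \<noteq> 0\<^sub>v (dim_row A) \<and>
     mat_of_row (conjugate y) * pencil_at A B \<mu> = 0\<^sub>m 1 (dim_col A)"

definition column_space :: "complex mat \<Rightarrow> complex vec set" where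
  "column_space M = vec_space.col_space (dim_row M) M"

definition orthogonal_sets :: "complex vec set \<Rightarrow> complex vec set \<Rightarrow> bool" where
  "orthogonal_sets X Y \<longleftrightarrow> (\<forall>x\<in>X. \<forall>y\<in>Y. x \<bullet>c y = 0)"

text \<open>
  Coefficientwise form of the perturbation:
  \<open>A - \<lambda> B + \<tau> (U D\<^sub>A V\<^sup>* - \<lambda> U D\<^sub>B V\<^sup>*)\<close> is the pencil of
  \<open>perturb A U D\<^sub>A V \<tau>\<close> and \<open>perturb B U D\<^sub>B V \<tau>\<close>.
\<close>

definition perturb ::
  "complex mat \<Rightarrow> complex mat \<Rightarrow> complex mat \<Rightarrow> complex mat \<Rightarrow> complex \<Rightarrow> complex mat" where
  "perturb M U D V \<tau> = M + \<tau> \<cdot>\<^sub>m (U * D * mat_adjoint V)"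


section \<open>Kronecker canonical form\<close>

definition is_jordan_matrix :: "complex mat \<Rightarrow> bool" where
  "is_jordan_matrix J \<longleftrightarrow> (\<exists>n_as. 0 \<notin> fst ` set n_as \<and> J = jordan_matrix n_as)"

text \<open>\<open>L\<^sub>j(\<lambda>) = [0 I\<^sub>j] - \<lambda> [I\<^sub>j 0]\<close>; the case \<open>j = 0\<close> is the \<open>0 \<times> 1\<close> matrix.\<close>

definition L_block :: "nat \<Rightarrow> complex \<Rightarrow> complex mat" where
  "L_block j z = mat j (j + 1) (\<lambda>(r, c). if c = r + 1 then 1 else if c = r then - z else 0)"

definition singular_part :: "nat list \<Rightarrow> nat list \<Rightarrow> complex \<Rightarrow> complex mat" where
  "singular_part ms ns z =
     diag_block_mat (map (\<lambda>m. L_block m z) ms @ map (\<lambda>m. transpose_mat (L_block m z)) ns)"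

text \<open>
  \<open>RA - \<lambda> RB\<close> is the regular part in some Kronecker canonical form of \<open>A - \<lambda> B\<close>
  (it is unique only up to the order of the Jordan blocks).
\<close>

definition is_regular_part ::
  "complex mat \<Rightarrow> complex mat \<Rightarrow> complex mat \<Rightarrow> complex mat \<Rightarrow> bool" where
  "is_regular_part A B RA RB \<longleftrightarrow>
     (\<exists>P Q J N ms ns.
        P \<in> carrier_mat (dim_row A) (dim_row A) \<and> invertible_mat P \<and>
        Q \<in> carrier_mat (dim_col A) (dim_col A) \<and> invertible_mat Q \<and>
        is_jordan_matrix J \<and> is_jordan_matrix N \<and>
        (\<exists>l. N ^\<^sub>m l = 0\<^sub>m (dim_row N) (dim_row N)) \<and>
        RA = diag_block_mat [J, 1\<^sub>m (dim_row N)] \<and>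
        RB = diag_block_mat [1\<^sub>m (dim_row J), N] \<and>
        (\<forall>z. P * pencil A B z * Q = diag_block_mat [pencil RA RB z, singular_part ms ns z]))"


section \<open>Genericity\<close>

text \<open>
  Polynomials in the variables \<open>X\<^sub>0, X\<^sub>1, \<dots>\<close>: finitely supported coefficient functions on
  monomials, a monomial being a finitely supported exponent function.
\<close>

type_synonym cmpoly = "(nat \<Rightarrow>\<^sub>0 nat) \<Rightarrow>\<^sub>0 complex"

definition in_vars :: "nat \<Rightarrow> cmpoly \<Rightarrow> bool" where
  "in_vars d p \<longleftrightarrow> (\<forall>m \<in> Poly_Mapping.keys p. Poly_Mapping.keys m \<subseteq> {..<d})"

definition cmpoly_eval :: "cmpoly \<Rightarrow> complex vec \<Rightarrow> complex" where
  "cmpoly_eval p x =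
     (\<Sum>m \<in> Poly_Mapping.keys p.
        Poly_Mapping.lookup p m * (\<Prod>i \<in> Poly_Mapping.keys m. (x $ i) ^ Poly_Mapping.lookup m i))"

definition algebraic_set :: "nat \<Rightarrow> complex vec set \<Rightarrow> bool" where
  "algebraic_set d Z \<longleftrightarrow>
     (\<exists>F. finite F \<and> (\<forall>p\<in>F. in_vars d p) \<and>
          Z = {x \<in> carrier_vec d. \<forall>p\<in>F. cmpoly_eval p x = 0})"

definition generic_set :: "nat \<Rightarrow> complex vec set \<Rightarrow> bool" where
  "generic_set d \<Omega> \<longleftrightarrow>
     \<Omega> \<subseteq> carrier_vec d \<and>
     (\<exists>Z. algebraic_set d Z \<and> Z \<noteq> carrier_vec d \<and> carrier_vec d - \<Omega> \<subseteq> Z)"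

text \<open>
  The identification of pairs of an \<open>n \<times> k\<close> and a \<open>k \<times> n\<close> matrix with vectors of length
  \<open>2 n k\<close>: the entries of the two matrices, row by row.
\<close>

definition pair_vec :: "nat \<Rightarrow> nat \<Rightarrow> complex mat \<Rightarrow> complex mat \<Rightarrow> complex vec" where
  "pair_vec n k U W =
     vec (2 * n * k)
       (\<lambda>l. if l < n * k then U $$ (l div k, l mod k)
            else W $$ ((l - n * k) div n, (l - n * k) mod n))"

text \<open>The coordinates are the entries of \<open>U\<close> and of \<open>V\<^sup>*\<close>, not those of \<open>V\<close>.\<close>

definition holds_generically ::
  "nat \<Rightarrow> nat \<Rightarrow> (complex mat \<Rightarrow> complex mat \<Rightarrow> bool) \<Rightarrow> bool" where
  "holds_generically n k Pr \<longleftrightarrow>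
     (\<exists>\<Omega>. generic_set (2 * n * k) \<Omega> \<and>
        (\<forall>U \<in> carrier_mat n k. \<forall>V \<in> carrier_mat n k.
           pair_vec n k U (mat_adjoint V) \<in> \<Omega> \<longrightarrow> Pr U V))"

end

theory Submission
  imports Defs
begin

text \<open>
  Write \<open>L = A - \<lambda> B\<close> and \<open>D = D\<^sub>A - \<lambda> D\<^sub>B\<close>. At an eigenvalue \<open>\<mu>\<close> of \<open>L\<close> the matrix \<open>D(\<mu>)\<close> is
  nonsingular, and generically the column spaces of \<open>L(\<mu>)\<close> and \<open>U\<close> meet trivially. Hence
  \<open>ker (L(\<mu>) + \<tau> U D(\<mu>) V\<^sup>*) = ker L(\<mu>) \<inter> ker V\<^sup>*\<close> for all \<open>\<tau> \<noteq> 0\<close>, and dually on the left, which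
  yields 2 and 3.

  For 1, the regular part of the Kronecker form gives constant matrices with \<open>L Q\<^sub>1 = C\<^sub>1 R\<close>. They are
  corrected along the right singular blocks, by solving a triangular Sylvester system column by
  column, to \<open>L X = Y R\<close> with \<open>V\<^sup>* X = 0\<close>; dually \<open>Z L = R W\<close> with \<open>Z U = 0\<close>. Both identities survive
  the perturbation, and \<open>Z Y = 1\<close>, \<open>W X = 1\<close>, so complements of \<open>X\<close> and \<open>Z\<close> split off \<open>R\<close>.

  The Sylvester system is solvable at \<open>\<mu>\<close> if \<open>V\<^sup>*\<close> is injective on the limits at \<open>\<mu>\<close> of kernel vectors
  of \<open>L(\<lambda>)\<close>. This space depends on \<open>L\<close> only and has dimension at most \<open>k\<close>, so a single generic set
  serves all Kronecker forms. All generic conditions have the form \<open>det (C U) \<noteq> 0\<close> or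
  \<open>det (V\<^sup>* N) \<noteq> 0\<close> with fixed \<open>C\<close> and \<open>N\<close> of full rank.
\<close>

section \<open>Matrices with a one-sided inverse\<close>

text \<open>The spectra of \<open>R\<close> and of the complementary block are separated by the same
  limits of kernels. A null vector of the complement at an eigenvalue of \<open>R\<close> lifts to a
  null vector \<open>x\<close> of the perturbed pencil with \<open>W x = 0\<close>, where
  \<open>W\<close> is the factor with \<open>W X = 1\<close>. Having no regular component,
  \<open>x\<close> is a limit of kernel vectors of \<open>L\<close>; being a null vector of the
  perturbed pencil, it is also annihilated by \<open>V\<^sup>*\<close>. Generically this forces
  \<open>x = 0\<close>. Conditions are imposed at finitely many points: the eigenvalues of
  \<open>L\<close> and one more point where \<open>L\<close> has normal rank. Since the perturbed
  kernel does not depend on \<tau>, the extra point gives regularity for all nonzero \<tau> at once.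
  Ranks are certified throughout by one-sided inverses. Such certificates pass to products and
  transposes, and they supply the points at which the determinants of the generic conditions are
  nonzero.\<close>

definition mrange :: "'a :: comm_ring_1 mat \<Rightarrow> 'a vec set" where
  "mrange N = (\<lambda>u. N *\<^sub>v u) ` carrier_vec (dim_col N)"

text \<open>Column-wise counterpart of \<open>@\<^sub>r\<close>; the empty bottom blocks reduce
  products with stacked matrices to the multiplication rule for four blocks.\<close>

definition hcat :: "'a :: zero mat \<Rightarrow> 'a mat \<Rightarrow> 'a mat" where
  "hcat A B = four_block_mat A B (0\<^sub>m 0 (dim_col A)) (0\<^sub>m 0 (dim_col B))"

lemma hcat_carrier [simp, intro]:
  assumes "A \<in> carrier_mat n a" "B \<in> carrier_mat n b"
  shows "hcat A B \<in> carrier_mat n (a + b)"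
  using assms unfolding hcat_def by auto

lemma append_rows_mult_hcat:
  fixes A :: "'a :: comm_ring_1 mat"
  assumes "A \<in> carrier_mat a n" "B \<in> carrier_mat b n" "X \<in> carrier_mat n c" "Y \<in> carrier_mat n d"
  shows "(A @\<^sub>r B) * hcat X Y = four_block_mat (A * X) (A * Y) (B * X) (B * Y)"
  unfolding append_rows_def hcat_def using assms
  by (subst mult_four_block_mat[of _ a n _ 0 _ b _ _ c _ d]) auto

lemma hcat_mult_append_rows:
  fixes A :: "'a :: comm_ring_1 mat"
  assumes A: "A \<in> carrier_mat n a" and B: "B \<in> carrier_mat n b"
    and X: "X \<in> carrier_mat a m" and Y: "Y \<in> carrier_mat b m"
  shows "hcat A B * (X @\<^sub>r Y) = A * X + B * Y"
proof -
  have "hcat A B * (X @\<^sub>r Y) = four_block_mat (A * X + B * Y) (A * 0\<^sub>m a 0 + B * 0\<^sub>m b 0)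
      (0\<^sub>m 0 a * X + 0\<^sub>m 0 b * Y) (0\<^sub>m 0 a * 0\<^sub>m a 0 + 0\<^sub>m 0 b * 0\<^sub>m b 0)"
    unfolding append_rows_def hcat_def using assms
    by (subst mult_four_block_mat[of _ n a _ b _ 0 _ _ m _ 0]) auto
  also have "\<dots> = A * X + B * Y"
    using assms by (intro eq_matI) auto
  finally show ?thesis .
qed

lemma append_rows_mult:
  fixes A :: "'a :: comm_ring_1 mat"
  assumes "A \<in> carrier_mat a n" "B \<in> carrier_mat b n" "X \<in> carrier_mat n c"
  shows "(A @\<^sub>r B) * X = (A * X) @\<^sub>r (B * X)"
proof (rule eq_matI)
  fix i j assume ij: "i < dim_row (A * X @\<^sub>r B * X)" "j < dim_col (A * X @\<^sub>r B * X)"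
  have 1: "(A @\<^sub>r B) *\<^sub>v col X j = (A *\<^sub>v col X j) @\<^sub>v (B *\<^sub>v col X j)"
    using assms by (intro mat_mult_append) auto
  have "((A @\<^sub>r B) * X) $$ (i,j) = ((A @\<^sub>r B) *\<^sub>v col X j) $ i"
    using ij assms by (auto simp: append_rows_def)
  then show "((A @\<^sub>r B) * X) $$ (i, j) = (A * X @\<^sub>r B * X) $$ (i, j)"
    unfolding 1 using ij assms by (auto simp: append_rows_def)
qed (use assms in \<open>auto simp: append_rows_def\<close>)

lemma mat_mult_unit_vec:
  fixes A :: "'a :: comm_ring_1 mat"
  assumes "j < dim_col A"
  shows "A *\<^sub>v unit_vec (dim_col A) j = col A j"
  using assms by (intro eq_vecI) auto

text \<open>If \<open>n < r\<close>, padding both factors with zeros to size \<open>r\<close> keeps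
  the product. For square matrices the reverse product is then 1 as well, but its row
  \<open>n\<close> is zero.\<close>

lemma left_inverse_dim_le:
  fixes C N :: "'a :: field mat"
  assumes C: "C \<in> carrier_mat r n" and N: "N \<in> carrier_mat n r" and CN: "C * N = 1\<^sub>m r"
  shows "r \<le> n"
proof (rule ccontr)
  assume "\<not> r \<le> n"
  hence nr: "n < r" by simp
  define C' where "C' = mat r r (\<lambda>(i,j). if j < n then C $$ (i,j) else 0)"
  define N' where "N' = mat r r (\<lambda>(i,j). if i < n then N $$ (i,j) else 0)"
  have C': "C' \<in> carrier_mat r r" and N': "N' \<in> carrier_mat r r"
    by (auto simp: C'_def N'_def)
  have "C' * N' = C * N"
  proof (rule eq_matI)
    fix i j assume "i < dim_row (C * N)" "j < dim_col (C * N)"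
    hence ij: "i < r" "j < r" using C N by auto
    have "(C' * N') $$ (i,j) = (\<Sum>l\<in>{0..<r}. C' $$ (i,l) * N' $$ (l,j))"
      using ij C' N' by (auto simp: scalar_prod_def)
    also have "\<dots> = (\<Sum>l\<in>{0..<n}. C $$ (i,l) * N $$ (l,j))"
      using nr ij by (intro sum.mono_neutral_cong_right) (auto simp: C'_def N'_def)
    also have "\<dots> = (C * N) $$ (i,j)" using ij C N by (auto simp: scalar_prod_def)
    finally show "(C' * N') $$ (i,j) = (C * N) $$ (i,j)" .
  qed (use C N C' N' in auto)
  hence "C' * N' = 1\<^sub>m r" using CN by simp
  from mat_mult_left_right_inverse[OF C' N' this] have NC: "N' * C' = 1\<^sub>m r" .
  have "(N' * C') $$ (n,n) = 0" using nr C' N'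
    by (auto simp: scalar_prod_def N'_def intro!: sum.neutral)
  thus False using NC nr by simp
qed

lemma left_inverse_inj:
  fixes C N :: "'a :: comm_ring_1 mat"
  assumes "C \<in> carrier_mat r n" "N \<in> carrier_mat n r" "C * N = 1\<^sub>m r" "u \<in> carrier_vec r"
  shows "C *\<^sub>v (N *\<^sub>v u) = u"
  using assms by (metis assoc_mult_mat_vec one_mult_mat_vec)

text \<open>\<open>N * C\<close> is idempotent with range \<open>mrange N\<close>, hence acts as the
  identity on columns taken from there.\<close>

lemma mult_left_inverse_of_mrange:
  fixes C N :: "'a :: comm_ring_1 mat"
  assumes C: "C \<in> carrier_mat r n" and N: "N \<in> carrier_mat n r" and CN: "C * N = 1\<^sub>m r"
    and M: "M \<in> carrier_mat n m" and cols: "\<And>j. j < m \<Longrightarrow> col M j \<in> mrange N"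
  shows "N * (C * M) = M"
proof (rule mat_col_eqI)
  fix j assume "j < dim_col M"
  hence j: "j < m" using M by simp
  then obtain u where u: "u \<in> carrier_vec r" "col M j = N *\<^sub>v u"
    using cols[OF j] N by (auto simp: mrange_def)
  have CM: "C * M \<in> carrier_mat r m" using C M by auto
  have "col (N * (C * M)) j = N *\<^sub>v (C *\<^sub>v col M j)"
    unfolding col_mult2[OF N CM j] col_mult2[OF C M j] ..
  also have "\<dots> = col M j" unfolding u(2) using left_inverse_inj[OF C N CN u(1)] by simp
  finally show "col (N * (C * M)) j = col M j" .
qed (use N C M in auto)

text \<open>The corrected vector \<open>y - N *\<^sub>v (C *\<^sub>v y)\<close> lies in the kernel
  of \<open>C\<close>, and it is nonzero because \<open>y\<close> is outside the range of
  \<open>N\<close>. The new row of the left inverse must vanish on \<open>N\<close> and take the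
  value 1 on this vector; a row of \<open>1 - N * C\<close> does so after scaling.\<close>

lemma left_inverse_extend:
  fixes C N :: "'a :: field mat"
  assumes C: "C \<in> carrier_mat r n" and N: "N \<in> carrier_mat n r" and CN: "C * N = 1\<^sub>m r"
    and y: "y \<in> carrier_vec n" and yN: "y \<notin> mrange N"
  obtains C' N' where "C' \<in> carrier_mat (Suc r) n" "N' \<in> carrier_mat n (Suc r)"
    "C' * N' = 1\<^sub>m (Suc r)" "\<And>j. j < r \<Longrightarrow> col N' j = col N j"
    "col N' r = y - N *\<^sub>v (C *\<^sub>v y)"
proof -
  define y' where "y' = y - N *\<^sub>v (C *\<^sub>v y)"
  have y': "y' \<in> carrier_vec n" using C N y by (auto simp: y'_def)
  have Cy: "C *\<^sub>v y \<in> carrier_vec r" using C y by auto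
  have "y' \<noteq> 0\<^sub>v n"
  proof
    assume "y' = 0\<^sub>v n"
    hence "y = N *\<^sub>v (C *\<^sub>v y)"
      unfolding y'_def vec_eq_iff using y N by auto
    thus False using yN N Cy by (auto simp: mrange_def)
  qed
  then obtain i0 where i0: "i0 < n" "y' $ i0 \<noteq> 0" using y' by (metis eq_vecI carrier_vecD index_zero_vec)
  have Cy': "C *\<^sub>v y' = 0\<^sub>v r"
    unfolding y'_def using C N y Cy CN left_inverse_inj[OF C N CN Cy]
    by (subst mult_minus_distrib_mat_vec[of _ r n]) auto
  define D where "D = 1\<^sub>m n - N * C"
  have D: "D \<in> carrier_mat n n" using N C by (auto simp: D_def)
  have DN: "D * N = 0\<^sub>m n r"
    unfolding D_def using N C CN
    by (subst minus_mult_distrib_mat[of _ n n]) (auto simp: assoc_mult_mat[of _ n r _ n _ r])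
  have Dy: "D *\<^sub>v y' = y'"
  proof -
    have "D *\<^sub>v y' = 1\<^sub>m n *\<^sub>v y' - (N * C) *\<^sub>v y'"
      unfolding D_def using N C y' by (intro minus_mult_distrib_mat_vec) auto
    also have "(N * C) *\<^sub>v y' = 0\<^sub>v n" using N C y' Cy' by (auto simp: assoc_mult_mat_vec[of _ n r _ n])
    finally show ?thesis using y' by auto
  qed
  define d where "d = (1 / y' $ i0) \<cdot>\<^sub>v row D i0"
  have d: "d \<in> carrier_vec n" using D by (auto simp: d_def)
  have dN: "d \<bullet> col N j = 0" if j: "j < r" for j
  proof -
    have "row D i0 \<bullet> col N j = (D * N) $$ (i0, j)" using i0 j D N by auto
    thus ?thesis unfolding DN using i0 j D N by (auto simp: d_def)
  qed
  have dy: "d \<bullet> y' = 1"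
  proof -
    have "row D i0 \<bullet> y' = (D *\<^sub>v y') $ i0" using i0 D by auto
    thus ?thesis unfolding Dy using i0 D y' by (auto simp: d_def)
  qed
  define N' where "N' = mat n (Suc r) (\<lambda>(i,j). if j < r then N $$ (i,j) else y' $ i)"
  define C' where "C' = mat (Suc r) n (\<lambda>(i,j). if i < r then C $$ (i,j) else d $ j)"
  have N': "N' \<in> carrier_mat n (Suc r)" and C': "C' \<in> carrier_mat (Suc r) n"
    by (auto simp: N'_def C'_def)
  have colN: "col N' j = col N j" if "j < r" for j
    using that N by (intro eq_vecI) (auto simp: N'_def)
  have colr: "col N' r = y'" using y' by (intro eq_vecI) (auto simp: N'_def)
  have rowC: "row C' i = row C i" if "i < r" for i
    using that C by (intro eq_vecI) (auto simp: C'_def)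
  have rowr: "row C' r = d" using d by (intro eq_vecI) (auto simp: C'_def)
  have "C' * N' = 1\<^sub>m (Suc r)"
  proof (rule eq_matI)
    fix i j assume "i < dim_row (1\<^sub>m (Suc r) :: 'a mat)" "j < dim_col (1\<^sub>m (Suc r) :: 'a mat)"
    hence ij: "i < Suc r" "j < Suc r" by auto
    have e: "(C' * N') $$ (i,j) = row C' i \<bullet> col N' j" using ij C' N' by auto
    have CNe: "row C i \<bullet> col N j = 1\<^sub>m r $$ (i,j)" if "i < r" "j < r"
      unfolding CN[symmetric] using that C N by auto
    have Ce: "row C i \<bullet> y' = 0" if "i < r"
    proof -
      have "row C i \<bullet> y' = (C *\<^sub>v y') $ i" using that C by auto
      thus ?thesis unfolding Cy' using that by simp
    qed
    show "(C' * N') $$ (i,j) = 1\<^sub>m (Suc r) $$ (i,j)"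
      unfolding e using ij CNe Ce dN[of j] dy rowC rowr colN colr
      by (cases "i < r"; cases "j < r") (auto simp: less_Suc_eq)
  qed (use C' N' in auto)
  from that[OF C' N' this colN colr[unfolded y'_def]] show thesis by auto
qed

lemma mult_mat_vec_last_col:
  fixes N' :: "'a :: comm_ring_1 mat"
  assumes N': "N' \<in> carrier_mat n (Suc r)" and N: "N \<in> carrier_mat n r"
    and col: "\<And>j. j < r \<Longrightarrow> col N' j = col N j" and u: "u \<in> carrier_vec (Suc r)"
  shows "N' *\<^sub>v u = N *\<^sub>v vec_first u r + (u $ r) \<cdot>\<^sub>v col N' r"
proof (rule eq_vecI)
  fix i assume "i < dim_vec (N *\<^sub>v vec_first u r + u $ r \<cdot>\<^sub>v col N' r)"
  hence i: "i < n" using N' by auto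
  have e: "N' $$ (i,j) = N $$ (i,j)" if "j < r" for j
    using arg_cong[OF col[OF that], of "\<lambda>v. v $ i"] that i N N' by auto
  show "(N' *\<^sub>v u) $ i = (N *\<^sub>v vec_first u r + u $ r \<cdot>\<^sub>v col N' r) $ i"
    using i N N' u e by (auto simp: scalar_prod_def vec_first_def)
qed (use N N' in auto)

lemma mrange_extend:
  fixes N :: "'a :: comm_ring_1 mat"
  assumes N': "N' \<in> carrier_mat n (Suc r)" and N: "N \<in> carrier_mat n r"
    and col: "\<And>j. j < r \<Longrightarrow> col N' j = col N j"
  shows "mrange N \<subseteq> mrange N'"
proof
  fix x assume "x \<in> mrange N"
  then obtain u where u: "u \<in> carrier_vec r" "x = N *\<^sub>v u" using N by (auto simp: mrange_def)
  define w where "w = vec (Suc r) (\<lambda>i. if i < r then u $ i else 0)"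
  have w: "w \<in> carrier_vec (Suc r)" "vec_first w r = u" "w $ r = 0"
    using u by (auto simp: w_def vec_first_def)
  have "N' *\<^sub>v w = N *\<^sub>v vec_first w r + w $ r \<cdot>\<^sub>v col N' r"
    by (rule mult_mat_vec_last_col[OF N' N _ w(1)]) (rule col)
  hence "N' *\<^sub>v w = N *\<^sub>v u" unfolding w(2,3) using N' N u(1)
    by (simp add: vec_eq_iff)
  thus "x \<in> mrange N'" using N' w u by (auto simp: mrange_def intro!: image_eqI[of _ _ w])
qed

section \<open>Subspaces and complements described by basis matrices\<close>

definition vec_subspace :: "nat \<Rightarrow> 'a :: field vec set \<Rightarrow> bool" where
  "vec_subspace n K \<longleftrightarrow> K \<subseteq> carrier_vec n \<and> 0\<^sub>v n \<in> K \<and>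
     (\<forall>x\<in>K. \<forall>y\<in>K. x + y \<in> K) \<and> (\<forall>c. \<forall>x\<in>K. c \<cdot>\<^sub>v x \<in> K)"

lemma vec_subspace_minus:
  assumes "vec_subspace n K" "x \<in> K" "y \<in> K" shows "x - y \<in> K"
proof -
  have "x - y = x + (-1) \<cdot>\<^sub>v y"
    using assms by (intro eq_vecI) (auto simp: vec_subspace_def)
  thus ?thesis using assms by (auto simp: vec_subspace_def)
qed

text \<open>Among matrices with a left inverse and range inside \<open>K\<close>, take one with the
  most columns; there are at most \<open>n\<close> of them. A vector of \<open>K\<close> outside its
  range would allow one more column.\<close>

lemma subspace_basis_matrix:
  fixes K :: "'a :: field vec set"
  assumes K: "vec_subspace n K"
  obtains r N C where "r \<le> n" "N \<in> carrier_mat n r" "C \<in> carrier_mat r n" "C * N = 1\<^sub>m r"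
    "mrange N = K"
proof -
  define P where "P r \<longleftrightarrow> (\<exists>N C. N \<in> carrier_mat n r \<and> C \<in> carrier_mat r n \<and> C * N = 1\<^sub>m r \<and>
     mrange N \<subseteq> K)" for r
  have bound: "r \<le> n" if "P r" for r using that left_inverse_dim_le unfolding P_def by blast
  have "0\<^sub>m n 0 *\<^sub>v u = 0\<^sub>v n" if "u \<in> carrier_vec 0" for u :: "'a vec"
    using that by (intro eq_vecI) (auto simp: scalar_prod_def)
  hence "P 0" unfolding P_def using K
    by (intro exI[of _ "0\<^sub>m n 0"] exI[of _ "0\<^sub>m 0 n"] conjI) (auto simp: mrange_def vec_subspace_def)
  hence PG: "P (GREATEST r. P r)" using bound by (rule GreatestI_nat)
  define r where "r = (GREATEST r. P r)"
  obtain N C where N: "N \<in> carrier_mat n r" and C: "C \<in> carrier_mat r n" and CN: "C * N = 1\<^sub>m r"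
    and sub: "mrange N \<subseteq> K" using PG unfolding P_def r_def by blast
  have "K \<subseteq> mrange N"
  proof
    fix y assume y: "y \<in> K"
    show "y \<in> mrange N"
    proof (rule ccontr)
      assume yN: "y \<notin> mrange N"
      have yc: "y \<in> carrier_vec n" using y K by (auto simp: vec_subspace_def)
      obtain C' N' where *: "C' \<in> carrier_mat (Suc r) n" "N' \<in> carrier_mat n (Suc r)"
        "C' * N' = 1\<^sub>m (Suc r)" and col: "\<And>j. j < r \<Longrightarrow> col N' j = col N j"
        and colr: "col N' r = y - N *\<^sub>v (C *\<^sub>v y)"
        using left_inverse_extend[OF C N CN yc yN] by metis
      have "N *\<^sub>v (C *\<^sub>v y) \<in> K" using sub N C yc by (auto simp: mrange_def)
      hence "col N' r \<in> K" unfolding colr using vec_subspace_minus[OF K y] by blast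
      moreover have "N *\<^sub>v vec_first u r \<in> K" for u using sub N by (auto simp: mrange_def)
      ultimately have "mrange N' \<subseteq> K"
        using K * mult_mat_vec_last_col[OF *(2) N col]
        by (auto simp: mrange_def vec_subspace_def)
      hence "P (Suc r)" unfolding P_def using * by blast
      hence "Suc r \<le> r" unfolding r_def using bound by (intro Greatest_le_nat)
      thus False by simp
    qed
  qed
  with sub have "mrange N = K" by blast
  with that[OF _ N C CN] left_inverse_dim_le[OF C N CN] show thesis by blast
qed

text \<open>Generic conditions are determinants of size \<open>k\<close>, so a smaller subspace has
  to be placed in one of dimension exactly \<open>k\<close>. With fewer than \<open>n\<close>
  columns a further one exists, since a surjective \<open>N1\<close> would give
  \<open>N1 * C1 = 1\<close> and contradict \<open>left_inverse_dim_le\<close>.\<close>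

lemma basis_matrix_enlarge:
  fixes N :: "'a :: field mat"
  assumes C: "C \<in> carrier_mat r n" and N: "N \<in> carrier_mat n r" and CN: "C * N = 1\<^sub>m r"
    and "r \<le> k" "k \<le> n"
  obtains N' C' where "N' \<in> carrier_mat n k" "C' \<in> carrier_mat k n" "C' * N' = 1\<^sub>m k"
    "mrange N \<subseteq> mrange N'"
proof -
  have "r \<le> k \<Longrightarrow> k \<le> n \<Longrightarrow> \<exists>N' C'. N' \<in> carrier_mat n k \<and> C' \<in> carrier_mat k n \<and> C' * N' = 1\<^sub>m k \<and>
    mrange N \<subseteq> mrange N'"
  proof (induction k rule: dec_induct)
    case base
    show ?case using C N CN by blast
  next
    case (step k)
    then obtain N1 C1 where 1: "N1 \<in> carrier_mat n k" "C1 \<in> carrier_mat k n" "C1 * N1 = 1\<^sub>m k"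
      "mrange N \<subseteq> mrange N1" by auto
    have "\<exists>y\<in>carrier_vec n. y \<notin> mrange N1"
    proof (rule ccontr)
      assume *: "\<not> ?thesis"
      have "N1 * C1 = 1\<^sub>m n"
      proof (rule mat_col_eqI)
        fix j assume "j < dim_col (1\<^sub>m n :: 'a mat)"
        hence j: "j < n" by simp
        have "unit_vec n j \<in> mrange N1" using * by auto
        then obtain u where u: "u \<in> carrier_vec k" "unit_vec n j = N1 *\<^sub>v u" using 1 by (auto simp: mrange_def)
        have "col (N1 * C1) j = (N1 * C1) *\<^sub>v unit_vec n j" using j 1
          by (metis carrier_matD(2) index_mult_mat(3) mat_mult_unit_vec)
        also have "\<dots> = N1 *\<^sub>v (C1 *\<^sub>v unit_vec n j)" using 1 by (intro assoc_mult_mat_vec) auto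
        also have "\<dots> = unit_vec n j" unfolding u(2) using left_inverse_inj[OF 1(2,1,3) u(1)] by simp
        finally show "col (N1 * C1) j = col (1\<^sub>m n) j" using j by simp
      qed (use 1 in auto)
      from left_inverse_dim_le[OF 1(1,2) this] step show False by simp
    qed
    then obtain y where y: "y \<in> carrier_vec n" "y \<notin> mrange N1" by blast
    obtain C' N' where *: "C' \<in> carrier_mat (Suc k) n" "N' \<in> carrier_mat n (Suc k)"
        "C' * N' = 1\<^sub>m (Suc k)" and col: "\<And>j. j < k \<Longrightarrow> col N' j = col N1 j"
      using left_inverse_extend[OF 1(2,1,3) y] by metis
    from mrange_extend[OF *(2) 1(1) col] 1(4) * show ?case by blast
  qed
  with assms that show thesis by blast
qed

lemma mat_kernel_subspace:
  assumes A: "A \<in> carrier_mat m n"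
  shows "vec_subspace n (mat_kernel A)"
  unfolding vec_subspace_def mat_kernel[OF A] using A
  by (auto simp: mult_add_distrib_mat_vec[OF A] mult_mat_vec)

lemma mrange_subspace:
  assumes A: "A \<in> carrier_mat m n"
  shows "vec_subspace m (mrange A)"
  unfolding vec_subspace_def mrange_def
proof (intro conjI ballI allI)
  show "0\<^sub>v m \<in> (*\<^sub>v) A ` carrier_vec (dim_col A)"
    using A by (intro image_eqI[of _ _ "0\<^sub>v n"]) auto
next
  fix x y assume "x \<in> (*\<^sub>v) A ` carrier_vec (dim_col A)" "y \<in> (*\<^sub>v) A ` carrier_vec (dim_col A)"
  then obtain u v where "u \<in> carrier_vec n" "v \<in> carrier_vec n" "x = A *\<^sub>v u" "y = A *\<^sub>v v" using A by auto
  thus "x + y \<in> (*\<^sub>v) A ` carrier_vec (dim_col A)" using A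
    by (intro image_eqI[of _ _ "u + v"]) (auto simp: mult_add_distrib_mat_vec[OF A])
next
  fix c x assume "x \<in> (*\<^sub>v) A ` carrier_vec (dim_col A)"
  then obtain u where "u \<in> carrier_vec n" "x = A *\<^sub>v u" using A by auto
  thus "c \<cdot>\<^sub>v x \<in> (*\<^sub>v) A ` carrier_vec (dim_col A)" using A
    by (intro image_eqI[of _ _ "c \<cdot>\<^sub>v u"]) (auto simp: mult_mat_vec[OF A])
qed (use A in auto)

text \<open>\<open>D = 1 - X * W\<close> projects onto the kernel of \<open>W\<close> along the
  range of \<open>X\<close>. With \<open>N\<close> a basis of that kernel and \<open>C\<close> its
  coordinates, \<open>C * D\<close> supplies the complementary coordinates. The size
  \<open>n - r\<close> follows because the stacked matrix and the joined one are inverse to each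
  other in both orders.\<close>

lemma complement_matrix:
  fixes W X :: "'a :: field mat"
  assumes W: "W \<in> carrier_mat r n" and X: "X \<in> carrier_mat n r" and WX: "W * X = 1\<^sub>m r"
  obtains W' X' where "W' \<in> carrier_mat (n - r) n" "X' \<in> carrier_mat n (n - r)"
    "W' * X' = 1\<^sub>m (n - r)" "W * X' = 0\<^sub>m r (n - r)" "W' * X = 0\<^sub>m (n - r) r"
    "X * W + X' * W' = 1\<^sub>m n" "mrange X' = mat_kernel W"
proof -
  obtain s N C where N: "N \<in> carrier_mat n s" and C: "C \<in> carrier_mat s n" and CN: "C * N = 1\<^sub>m s"
    and ran: "mrange N = mat_kernel W"
    using subspace_basis_matrix[OF mat_kernel_subspace[OF W]] by metis
  have WN: "W * N = 0\<^sub>m r s"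
  proof (rule mat_col_eqI)
    fix j assume "j < dim_col (0\<^sub>m r s :: 'a mat)"
    hence j: "j < s" by simp
    have "col N j = N *\<^sub>v unit_vec s j" using j N by (metis carrier_matD(2) mat_mult_unit_vec)
    hence "col N j \<in> mat_kernel W" unfolding ran[symmetric] mrange_def using N by auto
    hence "W *\<^sub>v col N j = 0\<^sub>v r" by (auto simp: mat_kernel[OF W])
    thus "col (W * N) j = col (0\<^sub>m r s) j" using j col_mult2[OF W N j] by simp
  qed (use W N in auto)
  define D where "D = 1\<^sub>m n - X * W"
  have D: "D \<in> carrier_mat n n" using X W by (auto simp: D_def)
  have WD: "W * D = 0\<^sub>m r n"
    unfolding D_def using W X WX
    by (subst mult_minus_distrib_mat[of _ r n]) (auto simp: assoc_mult_mat[of _ r n _ r _ n, symmetric])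
  have DX: "D * X = 0\<^sub>m n r"
    unfolding D_def using W X WX
    by (subst minus_mult_distrib_mat[of _ n n]) (auto simp: assoc_mult_mat[of _ n r _ n _ r])
  have DN: "D * N = N"
    unfolding D_def using W X N WN
    by (subst minus_mult_distrib_mat[of _ n n]) (auto simp: assoc_mult_mat[of _ n r _ n _ s])
  have NCD: "N * (C * D) = D"
  proof (rule mult_left_inverse_of_mrange[OF C N CN D])
    fix j assume j: "j < n"
    have "W *\<^sub>v col D j = 0\<^sub>v r" using WD j W D by (metis col_mult2 col_zero)
    thus "col D j \<in> mrange N" unfolding ran mat_kernel[OF W] using D j by auto
  qed
  define W' where "W' = C * D"
  have W': "W' \<in> carrier_mat s n" using C D by (auto simp: W'_def)
  have W'N: "W' * N = 1\<^sub>m s" unfolding W'_def using C D N CN DN by (auto simp: assoc_mult_mat[of _ s n _ n _ s])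
  have W'X: "W' * X = 0\<^sub>m s r" unfolding W'_def using C D X DX by (auto simp: assoc_mult_mat[of _ s n _ n _ r])
  have sum: "X * W + N * W' = 1\<^sub>m n"
    unfolding W'_def NCD unfolding D_def using X W by (intro eq_matI) auto
  have 1: "(W @\<^sub>r W') * hcat X N = 1\<^sub>m (r + s)"
    using W W' X N by (subst append_rows_mult_hcat) (auto simp: WX W'N WN W'X)
  have 2: "hcat X N * (W @\<^sub>r W') = 1\<^sub>m n"
    using sum W W' X N by (subst hcat_mult_append_rows) auto
  have "r + s = n"
    using left_inverse_dim_le[OF _ _ 1, of n] left_inverse_dim_le[OF _ _ 2, of "r + s"] W W' X N
    by (metis antisym carrier_append_rows hcat_carrier)
  hence s: "s = n - r" by simp
  show thesis by (rule that[OF W'[unfolded s] N[unfolded s] W'N[unfolded s] WN[unfolded s] W'X[unfolded s] sum ran])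
qed

section \<open>Rank\<close>

text \<open>A full-rank factorization with one-sided inverses of both factors. \<open>C\<close> and
  \<open>G\<close> are the certificates that \<open>mrank_eq\<close> consumes; transposition
  exchanges their roles.\<close>

lemma rank_factorization:
  fixes M :: "'a :: field mat"
  assumes M: "M \<in> carrier_mat n m"
  obtains r N B C G where "N \<in> carrier_mat n r" "B \<in> carrier_mat r m" "C \<in> carrier_mat r n"
    "G \<in> carrier_mat m r" "M = N * B" "C * N = 1\<^sub>m r" "B * G = 1\<^sub>m r"
proof -
  obtain r N C where N: "N \<in> carrier_mat n r" and C: "C \<in> carrier_mat r n" and CN: "C * N = 1\<^sub>m r"
    and ran: "mrange N = mrange M"
    using subspace_basis_matrix[OF mrange_subspace[OF M]] by metis
  have NCM: "N * (C * M) = M"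
  proof (rule mult_left_inverse_of_mrange[OF C N CN M])
    fix j assume j: "j < m"
    have "col M j = M *\<^sub>v unit_vec m j" using j M by (metis carrier_matD(2) mat_mult_unit_vec)
    hence "col M j \<in> mrange M" unfolding mrange_def using M by auto
    thus "col M j \<in> mrange N" unfolding ran .
  qed
  have "\<exists>g\<in>carrier_vec m. M *\<^sub>v g = col N j" if "j < r" for j
  proof -
    have "col N j = N *\<^sub>v unit_vec r j" using that N by (metis carrier_matD(2) mat_mult_unit_vec)
    hence "col N j \<in> mrange N" unfolding mrange_def using N by auto
    hence "col N j \<in> mrange M" unfolding ran .
    thus ?thesis using M by (auto simp: mrange_def)
  qed
  then obtain g where g: "\<And>j. j < r \<Longrightarrow> g j \<in> carrier_vec m \<and> M *\<^sub>v g j = col N j" by metis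
  define G where "G = mat_of_cols m (map g [0..<r])"
  have G: "G \<in> carrier_mat m r" by (auto simp: G_def)
  have MG: "M * G = N"
  proof (rule mat_col_eqI)
    fix j assume "j < dim_col N"
    hence j: "j < r" using N by simp
    have "col G j = g j" using j g by (simp add: G_def col_mat_of_cols)
    thus "col (M * G) j = col N j" using j g col_mult2[OF M G j] by simp
  qed (use N M G in auto)
  have "(C * M) * G = 1\<^sub>m r" using C M G MG CN by (auto simp: assoc_mult_mat[of _ r n _ m _ r])
  with that[OF N _ C G NCM[symmetric] CN] C M show thesis by auto
qed

text \<open>The right inverse of \<open>B\<close> makes the column spaces of \<open>N * B\<close>
  and \<open>N\<close> equal, and the left inverse of \<open>N\<close> makes its columns distinct
  and independent.\<close>

lemma mrank_eq:
  assumes N: "N \<in> carrier_mat n r" and B: "B \<in> carrier_mat r m" and C: "C \<in> carrier_mat r n"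
    and G: "G \<in> carrier_mat m r" and CN: "C * N = 1\<^sub>m r" and BG: "B * G = 1\<^sub>m r"
  shows "mrank (N * B) = r"
proof -
  interpret vec_space "TYPE(complex)" n .
  have inj: "v = 0\<^sub>v r" if "v \<in> carrier_vec r" "N *\<^sub>v v = 0\<^sub>v n" for v
    using left_inverse_inj[OF C N CN that(1)] that(2) C by (metis mult_mat_vec_carrier zero_carrier_vec
        mult_minus_distrib_mat_vec minus_cancel_vec)
  have NB: "N * B \<in> carrier_mat n m" using N B by auto
  have "col_space (N * B) = col_space N"
    unfolding col_space_eq[OF NB] col_space_eq[OF N]
  proof (rule Collect_cong, rule conj_cong)
    fix y
    show "(\<exists>x\<in>carrier_vec (dim_col (N * B)). N * B *\<^sub>v x = y) = (\<exists>x\<in>carrier_vec (dim_col N). N *\<^sub>v x = y)"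
    proof
    assume "\<exists>x\<in>carrier_vec (dim_col (N * B)). N * B *\<^sub>v x = y"
    then obtain x where "x \<in> carrier_vec m" "N * B *\<^sub>v x = y" using B by auto
    thus "\<exists>x\<in>carrier_vec (dim_col N). N *\<^sub>v x = y" using N B
      by (intro bexI[of _ "B *\<^sub>v x"]) (auto simp: assoc_mult_mat_vec[of _ n r _ m])
  next
    assume "\<exists>x\<in>carrier_vec (dim_col N). N *\<^sub>v x = y"
    then obtain x where "x \<in> carrier_vec r" "N *\<^sub>v x = y" using N by auto
    thus "\<exists>x\<in>carrier_vec (dim_col (N * B)). N * B *\<^sub>v x = y"
      using N B G left_inverse_inj[OF B G BG, of x]
      by (intro bexI[of _ "G *\<^sub>v x"]) (auto simp: assoc_mult_mat_vec[of _ n r _ m])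
    qed
  qed (use N B in auto)
  hence "rank (N * B) = rank N" unfolding rank_def col_space_def by simp
  moreover have dist: "distinct (cols N)"
  proof -
    have "i = j" if "i < r" "j < r" "col N i = col N j" for i j
    proof (rule ccontr)
      assume "i \<noteq> j"
      have "C *\<^sub>v col N i = col (1\<^sub>m r) i" if "i < r" for i
        unfolding CN[symmetric] using col_mult2[OF C N that] by simp
      hence "unit_vec r i = (unit_vec r j :: complex vec)" using that by (metis col_one)
      hence "(unit_vec r i :: complex vec) $ i = unit_vec r j $ i" by simp
      thus False using that \<open>i \<noteq> j\<close> by simp
    qed
    thus ?thesis using N by (auto simp: distinct_conv_nth)
  qed
  moreover have "lin_indpt (set (cols N))"
    using lin_depE[OF N _ dist] inj by metis
  ultimately have "rank (N * B) = r" using lin_indpt_full_rank[OF N] by simp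
  thus ?thesis unfolding mrank_def using N by auto
qed


text \<open>Rank-nullity with certificates: in a rank factorization \<open>N * B\<close> of
  \<open>M\<close> the first factor is injective, so \<open>M\<close> and \<open>B\<close> have the
  same kernel, and \<open>complement_matrix\<close> applied to \<open>B\<close> gives a basis of
  it.\<close>

lemma mrank_nullspace:
  assumes M: "M \<in> carrier_mat n m"
  obtains N W where "N \<in> carrier_mat m (m - mrank M)" "W \<in> carrier_mat (m - mrank M) m"
    "W * N = 1\<^sub>m (m - mrank M)" "mrange N = mat_kernel M" "mrank M \<le> m" "mrank M \<le> n"
proof -
  obtain r N B C G where *: "N \<in> carrier_mat n r" "B \<in> carrier_mat r m" "C \<in> carrier_mat r n"
    "G \<in> carrier_mat m r" "M = N * B" "C * N = 1\<^sub>m r" "B * G = 1\<^sub>m r"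
    by (rule rank_factorization[OF M])
  have r: "mrank M = r" unfolding *(5) by (rule mrank_eq[OF *(1-4,6,7)])
  obtain W' X' where c: "W' \<in> carrier_mat (m - r) m" "X' \<in> carrier_mat m (m - r)"
    "W' * X' = 1\<^sub>m (m - r)" "mrange X' = mat_kernel B"
    using complement_matrix[OF *(2,4,7)] by metis
  have "mat_kernel B = mat_kernel M"
    unfolding *(5) using mat_kernel_mult_subset[OF *(2,1)]
  proof (intro equalityI subsetI)
    fix v assume "v \<in> mat_kernel (N * B)"
    hence v: "v \<in> carrier_vec m" and z: "N *\<^sub>v (B *\<^sub>v v) = 0\<^sub>v n"
      using * by (auto simp: mat_kernel[of _ n m] assoc_mult_mat_vec[of _ n r _ m])
    have "B *\<^sub>v v = C *\<^sub>v (N *\<^sub>v (B *\<^sub>v v))"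
      using left_inverse_inj[OF *(3,1,6), of "B *\<^sub>v v"] *(2) v by simp
    also have "\<dots> = 0\<^sub>v r" unfolding z using *(3) by auto
    finally show "v \<in> mat_kernel B" using *(2) v by (simp add: mat_kernel[of _ r m])
  qed auto
  with c r that left_inverse_dim_le[OF *(2,4,7)] left_inverse_dim_le[OF *(3,1,6)] show thesis by auto
qed

lemma mrank_transpose:
  "mrank (transpose_mat M) = mrank M"
proof -
  define n m where "n = dim_row M" and "m = dim_col M"
  have M: "M \<in> carrier_mat n m" by (auto simp: n_def m_def)
  obtain r N B C G where *: "N \<in> carrier_mat n r" "B \<in> carrier_mat r m" "C \<in> carrier_mat r n"
    "G \<in> carrier_mat m r" "M = N * B" "C * N = 1\<^sub>m r" "B * G = 1\<^sub>m r"
    by (rule rank_factorization[OF M])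
  have r: "mrank M = r" unfolding *(5) by (rule mrank_eq[OF *(1-4,6,7)])
  have "transpose_mat G * transpose_mat B = 1\<^sub>m r" "transpose_mat N * transpose_mat C = 1\<^sub>m r"
    using transpose_mult[OF *(2,4)] transpose_mult[OF *(3,1)]
    unfolding *(6,7) by (metis transpose_one)+
  hence "mrank (transpose_mat B * transpose_mat N) = r" using * by (intro mrank_eq) auto
  thus ?thesis using transpose_mult[OF *(1,2)] *(5) r by simp
qed

text \<open>The columns of \<open>N\<close> have coordinates \<open>Y * N\<close> in a kernel basis
  \<open>X\<close>, so the identity of size \<open>s\<close> factors through dimension
  \<open>m - mrank M\<close>.\<close>

lemma nullity_bound:
  assumes M: "M \<in> carrier_mat n m" and N: "N \<in> carrier_mat m s" and W: "W \<in> carrier_mat s m"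
    and WN: "W * N = 1\<^sub>m s" and MN: "M * N = 0\<^sub>m n s"
  shows "s \<le> m - mrank M"
proof -
  obtain X Y where X: "X \<in> carrier_mat m (m - mrank M)" and Y: "Y \<in> carrier_mat (m - mrank M) m"
    and YX: "Y * X = 1\<^sub>m (m - mrank M)" and ran: "mrange X = mat_kernel M"
    using mrank_nullspace[OF M] by metis
  have XYN: "X * (Y * N) = N"
  proof (rule mult_left_inverse_of_mrange[OF Y X YX N])
    fix j assume j: "j < s"
    have "M *\<^sub>v col N j = 0\<^sub>v n" using MN j N M by (metis col_mult2 col_zero)
    thus "col N j \<in> mrange X" unfolding ran mat_kernel[OF M] using N j by auto
  qed
  have "(W * X) * (Y * N) = 1\<^sub>m s"
    using W X Y N XYN WN by (simp add: assoc_mult_mat[of _ s m _ "m - mrank M" _ s])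
  thus ?thesis using W X Y N by (intro left_inverse_dim_le[of "W * X" s _ "Y * N"]) auto
qed

lemma mrank_det:
  assumes "M \<in> carrier_mat n n"
  shows "mrank M = n \<longleftrightarrow> det M \<noteq> 0"
  using vec_space.det_rank_iff[OF assms] assms by (auto simp: mrank_def)

section \<open>Polynomial functions and genericity\<close>

text \<open>A property of functions on \<open>carrier_vec d\<close>, so that determinants of
  matrices with variable entries can be treated entry by entry.\<close>

definition poly_fun :: "nat \<Rightarrow> (complex vec \<Rightarrow> complex) \<Rightarrow> bool" where
  "poly_fun d f \<longleftrightarrow> (\<exists>p. in_vars d p \<and> (\<forall>x\<in>carrier_vec d. cmpoly_eval p x = f x))"

text \<open>The product runs over all variables below \<open>d\<close>, absent ones having exponent
  0. Addition of exponents thereby becomes multiplication of values.\<close>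

definition monom_fun :: "nat \<Rightarrow> (nat \<Rightarrow>\<^sub>0 nat) \<Rightarrow> complex vec \<Rightarrow> complex" where
  "monom_fun d m x = (\<Prod>i<d. (x $ i) ^ Poly_Mapping.lookup m i)"

lemma monom_fun_keys:
  assumes "Poly_Mapping.keys m \<subseteq> {..<d}"
  shows "(\<Prod>i\<in>Poly_Mapping.keys m. (x $ i) ^ Poly_Mapping.lookup m i) = monom_fun d m x"
  unfolding monom_fun_def using assms
  by (intro prod.mono_neutral_left) (auto simp: in_keys_iff)

lemma cmpoly_eval_superset:
  assumes "finite T" "Poly_Mapping.keys p \<subseteq> T"
  shows "cmpoly_eval p x = (\<Sum>m\<in>T. Poly_Mapping.lookup p m *
    (\<Prod>i\<in>Poly_Mapping.keys m. (x $ i) ^ Poly_Mapping.lookup m i))"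
  unfolding cmpoly_eval_def using assms
  by (intro sum.mono_neutral_left) (auto simp: in_keys_iff)

lemma cmpoly_eval_add: "cmpoly_eval (p + q) x = cmpoly_eval p x + cmpoly_eval q x"
proof -
  let ?T = "Poly_Mapping.keys p \<union> Poly_Mapping.keys q"
  have "cmpoly_eval r x = (\<Sum>m\<in>?T. Poly_Mapping.lookup r m *
    (\<Prod>i\<in>Poly_Mapping.keys m. (x $ i) ^ Poly_Mapping.lookup m i))" if "r \<in> {p, q, p + q}" for r
    using that Poly_Mapping.keys_add[of p q] by (intro cmpoly_eval_superset) auto
  thus ?thesis by (simp add: lookup_add algebra_simps sum.distrib)
qed

lemma poly_fun_add:
  assumes "poly_fun d f" "poly_fun d g"
  shows "poly_fun d (\<lambda>x. f x + g x)"
proof -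
  obtain p q where *: "in_vars d p" "\<forall>x\<in>carrier_vec d. cmpoly_eval p x = f x"
    "in_vars d q" "\<forall>x\<in>carrier_vec d. cmpoly_eval q x = g x"
    using assms unfolding poly_fun_def by blast
  have "in_vars d (p + q)" using *(1,3) Poly_Mapping.keys_add[of p q] unfolding in_vars_def by blast
  thus ?thesis unfolding poly_fun_def using * by (intro exI[of _ "p + q"]) (auto simp: cmpoly_eval_add)
qed

lemma poly_fun_monom:
  assumes "Poly_Mapping.keys m \<subseteq> {..<d}"
  shows "poly_fun d (\<lambda>x. c * monom_fun d m x)"
proof -
  have "cmpoly_eval (Poly_Mapping.single m c) x = c * monom_fun d m x" for x
    using cmpoly_eval_superset[of "{m}" "Poly_Mapping.single m c" x]
    by (simp add: monom_fun_keys[OF assms])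
  moreover have "in_vars d (Poly_Mapping.single m c)" using assms by (simp add: in_vars_def)
  ultimately show ?thesis unfolding poly_fun_def by blast
qed

lemma poly_fun_sum:
  assumes "\<And>s. s \<in> S \<Longrightarrow> poly_fun d (f s)"
  shows "poly_fun d (\<lambda>x. \<Sum>s\<in>S. f s x)"
proof -
  have 0: "poly_fun d (\<lambda>x. 0)"
    unfolding poly_fun_def by (intro exI[of _ 0]) (auto simp: in_vars_def cmpoly_eval_def)
  show ?thesis
  proof (cases "finite S")
    case True
    from this assms show ?thesis by (induction S rule: finite_induct) (auto intro: poly_fun_add 0)
  qed (use 0 in auto)
qed

text \<open>Exposes a finite set of monomials, so that products and restrictions to lines can be
  computed term by term.\<close>

lemma poly_fun_monom_sum:
  assumes "poly_fun d f"
  shows "\<exists>S c. finite S \<and> (\<forall>m\<in>S. Poly_Mapping.keys m \<subseteq> {..<d}) \<and>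
    (\<forall>x\<in>carrier_vec d. f x = (\<Sum>m\<in>S. c m * monom_fun d m x))"
proof -
  obtain p where p: "in_vars d p" "\<forall>x\<in>carrier_vec d. cmpoly_eval p x = f x"
    using assms unfolding poly_fun_def by blast
  have "f x = (\<Sum>m\<in>Poly_Mapping.keys p. Poly_Mapping.lookup p m * monom_fun d m x)"
    if "x \<in> carrier_vec d" for x
    unfolding p(2)[rule_format, OF that, symmetric] cmpoly_eval_def
    using p(1) by (intro sum.cong) (auto simp: in_vars_def monom_fun_keys)
  with p(1) show ?thesis
    by (intro exI[of _ "Poly_Mapping.keys p"] exI[of _ "Poly_Mapping.lookup p"]) (auto simp: in_vars_def)
qed

lemma poly_fun_cong:
  assumes "poly_fun d f" "\<And>x. x \<in> carrier_vec d \<Longrightarrow> f x = g x"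
  shows "poly_fun d g"
  using assms unfolding poly_fun_def by auto

lemma poly_fun_mult:
  assumes "poly_fun d f" "poly_fun d g"
  shows "poly_fun d (\<lambda>x. f x * g x)"
proof -
  obtain S c where S: "finite S" "\<forall>m\<in>S. Poly_Mapping.keys m \<subseteq> {..<d}"
    "\<forall>x\<in>carrier_vec d. f x = (\<Sum>m\<in>S. c m * monom_fun d m x)"
    using poly_fun_monom_sum[OF assms(1)] by auto
  obtain T e where T: "finite T" "\<forall>m\<in>T. Poly_Mapping.keys m \<subseteq> {..<d}"
    "\<forall>x\<in>carrier_vec d. g x = (\<Sum>m\<in>T. e m * monom_fun d m x)"
    using poly_fun_monom_sum[OF assms(2)] by auto
  have "poly_fun d (\<lambda>x. \<Sum>m\<in>S. \<Sum>l\<in>T. (c m * e l) * monom_fun d (m + l) x)"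
  proof (intro poly_fun_sum poly_fun_monom)
    fix m l assume "m \<in> S" "l \<in> T"
    thus "Poly_Mapping.keys (m + l) \<subseteq> {..<d}"
      using S(2) T(2) Poly_Mapping.keys_add[of m l] by blast
  qed
  moreover have "monom_fun d (m + l) x = monom_fun d m x * monom_fun d l x" for m l x
    by (simp add: monom_fun_def lookup_add power_add prod.distrib)
  ultimately show ?thesis
    by (elim poly_fun_cong) (simp add: S(3) T(3) sum_product mult_ac)
qed

lemma poly_fun_const: "poly_fun d (\<lambda>x. c)"
  using poly_fun_monom[of 0 d c] by (simp add: monom_fun_def)

lemma poly_fun_index:
  assumes "i < d"
  shows "poly_fun d (\<lambda>x. x $ i)"
proof -
  have "monom_fun d (Poly_Mapping.single i 1) x = x $ i" for x
    using assms by (simp add: monom_fun_def lookup_single when_def if_distrib[of "\<lambda>e. _ ^ e"] prod.delta cong: if_cong)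
  thus ?thesis using poly_fun_monom[of "Poly_Mapping.single i 1" d 1] assms by simp
qed

lemma poly_fun_prod:
  assumes "\<And>s. s \<in> S \<Longrightarrow> poly_fun d (f s)"
  shows "poly_fun d (\<lambda>x. \<Prod>s\<in>S. f s x)"
proof (cases "finite S")
  case True
  from this assms show ?thesis
    by (induction S rule: finite_induct) (auto intro: poly_fun_mult poly_fun_const)
qed (auto intro: poly_fun_const)

lemma poly_fun_det:
  assumes "\<And>x. M x \<in> carrier_mat n n"
    and "\<And>i j. i < n \<Longrightarrow> j < n \<Longrightarrow> poly_fun d (\<lambda>x. M x $$ (i,j))"
  shows "poly_fun d (\<lambda>x. det (M x))"
  unfolding det_def'[OF assms(1)]
  by (intro poly_fun_sum poly_fun_mult poly_fun_const poly_fun_prod assms(2))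
    (auto simp: permutes_in_image)

lemma poly_fun_line:
  assumes "poly_fun d f" "x \<in> carrier_vec d" "y \<in> carrier_vec d"
  obtains q where "\<And>t. f (x + t \<cdot>\<^sub>v y) = poly q t"
proof -
  obtain S c where S: "finite S" "\<forall>m\<in>S. Poly_Mapping.keys m \<subseteq> {..<d}"
    "\<forall>x\<in>carrier_vec d. f x = (\<Sum>m\<in>S. c m * monom_fun d m x)"
    using poly_fun_monom_sum[OF assms(1)] by auto
  show thesis
  proof (rule that)
    fix t
    show "f (x + t \<cdot>\<^sub>v y) =
      poly (\<Sum>m\<in>S. Polynomial.smult (c m) (\<Prod>i<d. [:x $ i, y $ i:] ^ Poly_Mapping.lookup m i)) t"
      using assms(2,3) by (simp add: S(3) monom_fun_def poly_sum poly_prod mult.commute)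
  qed
qed

text \<open>On the line joining a common nonzero point of \<open>F\<close> to a nonzero point of the
  new \<open>f\<close>, both \<open>f\<close> and the product over \<open>F\<close> restrict to
  nonzero polynomials in one variable. Some parameter avoids their finitely many roots.\<close>

lemma poly_fun_common_nonzero:
  assumes "finite F" "\<And>f. f \<in> F \<Longrightarrow> poly_fun d f"
    "\<And>f. f \<in> F \<Longrightarrow> \<exists>x\<in>carrier_vec d. f x \<noteq> 0"
  shows "\<exists>x\<in>carrier_vec d. \<forall>f\<in>F. f x \<noteq> 0"
  using assms
proof (induction F rule: finite_induct)
  case empty
  show ?case by (intro bexI[of _ "0\<^sub>v d"]) auto
next
  case (insert f F)
  obtain x where x: "x \<in> carrier_vec d" "\<forall>f\<in>F. f x \<noteq> 0" using insert by blast
  obtain y where y: "y \<in> carrier_vec d" "f y \<noteq> 0" using insert by blast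
  define g where "g = (\<lambda>x. \<Prod>f\<in>F. f x)"
  have g: "poly_fun d g" unfolding g_def using insert by (intro poly_fun_prod) auto
  obtain p where p: "\<And>t. f (x + t \<cdot>\<^sub>v (y - x)) = poly p t"
    using poly_fun_line[of d f x "y - x"] insert.prems x y by auto
  obtain q where q: "\<And>t. g (x + t \<cdot>\<^sub>v (y - x)) = poly q t"
    using poly_fun_line[of d g x "y - x"] g x y by auto
  have "x + 1 \<cdot>\<^sub>v (y - x) = y" using x y by (intro eq_vecI) auto
  hence "poly p 1 = f y" using p[of 1] by simp
  hence p0: "p \<noteq> 0" using y by auto
  have "x + 0 \<cdot>\<^sub>v (y - x) = x" using x y by (intro eq_vecI) auto
  hence "poly q 0 = g x" using q[of 0] by simp
  hence q0: "q \<noteq> 0" using x insert.hyps by (auto simp: g_def)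
  have "finite {t. poly (p * q) t = 0}" using p0 q0 by (intro poly_roots_finite) auto
  then obtain t where t: "poly (p * q) t \<noteq> 0" using ex_new_if_finite[OF infinite_UNIV_char_0]
    by blast
  have "f (x + t \<cdot>\<^sub>v (y - x)) \<noteq> 0" "g (x + t \<cdot>\<^sub>v (y - x)) \<noteq> 0" using t p q by auto
  thus ?case using x y insert.hyps by (intro bexI[of _ "x + t \<cdot>\<^sub>v (y - x)"]) (auto simp: g_def)
qed

text \<open>One polynomial is enough for the exceptional set: the product of all members of
  \<open>F\<close>, which is nonzero somewhere by the previous lemma.\<close>

lemma generic_nonvanishing:
  assumes F: "finite F" "\<And>f. f \<in> F \<Longrightarrow> poly_fun d f"
    "\<And>f. f \<in> F \<Longrightarrow> \<exists>x\<in>carrier_vec d. f x \<noteq> 0"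
  shows "generic_set d {x \<in> carrier_vec d. \<forall>f\<in>F. f x \<noteq> 0}"
proof -
  define g where "g = (\<lambda>x. \<Prod>f\<in>F. f x)"
  have "poly_fun d g" unfolding g_def using assms by (intro poly_fun_prod) auto
  then obtain p where p: "in_vars d p" "\<And>x. x \<in> carrier_vec d \<Longrightarrow> cmpoly_eval p x = g x"
    unfolding poly_fun_def by blast
  define Z where "Z = {x \<in> carrier_vec d. g x = 0}"
  have "algebraic_set d Z" unfolding algebraic_set_def Z_def
    using p by (intro exI[of _ "{p}"]) auto
  moreover have "Z \<noteq> carrier_vec d"
    using poly_fun_common_nonzero[OF F] F(1) by (auto simp: Z_def g_def)
  moreover have "carrier_vec d - {x \<in> carrier_vec d. \<forall>f\<in>F. f x \<noteq> 0} \<subseteq> Z"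
    using F(1) by (auto simp: Z_def g_def)
  ultimately show ?thesis unfolding generic_set_def by blast
qed

section \<open>Generic conditions on a pair of matrices\<close>

definition unpair_left :: "nat \<Rightarrow> nat \<Rightarrow> complex vec \<Rightarrow> complex mat" where
  "unpair_left n k x = mat n k (\<lambda>(i,j). x $ (i * k + j))"

definition unpair_right :: "nat \<Rightarrow> nat \<Rightarrow> complex vec \<Rightarrow> complex mat" where
  "unpair_right n k x = mat k n (\<lambda>(i,j). x $ (n * k + (i * n + j)))"

lemma mat_adjoint_carrier: "A \<in> carrier_mat n m \<Longrightarrow> mat_adjoint A \<in> carrier_mat m n"
  unfolding mat_adjoint_def mat_of_rows_def by auto

lemma mult_add_less: "i < a \<Longrightarrow> j < b \<Longrightarrow> i * b + j < a * (b :: nat)"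
proof -
  assume *: "i < a" "j < b"
  hence "i * b + j < Suc i * b" by simp
  also have "\<dots> \<le> a * b" using * by (intro mult_le_mono1) auto
  finally show ?thesis .
qed

lemma unpair_left_pair_vec:
  assumes "U \<in> carrier_mat n k"
  shows "unpair_left n k (pair_vec n k U W) = U"
proof (rule eq_matI)
  fix i j assume "i < dim_row U" "j < dim_col U"
  hence ij: "i < n" "j < k" using assms by auto
  thus "unpair_left n k (pair_vec n k U W) $$ (i,j) = U $$ (i,j)"
    using mult_add_less[OF ij] by (simp add: unpair_left_def pair_vec_def)
qed (use assms in \<open>auto simp: unpair_left_def\<close>)

lemma unpair_right_pair_vec:
  assumes "W \<in> carrier_mat k n"
  shows "unpair_right n k (pair_vec n k U W) = W"
proof (rule eq_matI)
  fix i j assume "i < dim_row W" "j < dim_col W"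
  hence ij: "i < k" "j < n" using assms by auto
  thus "unpair_right n k (pair_vec n k U W) $$ (i,j) = W $$ (i,j)"
    using mult_add_less[OF ij] by (simp add: unpair_right_def pair_vec_def mult.commute)
qed (use assms in \<open>auto simp: unpair_right_def\<close>)

lemma pair_vec_carrier: "pair_vec n k U W \<in> carrier_vec (2 * n * k)"
  by (simp add: pair_vec_def)

text \<open>A right inverse \<open>X\<close> of \<open>C\<close> gives
  \<open>det (C * X) = 1\<close>, so the polynomial \<open>det (C * U)\<close> does not vanish
  identically; left inverses do the same for the matrices in \<open>Ns\<close>. As the coordinates
  are the entries of the adjoint of \<open>V\<close>, no conjugation enters the polynomials.\<close>

lemma holds_genericallyI:
  assumes "finite Cs" "finite Ns"
    and Cs: "\<And>C. C \<in> Cs \<Longrightarrow> C \<in> carrier_mat k n \<and> (\<exists>X\<in>carrier_mat n k. C * X = 1\<^sub>m k)"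
    and Ns: "\<And>N. N \<in> Ns \<Longrightarrow> N \<in> carrier_mat n k \<and> (\<exists>X\<in>carrier_mat k n. X * N = 1\<^sub>m k)"
    and Pr: "\<And>U V. U \<in> carrier_mat n k \<Longrightarrow> V \<in> carrier_mat n k \<Longrightarrow>
      (\<And>C. C \<in> Cs \<Longrightarrow> det (C * U) \<noteq> 0) \<Longrightarrow>
      (\<And>N. N \<in> Ns \<Longrightarrow> det (mat_adjoint V * N) \<noteq> 0) \<Longrightarrow> Pr U V"
  shows "holds_generically n k Pr"
proof -
  define d where "d = 2 * n * k"
  define F where "F = (\<lambda>C x. det (C * unpair_left n k x)) ` Cs \<union> (\<lambda>N x. det (unpair_right n k x * N)) ` Ns"
  have left: "unpair_left n k x \<in> carrier_mat n k" and right: "unpair_right n k x \<in> carrier_mat k n" for x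
    by (auto simp: unpair_left_def unpair_right_def)
  have entry_left: "poly_fun d (\<lambda>x. unpair_left n k x $$ (i,j))" if "i < n" "j < k" for i j
  proof -
    have "i * k + j < d" using mult_add_less[OF that] by (simp add: d_def)
    from poly_fun_index[OF this] show ?thesis using that by (simp add: unpair_left_def)
  qed
  have "poly_fun d (\<lambda>x. (C * unpair_left n k x) $$ (i,j))"
    if "C \<in> carrier_mat k n" "i < k" "j < k" for C i j
  proof -
    have "(C * unpair_left n k x) $$ (i,j) = (\<Sum>l\<in>{0..<n}. C $$ (i,l) * unpair_left n k x $$ (l,j))" for x
      using that left[of x] by (simp add: scalar_prod_def)
    thus ?thesis using that entry_left by (auto intro!: poly_fun_sum poly_fun_mult poly_fun_const)
  qed
  hence 1: "poly_fun d (\<lambda>x. det (C * unpair_left n k x))" if "C \<in> Cs" for C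
    using Cs[OF that] by (intro poly_fun_det[of _ k]) (auto intro: mult_carrier_mat left)
  have entry_right: "poly_fun d (\<lambda>x. unpair_right n k x $$ (i,j))" if "i < k" "j < n" for i j
  proof -
    have "n * k + (i * n + j) < d" using mult_add_less[OF that] by (simp add: d_def mult.commute)
    from poly_fun_index[OF this] show ?thesis using that by (simp add: unpair_right_def)
  qed
  have "poly_fun d (\<lambda>x. (unpair_right n k x * N) $$ (i,j))"
    if "N \<in> carrier_mat n k" "i < k" "j < k" for N i j
  proof -
    have "(unpair_right n k x * N) $$ (i,j) = (\<Sum>l\<in>{0..<n}. unpair_right n k x $$ (i,l) * N $$ (l,j))" for x
      using that right[of x] by (simp add: scalar_prod_def)
    thus ?thesis using that entry_right by (auto intro!: poly_fun_sum poly_fun_mult poly_fun_const)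
  qed
  hence 2: "poly_fun d (\<lambda>x. det (unpair_right n k x * N))" if "N \<in> Ns" for N
    using Ns[OF that] by (intro poly_fun_det[of _ k]) (auto intro: mult_carrier_mat right)
  have 3: "\<exists>x\<in>carrier_vec d. det (C * unpair_left n k x) \<noteq> 0" if "C \<in> Cs" for C
  proof -
    obtain X where "X \<in> carrier_mat n k" "C * X = 1\<^sub>m k" using Cs[OF \<open>C \<in> Cs\<close>] by blast
    thus ?thesis using pair_vec_carrier[of n k X "0\<^sub>m k n"]
      by (intro bexI[of _ "pair_vec n k X (0\<^sub>m k n)"]) (auto simp: unpair_left_pair_vec d_def)
  qed
  have 4: "\<exists>x\<in>carrier_vec d. det (unpair_right n k x * N) \<noteq> 0" if "N \<in> Ns" for N
  proof -
    obtain X where "X \<in> carrier_mat k n" "X * N = 1\<^sub>m k" using Ns[OF \<open>N \<in> Ns\<close>] by blast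
    thus ?thesis using pair_vec_carrier[of n k "0\<^sub>m n k" X]
      by (intro bexI[of _ "pair_vec n k (0\<^sub>m n k) X"]) (auto simp: unpair_right_pair_vec d_def)
  qed
  have "generic_set d {x \<in> carrier_vec d. \<forall>f\<in>F. f x \<noteq> 0}"
    by (rule generic_nonvanishing) (use assms(1,2) 1 2 3 4 in \<open>auto simp: F_def\<close>)
  moreover have "Pr U V" if "U \<in> carrier_mat n k" "V \<in> carrier_mat n k"
    "pair_vec n k U (mat_adjoint V) \<in> {x \<in> carrier_vec d. \<forall>f\<in>F. f x \<noteq> 0}" for U V
  proof -
    have V: "mat_adjoint V \<in> carrier_mat k n" using that(2)
      by (metis mat_adjoint_carrier)
    have "f (pair_vec n k U (mat_adjoint V)) \<noteq> 0" if "f \<in> F" for f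
      using that \<open>pair_vec n k U (mat_adjoint V) \<in> _\<close> by blast
    from this[of "\<lambda>x. det (_ * unpair_left n k x)"] this[of "\<lambda>x. det (unpair_right n k x * _)"]
    show ?thesis unfolding unpair_left_pair_vec[OF that(1)] unpair_right_pair_vec[OF V]
      by (intro Pr[OF that(1,2)]) (auto simp: F_def)
  qed
  ultimately show ?thesis unfolding holds_generically_def d_def by blast
qed

section \<open>Ranks of pencils\<close>

lemma det_nonzero_inverse:
  fixes M :: "'a :: field mat"
  assumes M: "M \<in> carrier_mat n n" and "det M \<noteq> 0"
  obtains E where "E \<in> carrier_mat n n" "E * M = 1\<^sub>m n" "M * E = 1\<^sub>m n"
proof -
  define E where "E = (1 / det M) \<cdot>\<^sub>m adj_mat M"
  have adj: "adj_mat M \<in> carrier_mat n n" "M * adj_mat M = det M \<cdot>\<^sub>m 1\<^sub>m n" "adj_mat M * M = det M \<cdot>\<^sub>m 1\<^sub>m n"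
    using adj_mat[OF M] by auto
  have "E \<in> carrier_mat n n" using adj by (auto simp: E_def)
  moreover have "E * M = 1\<^sub>m n" "M * E = 1\<^sub>m n" unfolding E_def
    using adj M assms(2) by (auto simp: mult_smult_assoc_mat[OF adj(1) M] mult_smult_distrib[OF M adj(1)])
  ultimately show thesis using that by blast
qed

lemma det_nonzero_kernel:
  fixes M :: "'a :: field mat"
  assumes M: "M \<in> carrier_mat n n" and "det M \<noteq> 0" "x \<in> carrier_vec n" "M *\<^sub>v x = 0\<^sub>v n"
  shows "x = 0\<^sub>v n"
  using assms det_0_iff_vec_prod_zero_field[OF M] by blast

lemma mrank_smult:
  assumes "c \<noteq> 0"
  shows "mrank (c \<cdot>\<^sub>m M) = mrank M"
proof -
  define n m where "n = dim_row M" and "m = dim_col M"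
  have M: "M \<in> carrier_mat n m" by (auto simp: n_def m_def)
  obtain r N B C G where *: "N \<in> carrier_mat n r" "B \<in> carrier_mat r m" "C \<in> carrier_mat r n"
    "G \<in> carrier_mat m r" "M = N * B" "C * N = 1\<^sub>m r" "B * G = 1\<^sub>m r"
    by (rule rank_factorization[OF M])
  have r: "mrank M = r" unfolding *(5) by (rule mrank_eq[OF *(1-4,6,7)])
  have "((1/c) \<cdot>\<^sub>m C) * (c \<cdot>\<^sub>m N) = c \<cdot>\<^sub>m ((1/c) \<cdot>\<^sub>m (C * N))" using *(1,3)
    by (simp add: mult_smult_assoc_mat[of _ r n _ r] mult_smult_distrib[of _ r n _ r])
  also have "\<dots> = 1\<^sub>m r" using *(6) assms by (auto intro!: eq_matI)
  finally have "mrank ((c \<cdot>\<^sub>m N) * B) = r" using * by (intro mrank_eq[of _ n r _ m "(1/c) \<cdot>\<^sub>m C" G]) auto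
  moreover have "(c \<cdot>\<^sub>m N) * B = c \<cdot>\<^sub>m M" using * by (simp add: mult_smult_assoc_mat[of _ n r _ m])
  ultimately show ?thesis using r by simp
qed

text \<open>An invertible compression \<open>C * M * G\<close> factors through the inner dimension
  of a rank factorization of \<open>M\<close>.\<close>

lemma mrank_lower_bound:
  assumes C: "C \<in> carrier_mat r n" and M: "M \<in> carrier_mat n m" and G: "G \<in> carrier_mat m r"
    and d: "det (C * M * G) \<noteq> 0"
  shows "r \<le> mrank M"
proof -
  obtain s N B C' G' where *: "N \<in> carrier_mat n s" "B \<in> carrier_mat s m" "C' \<in> carrier_mat s n"
    "G' \<in> carrier_mat m s" "M = N * B" "C' * N = 1\<^sub>m s" "B * G' = 1\<^sub>m s"
    by (rule rank_factorization[OF M])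
  have s: "mrank M = s" unfolding *(5) by (rule mrank_eq[OF *(1-4,6,7)])
  have "C * M * G \<in> carrier_mat r r" using C M G by auto
  from det_nonzero_inverse[OF this d] obtain E where E: "E \<in> carrier_mat r r" "E * (C * M * G) = 1\<^sub>m r" by metis
  have "(E * (C * N)) * (B * G) = E * (C * M * G)"
    using E(1) C G *(1,2) unfolding *(5)
    by (simp add: assoc_mult_mat[of _ r r _ s _ r] assoc_mult_mat[of _ r n _ s _ r] assoc_mult_mat[of _ r n _ m _ r]
        assoc_mult_mat[of _ n s _ m _ r])
  hence "(E * (C * N)) * (B * G) = 1\<^sub>m r" using E by simp
  thus ?thesis unfolding s using E(1) C G *(1,2)
    by (intro left_inverse_dim_le[of "E * (C * N)" r s "B * G"]) auto
qed

lemma pencil_carrier: "A \<in> carrier_mat n m \<Longrightarrow> B \<in> carrier_mat n m \<Longrightarrow> pencil A B z \<in> carrier_mat n m"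
  by (auto simp: pencil_def)

text \<open>The determinant is taken over the polynomial ring and then evaluated, evaluation being a
  ring homomorphism.\<close>

lemma det_pencil_poly:
  assumes X: "X \<in> carrier_mat r r" and Y: "Y \<in> carrier_mat r r"
  obtains p where "\<And>z. det (pencil X Y z) = poly p z"
proof -
  define P where "P = mat r r (\<lambda>(i,j). [:X $$ (i,j), - Y $$ (i,j):])"
  have "det (pencil X Y z) = poly (det P) z" for z
  proof -
    have hom: "comm_ring_hom (\<lambda>p :: complex poly. poly p z)" by unfold_locales auto
    have "pencil X Y z = map_mat (\<lambda>p. poly p z) P" using X Y
      by (intro eq_matI) (auto simp: P_def pencil_def)
    thus ?thesis using comm_ring_hom.hom_det[OF hom, of P] by simp
  qed
  with that show thesis by blast
qed

text \<open>The rank certificates at \<open>z0\<close> define the compressed pencil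
  \<open>C * pencil A B z * G\<close>. Its determinant is a polynomial in \<open>z\<close> with
  value 1 at \<open>z0\<close>, and the rank can fall below that at \<open>z0\<close> only at its
  roots.\<close>

lemma finite_low_mrank:
  assumes A: "A \<in> carrier_mat n m" and B: "B \<in> carrier_mat n m"
  shows "finite {z. mrank (pencil A B z) < mrank (pencil A B z0)}"
proof -
  have M: "pencil A B z \<in> carrier_mat n m" for z using A B by (rule pencil_carrier)
  obtain r N B' C G where *: "N \<in> carrier_mat n r" "B' \<in> carrier_mat r m" "C \<in> carrier_mat r n"
    "G \<in> carrier_mat m r" "pencil A B z0 = N * B'" "C * N = 1\<^sub>m r" "B' * G = 1\<^sub>m r"
    by (rule rank_factorization[OF M])
  have r: "mrank (pencil A B z0) = r" unfolding *(5) by (rule mrank_eq[OF *(1-4,6,7)])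
  have CPG: "C * pencil A B z * G = pencil (C * A * G) (C * B * G) z" for z
    using *(3,4) A B unfolding pencil_def
    by (simp add: mult_minus_distrib_mat[of _ r n _ m] minus_mult_distrib_mat[of _ r m _ _ r]
        mult_smult_distrib[of _ r n _ m] mult_smult_assoc_mat[of _ r m _ r])
  obtain p where p: "\<And>z. det (pencil (C * A * G) (C * B * G) z) = poly p z"
    using det_pencil_poly[of "C * A * G" r "C * B * G"] *(3,4) A B by (metis mult_carrier_mat)
  have "C * pencil A B z0 * G = (C * N) * (B' * G)"
    unfolding *(5) using *(1-4) by (simp add: assoc_mult_mat[of _ r n _ m _ r] assoc_mult_mat[of _ n r _ m _ r]
      assoc_mult_mat[of _ r n _ r _ r])
  hence "poly p z0 = 1" unfolding p[symmetric] CPG[symmetric] using *(6,7) by simp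
  hence "finite {z. poly p z = 0}" by (intro poly_roots_finite) auto
  moreover have "{z. mrank (pencil A B z) < mrank (pencil A B z0)} \<subseteq> {z. poly p z = 0}"
    using mrank_lower_bound[OF *(3) M *(4)] unfolding r CPG p by force
  ultimately show ?thesis by (rule finite_subset[rotated])
qed

lemma nrank_attained:
  assumes A: "A \<in> carrier_mat n m" and B: "B \<in> carrier_mat n m"
  shows "mrank (pencil A B z) \<le> nrank A B" and "\<exists>z. mrank (pencil A B z) = nrank A B"
    and "nrank A B \<le> m"
proof -
  have "mrank (pencil A B z) \<le> m" for z
    by (rule mrank_nullspace[OF pencil_carrier[OF A B]])
  hence fin: "finite (range (\<lambda>z. mrank (pencil A B z)))"
    by (auto intro: finite_subset[OF _ finite_atMost[of m]])
  show "mrank (pencil A B z) \<le> nrank A B" for z unfolding nrank_def using fin by auto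
  have "nrank A B \<in> range (\<lambda>z. mrank (pencil A B z))" unfolding nrank_def using fin by (intro Max_in) auto
  thus "\<exists>z. mrank (pencil A B z) = nrank A B" by auto
  then obtain z where "mrank (pencil A B z) = nrank A B" by blast
  thus "nrank A B \<le> m" using \<open>\<And>z. mrank (pencil A B z) \<le> m\<close>[of z] by simp
qed

lemma finite_low_nrank:
  assumes A: "A \<in> carrier_mat n m" and B: "B \<in> carrier_mat n m"
  shows "finite {z. mrank (pencil A B z) < nrank A B}"
  using finite_low_mrank[OF A B] nrank_attained(2)[OF A B] by metis

lemma finite_eigenvalues:
  assumes A: "A \<in> carrier_mat n m" and B: "B \<in> carrier_mat n m"
  shows "finite (eigenvalues A B)"
proof -
  have "eigenvalues A B \<subseteq> Fin ` {z. mrank (pencil A B z) < nrank A B} \<union> {Infty}"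
  proof
    fix \<mu> assume "\<mu> \<in> eigenvalues A B"
    thus "\<mu> \<in> Fin ` {z. mrank (pencil A B z) < nrank A B} \<union> {Infty}"
      by (cases \<mu>) (auto simp: eigenvalues_def)
  qed
  thus ?thesis by (rule finite_subset) (use finite_low_nrank[OF A B] in auto)
qed

lemma pencil_at_carrier: "A \<in> carrier_mat n m \<Longrightarrow> B \<in> carrier_mat n m \<Longrightarrow> pencil_at A B \<mu> \<in> carrier_mat n m"
  by (cases \<mu>) (auto simp: pencil_carrier)

lemma pencil_at_transpose:
  assumes "A \<in> carrier_mat n m" "B \<in> carrier_mat n m"
  shows "pencil_at (transpose_mat A) (transpose_mat B) \<mu> = transpose_mat (pencil_at A B \<mu>)"
  using assms by (cases \<mu>) (auto simp: pencil_def intro!: eq_matI)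

lemma nrank_transpose:
  assumes "A \<in> carrier_mat n m" "B \<in> carrier_mat n m"
  shows "nrank (transpose_mat A) (transpose_mat B) = nrank A B"
  unfolding nrank_def using pencil_at_transpose[OF assms, of "Fin z" for z] by (simp add: mrank_transpose)

lemma nrank_regular:
  assumes "A \<in> carrier_mat n n" "B \<in> carrier_mat n n" "regular_pencil A B"
  shows "nrank A B = n"
proof -
  obtain z where "det (pencil A B z) \<noteq> 0" using assms(3) by (auto simp: regular_pencil_def)
  hence "mrank (pencil A B z) = n" using mrank_det[OF pencil_carrier[OF assms(1,2)]] by blast
  thus ?thesis using nrank_attained[OF assms(1,2)] by (metis antisym)
qed

text \<open>Direction of a line through \<open>pencil_at A B \<mu>\<close> whose other points are
  nonzero multiples of other members of the pencil. Finite points and infinity thus share one local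
  parameter \<open>t\<close>.\<close>

fun pencil_dir :: "complex mat \<Rightarrow> complex mat \<Rightarrow> point \<Rightarrow> complex mat" where
  "pencil_dir A B (Fin z) = - B"
| "pencil_dir A B Infty = - A"

lemma pencil_dir_carrier: "A \<in> carrier_mat n m \<Longrightarrow> B \<in> carrier_mat n m \<Longrightarrow> pencil_dir A B \<mu> \<in> carrier_mat n m"
  by (cases \<mu>) auto

text \<open>Only finitely many members of the pencil fall below the normal rank, and a punctured
  neighbourhood of the base point avoids them.\<close>

lemma eventually_nrank:
  assumes A: "A \<in> carrier_mat n m" and B: "B \<in> carrier_mat n m"
  shows "eventually (\<lambda>t. nrank A B \<le> mrank (pencil_at A B \<mu> + t \<cdot>\<^sub>m pencil_dir A B \<mu>)) (at 0)"
proof -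
  define S where "S = {z. mrank (pencil A B z) < nrank A B}"
  have S: "finite S" unfolding S_def by (rule finite_low_nrank[OF A B])
  have ev: "eventually (\<lambda>t. t \<notin> T) (at (0::complex))" if "finite T" for T
    unfolding eventually_at_topological using that
    by (intro exI[of _ "- (T - {0})"]) (use open_Compl[OF finite_imp_closed[of "T - {0}"]] in auto)
  show ?thesis
  proof (cases \<mu>)
    case (Fin z)
    have "pencil_at A B \<mu> + t \<cdot>\<^sub>m pencil_dir A B \<mu> = pencil A B (z + t)" for t
      using Fin A B by (auto simp: pencil_def algebra_simps intro!: eq_matI)
    moreover have "eventually (\<lambda>t. t \<notin> (\<lambda>w. w - z) ` S) (at 0)" using S by (intro ev) auto
    ultimately show ?thesis
      by (elim eventually_mono) (force simp: S_def image_iff not_less)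
  next
    case Infty
    \<comment> \<open>\<open>B - t A = -t (A - (1/t) B)\<close>: near infinity the line consists of
      members with parameter \<open>1 / t\<close>, up to a nonzero factor.\<close>
    have e: "pencil_at A B \<mu> + t \<cdot>\<^sub>m pencil_dir A B \<mu> = (- t) \<cdot>\<^sub>m pencil A B (1 / t)" if "t \<noteq> 0" for t
      using Infty A B that by (auto simp: pencil_def algebra_simps intro!: eq_matI)
    have "eventually (\<lambda>t. t \<notin> insert 0 ((\<lambda>w. 1 / w) ` S)) (at 0)" using S by (intro ev) auto
    thus ?thesis
    proof (elim eventually_mono)
      fix t assume t: "t \<notin> insert 0 ((\<lambda>w. 1 / w) ` S)"
      hence "1 / t \<notin> S" by (force simp: image_iff)
      thus "nrank A B \<le> mrank (pencil_at A B \<mu> + t \<cdot>\<^sub>m pencil_dir A B \<mu>)"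
        using e[of t] t by (simp add: mrank_smult S_def)
    qed
  qed
qed

section \<open>Limits of kernels\<close>

text \<open>At an eigenvalue of a singular pencil the kernel is larger than generically; the
  \<open>germ_kernel\<close> is the part of it that is a limit of the generic kernels.\<close>

definition germ_kernel :: "nat \<Rightarrow> complex mat \<Rightarrow> complex mat \<Rightarrow> complex vec set" where
  "germ_kernel n E F = {x. \<exists>f. (\<forall>t. f t \<in> carrier_vec n) \<and> (\<forall>i<n. isCont (\<lambda>t. f t $ i) 0) \<and>
     (\<forall>t. (E + t \<cdot>\<^sub>m F) *\<^sub>v f t = 0\<^sub>v n) \<and> f 0 = x}"

lemma germ_kernel_subspace:
  assumes E: "E \<in> carrier_mat n n" and F: "F \<in> carrier_mat n n"
  shows "vec_subspace n (germ_kernel n E F)"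
proof -
  have M: "E + t \<cdot>\<^sub>m F \<in> carrier_mat n n" for t using E F by auto
  show ?thesis unfolding vec_subspace_def
  proof (intro conjI ballI allI)
    show "germ_kernel n E F \<subseteq> carrier_vec n" by (auto simp: germ_kernel_def)
    show "0\<^sub>v n \<in> germ_kernel n E F" unfolding germ_kernel_def
      by (intro CollectI exI[of _ "\<lambda>t. 0\<^sub>v n"]) (use M E F in auto)
  next
    fix x y assume "x \<in> germ_kernel n E F" "y \<in> germ_kernel n E F"
    then obtain f g where f: "\<And>t. f t \<in> carrier_vec n" "\<And>i. i < n \<Longrightarrow> isCont (\<lambda>t. f t $ i) 0"
      "\<And>t. (E + t \<cdot>\<^sub>m F) *\<^sub>v f t = 0\<^sub>v n" "f 0 = x"
      and g: "\<And>t. g t \<in> carrier_vec n" "\<And>i. i < n \<Longrightarrow> isCont (\<lambda>t. g t $ i) 0"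
      "\<And>t. (E + t \<cdot>\<^sub>m F) *\<^sub>v g t = 0\<^sub>v n" "g 0 = y" by (auto simp: germ_kernel_def)
    have "isCont (\<lambda>t. (f t + g t) $ i) 0" if "i < n" for i
      using f(2)[OF that] g(2)[OF that] that f(1) g(1) by (auto simp: index_add_vec carrier_vecD[OF g(1)])
    moreover have "(E + t \<cdot>\<^sub>m F) *\<^sub>v (f t + g t) = 0\<^sub>v n" for t
      using mult_add_distrib_mat_vec[OF M f(1) g(1)] f(3) g(3) by simp
    ultimately show "x + y \<in> germ_kernel n E F" unfolding germ_kernel_def
      using f(1,4) g(1,4) by (intro CollectI exI[of _ "\<lambda>t. f t + g t"]) auto
  next
    fix c x assume "x \<in> germ_kernel n E F"
    then obtain f where f: "\<And>t. f t \<in> carrier_vec n" "\<And>i. i < n \<Longrightarrow> isCont (\<lambda>t. f t $ i) 0"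
      "\<And>t. (E + t \<cdot>\<^sub>m F) *\<^sub>v f t = 0\<^sub>v n" "f 0 = x" by (auto simp: germ_kernel_def)
    have "isCont (\<lambda>t. (c \<cdot>\<^sub>v f t) $ i) 0" if "i < n" for i
      using f(2)[OF that] that f(1) by (auto simp: carrier_vecD[OF f(1)])
    moreover have "(E + t \<cdot>\<^sub>m F) *\<^sub>v (c \<cdot>\<^sub>v f t) = 0\<^sub>v n" for t
      using mult_mat_vec[OF M f(1)] f(3) by auto
    ultimately show "c \<cdot>\<^sub>v x \<in> germ_kernel n E F" unfolding germ_kernel_def
      using f(1,4) by (intro CollectI exI[of _ "\<lambda>t. c \<cdot>\<^sub>v f t"]) auto
  qed
qed

lemma isCont_det:
  fixes M :: "complex \<Rightarrow> complex mat"
  assumes M: "\<And>t. M t \<in> carrier_mat n n"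
    and "\<And>i j. i < n \<Longrightarrow> j < n \<Longrightarrow> isCont (\<lambda>t. M t $$ (i,j)) a"
  shows "isCont (\<lambda>t. det (M t)) a"
  unfolding det_def'[OF M]
  by (intro continuous_intros assms(2)) (auto simp: permutes_in_image)

text \<open>Basis vectors of the germ kernel extend to continuous families of kernel vectors. Their
  independence, measured by \<open>det (C * G t)\<close>, persists for small \<open>t\<close>, where
  the nullity is at most \<open>k\<close>. So there are at most \<open>k\<close> of them, and the
  basis can be enlarged to \<open>k\<close> columns.\<close>

lemma germ_kernel_basis:
  assumes E: "E \<in> carrier_mat n n" and F: "F \<in> carrier_mat n n" and k: "k \<le> n"
    and ev: "eventually (\<lambda>t. n - k \<le> mrank (E + t \<cdot>\<^sub>m F)) (at 0)"
  obtains N X where "N \<in> carrier_mat n k" "X \<in> carrier_mat k n" "X * N = 1\<^sub>m k"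
    "germ_kernel n E F \<subseteq> mrange N"
proof -
  obtain r N C where N: "N \<in> carrier_mat n r" and C: "C \<in> carrier_mat r n" and CN: "C * N = 1\<^sub>m r"
    and ran: "mrange N = germ_kernel n E F"
    using subspace_basis_matrix[OF germ_kernel_subspace[OF E F]] by metis
  have "col N j \<in> germ_kernel n E F" if "j < r" for j
  proof -
    have "col N j = N *\<^sub>v unit_vec r j" using that N by (metis carrier_matD(2) mat_mult_unit_vec)
    hence "col N j \<in> mrange N" unfolding mrange_def using N by auto
    thus ?thesis unfolding ran .
  qed
  then obtain f where f: "\<And>j t. j < r \<Longrightarrow> f j t \<in> carrier_vec n"
      "\<And>i j. j < r \<Longrightarrow> i < n \<Longrightarrow> isCont (\<lambda>t. f j t $ i) 0"
      "\<And>j t. j < r \<Longrightarrow> (E + t \<cdot>\<^sub>m F) *\<^sub>v f j t = 0\<^sub>v n" "\<And>j. j < r \<Longrightarrow> f j 0 = col N j"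
    unfolding germ_kernel_def by (auto simp: Bex_def) metis
  define G where "G t = mat n r (\<lambda>(i,j). f j t $ i)" for t
  have G: "G t \<in> carrier_mat n r" for t by (auto simp: G_def)
  have colG: "col (G t) j = f j t" if "j < r" for j t
    using f(1)[OF that, of t] that by (intro eq_vecI) (auto simp: G_def)
  have EG: "(E + t \<cdot>\<^sub>m F) * G t = 0\<^sub>m n r" for t
  proof (rule mat_col_eqI)
    fix j assume "j < dim_col (0\<^sub>m n r :: complex mat)"
    hence j: "j < r" by simp
    have M: "E + t \<cdot>\<^sub>m F \<in> carrier_mat n n" using E F by auto
    show "col ((E + t \<cdot>\<^sub>m F) * G t) j = col (0\<^sub>m n r) j"
      unfolding col_mult2[OF M G j] colG[OF j] f(3)[OF j] using j by simp
  qed (use E F G in auto)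
  have "G 0 = N" using f(4) N by (intro eq_matI) (auto simp: G_def)
  have "isCont (\<lambda>t. det (C * G t)) 0"
  proof (rule isCont_det)
    fix i j assume ij: "i < r" "j < r"
    have "(C * G t) $$ (i,j) = (\<Sum>l\<in>{0..<n}. C $$ (i,l) * f j t $ l)" for t
      using C G[of t] ij by (simp add: scalar_prod_def) (simp add: G_def)
    thus "isCont (\<lambda>t. (C * G t) $$ (i,j)) 0" using f(2)[OF ij(2)] by (auto intro!: continuous_intros)
  qed (use C G in auto)
  hence "((\<lambda>t. det (C * G t)) \<longlongrightarrow> 1) (at 0)"
    unfolding isCont_def \<open>G 0 = N\<close> CN by simp
  hence "eventually (\<lambda>t. det (C * G t) \<noteq> 0) (at 0)" by (rule tendsto_imp_eventually_ne) simp
  hence "eventually (\<lambda>t. det (C * G t) \<noteq> 0 \<and> n - k \<le> mrank (E + t \<cdot>\<^sub>m F)) (at 0)"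
    using ev by (rule eventually_conj)
  then obtain t where t: "det (C * G t) \<noteq> 0" "n - k \<le> mrank (E + t \<cdot>\<^sub>m F)"
    using eventually_happens'[OF at_neq_bot] by blast
  have "C * G t \<in> carrier_mat r r" using C G[of t] by auto
  from det_nonzero_inverse[OF this t(1)] obtain Y where Y: "Y \<in> carrier_mat r r" "Y * (C * G t) = 1\<^sub>m r" by metis
  have "r \<le> n - mrank (E + t \<cdot>\<^sub>m F)"
    using E F G Y C EG by (intro nullity_bound[of _ n n "G t" r "Y * C"]) (auto simp: assoc_mult_mat[of _ r r _ n _ r])
  hence "r \<le> k" using t(2) k by auto
  from basis_matrix_enlarge[OF C N CN this k] that ran show thesis by metis
qed

text \<open>The conditions on \<open>W = V\<^sup>*\<close> at one point. The first, applied to the transposed pencil and \<open>U\<^sup>T\<close>,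
  determines the kernel of the perturbed pencil; the second makes the Sylvester system solvable; the
  third gives regularity of the perturbed pencil at a point that is not an eigenvalue.\<close>

definition good_right :: "nat \<Rightarrow> nat \<Rightarrow> complex mat \<Rightarrow> complex mat \<Rightarrow> point \<Rightarrow> complex mat \<Rightarrow> bool" where
  "good_right n k A B \<mu> W \<longleftrightarrow>
     (\<exists>N\<in>carrier_mat n k. pencil_at A B \<mu> * N = 0\<^sub>m n k \<and> det (W * N) \<noteq> 0) \<and>
     (\<forall>x\<in>germ_kernel n (pencil_at A B \<mu>) (pencil_dir A B \<mu>). W *\<^sub>v x = 0\<^sub>v k \<longrightarrow> x = 0\<^sub>v n) \<and>
     (mrank (pencil_at A B \<mu>) = n - k \<longrightarrow>
       (\<forall>x\<in>mat_kernel (pencil_at A B \<mu>). W *\<^sub>v x = 0\<^sub>v k \<longrightarrow> x = 0\<^sub>v n))"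

lemma injective_on_mrange:
  fixes W N :: "complex mat"
  assumes W: "W \<in> carrier_mat k n" and N: "N \<in> carrier_mat n k" and d: "det (W * N) \<noteq> 0"
    and x: "x \<in> mrange N" "W *\<^sub>v x = 0\<^sub>v k"
  shows "x = 0\<^sub>v n"
proof -
  obtain u where u: "u \<in> carrier_vec k" "x = N *\<^sub>v u" using x N by (auto simp: mrange_def)
  have "(W * N) *\<^sub>v u = 0\<^sub>v k" using x u W N by (simp add: assoc_mult_mat_vec[of _ k n _ k])
  hence "u = 0\<^sub>v k" using det_nonzero_kernel[of "W * N" k u] d W N u by auto
  thus ?thesis using u N by auto
qed

text \<open>Two test matrices suffice. \<open>N1\<close> spans a space containing the germ kernel;
  \<open>N2\<close> consists of \<open>k\<close> independent kernel vectors, available because the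
  rank at \<mu> is at most \<open>n - k\<close>. If the rank equals \<open>n - k\<close>, then
  \<open>N2\<close> spans the whole kernel, which settles the third condition.\<close>

lemma good_right_generic:
  assumes A: "A \<in> carrier_mat n n" and B: "B \<in> carrier_mat n n" and k: "k \<le> n"
    and nr: "nrank A B = n - k" and low: "mrank (pencil_at A B \<mu>) \<le> n - k"
  obtains Ns where "finite Ns"
    "\<And>N. N \<in> Ns \<Longrightarrow> N \<in> carrier_mat n k \<and> (\<exists>X\<in>carrier_mat k n. X * N = 1\<^sub>m k)"
    "\<And>W. W \<in> carrier_mat k n \<Longrightarrow> (\<And>N. N \<in> Ns \<Longrightarrow> det (W * N) \<noteq> 0) \<Longrightarrow> good_right n k A B \<mu> W"
proof -
  let ?E = "pencil_at A B \<mu>" let ?F = "pencil_dir A B \<mu>"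
  have E: "?E \<in> carrier_mat n n" and F: "?F \<in> carrier_mat n n"
    using A B by (auto intro: pencil_at_carrier pencil_dir_carrier)
  obtain N1 X1 where N1: "N1 \<in> carrier_mat n k" "X1 \<in> carrier_mat k n" "X1 * N1 = 1\<^sub>m k"
    "germ_kernel n ?E ?F \<subseteq> mrange N1"
    using germ_kernel_basis[OF E F k] eventually_nrank[OF A B, of \<mu>] nr by metis
  obtain N Y where N: "N \<in> carrier_mat n (n - mrank ?E)" "Y \<in> carrier_mat (n - mrank ?E) n"
    "Y * N = 1\<^sub>m (n - mrank ?E)" "mrange N = mat_kernel ?E" "mrank ?E \<le> n"
    using mrank_nullspace[OF E] by metis
  define s where "s = n - mrank ?E"
  have ks: "k \<le> s" using low k N(5) by (auto simp: s_def)
  define N2 where "N2 = mat n k (\<lambda>(i,j). N $$ (i,j))"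
  define X2 where "X2 = mat k n (\<lambda>(i,j). Y $$ (i,j))"
  have N2: "N2 \<in> carrier_mat n k" and X2: "X2 \<in> carrier_mat k n" by (auto simp: N2_def X2_def)
  have XN2: "X2 * N2 = 1\<^sub>m k"
  proof (rule eq_matI)
    fix i j assume "i < dim_row (1\<^sub>m k :: complex mat)" "j < dim_col (1\<^sub>m k :: complex mat)"
    hence ij: "i < k" "j < k" by auto
    have "(X2 * N2) $$ (i,j) = (\<Sum>l\<in>{0..<n}. Y $$ (i,l) * N $$ (l,j))"
      using ij X2 N2 by (simp add: scalar_prod_def) (simp add: N2_def X2_def)
    also have "\<dots> = (Y * N) $$ (i,j)"
      using ij ks N(1,2) by (simp add: scalar_prod_def s_def)
    finally have "(X2 * N2) $$ (i,j) = (Y * N) $$ (i,j)" .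
    thus "(X2 * N2) $$ (i,j) = 1\<^sub>m k $$ (i,j)" unfolding N(3) using ij ks by (auto simp: s_def)
  qed (use N2 X2 in auto)
  have colN2: "col N2 j \<in> mat_kernel ?E" if "j < k" for j
  proof -
    have "col N2 j = col N j" using that ks N by (intro eq_vecI) (auto simp: N2_def s_def)
    also have "\<dots> = N *\<^sub>v unit_vec s j" using that ks N by (metis carrier_matD(2) mat_mult_unit_vec s_def less_le_trans)
    finally have "col N2 j \<in> mrange N" unfolding mrange_def using N by (auto simp: s_def)
    thus ?thesis unfolding N .
  qed
  have EN2: "?E * N2 = 0\<^sub>m n k"
  proof (rule mat_col_eqI)
    fix j assume "j < dim_col (0\<^sub>m n k :: complex mat)"
    hence j: "j < k" by simp
    from colN2[OF j] have "?E *\<^sub>v col N2 j = 0\<^sub>v n" by (auto simp: mat_kernel[OF E])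
    thus "col (?E * N2) j = col (0\<^sub>m n k) j" using j col_mult2[OF E N2 j] by simp
  qed (use E N2 in auto)
  have ker: "mat_kernel ?E \<subseteq> mrange N2" if "mrank ?E = n - k"
  proof -
    have "s = k" using that k by (auto simp: s_def)
    hence "N2 = N" using N by (intro eq_matI) (auto simp: N2_def s_def)
    thus ?thesis using N by simp
  qed
  show thesis
  proof (rule that[of "{N1, N2}"])
    fix W assume W: "W \<in> carrier_mat k n" and d: "\<And>N. N \<in> {N1, N2} \<Longrightarrow> det (W * N) \<noteq> 0"
    show "good_right n k A B \<mu> W"
      unfolding good_right_def using N2 EN2 d N1(4) ker
        injective_on_mrange[OF W N1(1)] injective_on_mrange[OF W N2]
      by blast
  qed (use N1 N2 X2 XN2 in auto)
qed

section \<open>Kernels of rank-completing perturbations\<close>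

lemma zero_mat_mult_vec: "x \<in> carrier_vec n \<Longrightarrow> 0\<^sub>m k n *\<^sub>v x = (0\<^sub>v k :: 'a :: semiring_0 vec)"
  by (intro eq_vecI) (auto simp: scalar_prod_def)

lemma mult_mat_zero_vec: "A \<in> carrier_mat n m \<Longrightarrow> A *\<^sub>v 0\<^sub>v m = (0\<^sub>v n :: 'a :: semiring_0 vec)"
  by (intro eq_vecI) auto

text \<open>Multiplication by \<open>C\<close> removes \<open>E\<close> and leaves
  \<open>\<tau> C U D W x = 0\<close> with \<open>C * U\<close> and \<open>D\<close> nonsingular.
  Hence \<open>W x = 0\<close>, the perturbation term drops out of the equation, and with it every
  trace of \<tau>.\<close>

lemma perturbed_kernel:
  fixes E U D W :: "complex mat"
  assumes E: "E \<in> carrier_mat n n" and U: "U \<in> carrier_mat n k" and D: "D \<in> carrier_mat k k"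
    and W: "W \<in> carrier_mat k n" and dD: "det D \<noteq> 0" and \<tau>: "\<tau> \<noteq> 0"
    and C: "C \<in> carrier_mat k n" and CE: "C * E = 0\<^sub>m k n" and dC: "det (C * U) \<noteq> 0"
  shows "mat_kernel (E + \<tau> \<cdot>\<^sub>m (U * D * W)) = {x \<in> mat_kernel E. W *\<^sub>v x = 0\<^sub>v k}"
proof -
  have UDW: "U * D * W \<in> carrier_mat n n" using U D W by auto
  have M: "E + \<tau> \<cdot>\<^sub>m (U * D * W) \<in> carrier_mat n n" using E UDW by auto
  have app: "(E + \<tau> \<cdot>\<^sub>m (U * D * W)) *\<^sub>v x = E *\<^sub>v x + \<tau> \<cdot>\<^sub>v (U *\<^sub>v (D *\<^sub>v (W *\<^sub>v x)))"
    if x: "x \<in> carrier_vec n" for x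
  proof -
    have "(E + \<tau> \<cdot>\<^sub>m (U * D * W)) *\<^sub>v x = E *\<^sub>v x + (\<tau> \<cdot>\<^sub>m (U * D * W)) *\<^sub>v x"
      using E UDW x by (intro add_mult_distrib_mat_vec) auto
    also have "(\<tau> \<cdot>\<^sub>m (U * D * W)) *\<^sub>v x = \<tau> \<cdot>\<^sub>v ((U * D * W) *\<^sub>v x)"
      using UDW x by (intro eq_vecI) auto
    also have "(U * D * W) *\<^sub>v x = U *\<^sub>v (D *\<^sub>v (W *\<^sub>v x))"
      using U D W x by (simp add: assoc_mult_mat_vec[of _ n k _ n] assoc_mult_mat_vec[of _ n k _ k])
    finally show ?thesis .
  qed
  have UD0: "\<tau> \<cdot>\<^sub>v (U *\<^sub>v (D *\<^sub>v 0\<^sub>v k)) = 0\<^sub>v n"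
    unfolding mult_mat_zero_vec[OF D] mult_mat_zero_vec[OF U] by (intro eq_vecI) auto
  show ?thesis
  proof (intro equalityI subsetI)
    fix x assume "x \<in> mat_kernel (E + \<tau> \<cdot>\<^sub>m (U * D * W))"
    hence x: "x \<in> carrier_vec n" and z: "E *\<^sub>v x + \<tau> \<cdot>\<^sub>v (U *\<^sub>v (D *\<^sub>v (W *\<^sub>v x))) = 0\<^sub>v n"
      using M app by (auto simp: mat_kernel[OF M])
    define w where "w = D *\<^sub>v (W *\<^sub>v x)"
    have w: "w \<in> carrier_vec k" using D W x by (auto simp: w_def)
    have "C *\<^sub>v (E *\<^sub>v x) = (C * E) *\<^sub>v x" using assoc_mult_mat_vec[OF C E x] ..
    also have "\<dots> = 0\<^sub>v k" unfolding CE using x by (rule zero_mat_mult_vec)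
    finally have CEx: "C *\<^sub>v (E *\<^sub>v x) = 0\<^sub>v k" .
    have "0\<^sub>v k = C *\<^sub>v (E *\<^sub>v x + \<tau> \<cdot>\<^sub>v (U *\<^sub>v w))" unfolding w_def z using mult_mat_zero_vec[OF C] by simp
    also have "\<dots> = C *\<^sub>v (E *\<^sub>v x) + C *\<^sub>v (\<tau> \<cdot>\<^sub>v (U *\<^sub>v w))"
      using C E U x w by (intro mult_add_distrib_mat_vec) auto
    also have "\<dots> = \<tau> \<cdot>\<^sub>v ((C * U) *\<^sub>v w)"
      unfolding CEx using C U w by (simp add: mult_mat_vec[of _ k n] assoc_mult_mat_vec[of _ k n _ k])
    finally have t0: "\<tau> \<cdot>\<^sub>v ((C * U) *\<^sub>v w) = 0\<^sub>v k" by simp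
    have CUw: "(C * U) *\<^sub>v w \<in> carrier_vec k" using C U w by auto
    have "((C * U) *\<^sub>v w) $ i = 0" if "i < k" for i
      using arg_cong[OF t0, of "\<lambda>v. v $ i"] that CUw \<tau> C by simp
    hence "(C * U) *\<^sub>v w = 0\<^sub>v k" using CUw by (intro eq_vecI) (simp_all del: index_mult_mat_vec dim_mult_mat_vec)
    hence "w = 0\<^sub>v k" using det_nonzero_kernel[of "C * U" k w] C U w dC by auto
    hence Wx: "W *\<^sub>v x = 0\<^sub>v k" using det_nonzero_kernel[OF D dD] W x by (auto simp: w_def)
    have "E *\<^sub>v x = 0\<^sub>v n" using z E x unfolding Wx UD0 by simp
    thus "x \<in> {x \<in> mat_kernel E. W *\<^sub>v x = 0\<^sub>v k}" using x Wx by (auto simp: mat_kernel[OF E])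
  next
    fix x assume "x \<in> {x \<in> mat_kernel E. W *\<^sub>v x = 0\<^sub>v k}"
    hence x: "x \<in> carrier_vec n" "E *\<^sub>v x = 0\<^sub>v n" "W *\<^sub>v x = 0\<^sub>v k" by (auto simp: mat_kernel[OF E])
    thus "x \<in> mat_kernel (E + \<tau> \<cdot>\<^sub>m (U * D * W))" using app[OF x(1)] UD0 by (auto simp: mat_kernel[OF M])
  qed
qed

text \<open>Kernel vectors of the transposed pencil become, after transposition, the left
  annihilator \<open>C\<close> that \<open>perturbed_kernel\<close> asks for.\<close>

lemma good_right_perturbed_kernel:
  assumes A: "A \<in> carrier_mat n n" and B: "B \<in> carrier_mat n n" and U: "U \<in> carrier_mat n k"
    and D: "D \<in> carrier_mat k k" and W: "W \<in> carrier_mat k n" and dD: "det D \<noteq> 0" and \<tau>: "\<tau> \<noteq> 0"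
    and good: "good_right n k (transpose_mat A) (transpose_mat B) \<mu> (transpose_mat U)"
  shows "mat_kernel (pencil_at A B \<mu> + \<tau> \<cdot>\<^sub>m (U * D * W)) = {x \<in> mat_kernel (pencil_at A B \<mu>). W *\<^sub>v x = 0\<^sub>v k}"
proof -
  let ?E = "pencil_at A B \<mu>"
  have E: "?E \<in> carrier_mat n n" by (rule pencil_at_carrier[OF A B])
  obtain N where N: "N \<in> carrier_mat n k" "transpose_mat ?E * N = 0\<^sub>m n k" "det (transpose_mat U * N) \<noteq> 0"
    using good unfolding good_right_def pencil_at_transpose[OF A B] by blast
  have "transpose_mat (transpose_mat ?E * N) = transpose_mat N * ?E"
    using N E by (subst transpose_mult[of _ n n _ k]) auto
  hence CE: "transpose_mat N * ?E = 0\<^sub>m k n" using N by simp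
  have "transpose_mat (transpose_mat U * N) = transpose_mat N * U"
    using N U by (subst transpose_mult[of _ k n _ k]) auto
  moreover have "transpose_mat U * N \<in> carrier_mat k k" using N U by auto
  ultimately have "det (transpose_mat N * U) \<noteq> 0" using N(3) det_transpose by metis
  with CE show ?thesis using N(1) by (intro perturbed_kernel[OF E U D W dD \<tau>]) auto
qed

text \<open>Filling up with zero rows gives a square matrix of determinant 0.\<close>

lemma wide_matrix_kernel:
  fixes M :: "'a :: field mat"
  assumes M: "M \<in> carrier_mat r s" and "r < s"
  obtains u where "u \<in> carrier_vec s" "u \<noteq> 0\<^sub>v s" "M *\<^sub>v u = 0\<^sub>v r"
proof -
  define M' where "M' = mat s s (\<lambda>(i,j). if i < r then M $$ (i,j) else 0)"
  have M': "M' \<in> carrier_mat s s" by (simp add: M'_def)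
  have "row M' r = 0\<^sub>v s" using assms by (intro eq_vecI) (auto simp: M'_def)
  hence "transpose_mat M' *\<^sub>v unit_vec s r = 0\<^sub>v s"
    using mat_mult_unit_vec[of r "transpose_mat M'"] M' assms(2) by simp
  hence "det (transpose_mat M') = 0"
    using assms(2) M' by (intro det_0_iff_vec_prod_zero_field[THEN iffD2, of _ s])
      (auto intro!: exI[of _ "unit_vec s r"])
  hence "det M' = 0" using det_transpose[OF M'] by simp
  then obtain u where u: "u \<in> carrier_vec s" "u \<noteq> 0\<^sub>v s" "M' *\<^sub>v u = 0\<^sub>v s"
    using det_0_iff_vec_prod_zero_field[OF M'] by blast
  have "M *\<^sub>v u = 0\<^sub>v r"
  proof (rule eq_vecI)
    fix i assume "i < dim_vec (0\<^sub>v r :: 'a vec)"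
    hence i: "i < r" by simp
    have "row M' i = row M i" using i assms by (intro eq_vecI) (auto simp: M'_def)
    hence "(M' *\<^sub>v u) $ i = (M *\<^sub>v u) $ i" using i M M' assms(2) by simp
    thus "(M *\<^sub>v u) $ i = 0\<^sub>v r $ i" using i assms u(3) by simp
  qed (use M in auto)
  with u that show thesis by blast
qed

lemma left_inverse_mult_zero:
  fixes C N :: "'a :: comm_ring_1 mat"
  assumes "C \<in> carrier_mat r n" "N \<in> carrier_mat n r" "C * N = 1\<^sub>m r" "u \<in> carrier_vec r" "N *\<^sub>v u = 0\<^sub>v n"
  shows "u = 0\<^sub>v r"
  using left_inverse_inj[OF assms(1-4)] assms(1,5) by auto

text \<open>\<open>W\<close> imposes \<open>k\<close> equations on a kernel of dimension greater
  than \<open>k\<close>. This is why an eigenvalue survives: the perturbation does not see the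
  remaining kernel vectors.\<close>

lemma low_rank_perturbed_singular:
  assumes E: "E \<in> carrier_mat n n" and W: "W \<in> carrier_mat k n" and low: "mrank E < n - k"
  obtains x where "x \<in> mat_kernel E" "x \<noteq> 0\<^sub>v n" "W *\<^sub>v x = 0\<^sub>v k"
proof -
  define s where "s = n - mrank E"
  obtain N Y where N: "N \<in> carrier_mat n s" and Y: "Y \<in> carrier_mat s n"
    and YN: "Y * N = 1\<^sub>m s" and ran: "mrange N = mat_kernel E"
    unfolding s_def using mrank_nullspace[OF E] by metis
  have WN: "W * N \<in> carrier_mat k s" using W N by auto
  have "k < s" using low by (auto simp: s_def)
  then obtain u where u: "u \<in> carrier_vec s" "u \<noteq> 0\<^sub>v s" "(W * N) *\<^sub>v u = 0\<^sub>v k"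
    using wide_matrix_kernel[OF WN] by blast
  have "N *\<^sub>v u \<in> mat_kernel E" unfolding ran[symmetric] mrange_def using N u by auto
  moreover have "N *\<^sub>v u \<noteq> 0\<^sub>v n" using left_inverse_mult_zero[OF Y N YN u(1)] u(2) by blast
  moreover have "W *\<^sub>v (N *\<^sub>v u) = 0\<^sub>v k" using u W N by (simp add: assoc_mult_mat_vec[of _ k n _ s])
  ultimately show thesis using that by blast
qed

section \<open>A triangular Sylvester system\<close>

text \<open>In a regular part the diagonal pairs are normalised, \<open>(m, 1)\<close> coming from
  \<open>J\<close> and \<open>(1, 0)\<close> from \<open>N\<close>. The point \<mu> is where the
  diagonal entry of the pencil vanishes.\<close>

definition point_of_diag :: "point \<Rightarrow> complex mat \<Rightarrow> complex mat \<Rightarrow> nat \<Rightarrow> bool" where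
  "point_of_diag \<mu> RA RB j \<longleftrightarrow> (case \<mu> of Fin m \<Rightarrow> RA $$ (j,j) = m \<and> RB $$ (j,j) = 1
        | Infty \<Rightarrow> RA $$ (j,j) = 1 \<and> RB $$ (j,j) = 0)"

text \<open>In \<open>S X = Y R\<close> column \<open>j\<close> involves only columns \<open>i\<close> with \<open>\<sigma> i \<le> \<sigma> j\<close>. At the point given by
  the diagonal entry of \<open>R\<close> the unknown \<open>Y\<close>-column cancels, which leaves a linear system for the
  \<open>X\<close>-column alone.\<close>

lemma triangular_sylvester:
  fixes RA RB SA SB V H :: "complex mat" and \<sigma> :: "nat \<Rightarrow> nat"
  assumes SA: "SA \<in> carrier_mat a c" and SB: "SB \<in> carrier_mat a c" and V: "V \<in> carrier_mat k c"
    and RA: "RA \<in> carrier_mat \<rho> \<rho>" and RB: "RB \<in> carrier_mat \<rho> \<rho>" and H: "H \<in> carrier_mat k \<rho>"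
    and tri: "\<And>i j. i < \<rho> \<Longrightarrow> j < \<rho> \<Longrightarrow> i \<noteq> j \<Longrightarrow> RA $$ (i,j) \<noteq> 0 \<or> RB $$ (i,j) \<noteq> 0 \<Longrightarrow> \<sigma> i < \<sigma> j"
    and diag: "\<And>j. j < \<rho> \<Longrightarrow> \<exists>\<mu>. point_of_diag \<mu> RA RB j \<and>
      (\<forall>y\<in>carrier_vec a. \<forall>v\<in>carrier_vec k. \<exists>x\<in>carrier_vec c. pencil_at SA SB \<mu> *\<^sub>v x = y \<and> V *\<^sub>v x = v)"
  obtains X Y where "X \<in> carrier_mat c \<rho>" "Y \<in> carrier_mat a \<rho>" "SA * X = Y * RA" "SB * X = Y * RB"
    "V * X = H"
proof -
  define P where "P x y j \<longleftrightarrow> x j \<in> carrier_vec c \<and> y j \<in> carrier_vec a \<and> V *\<^sub>v x j = col H j \<and>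
      (\<forall>r<a. (SA *\<^sub>v x j) $ r = (\<Sum>i<\<rho>. RA $$ (i,j) * y i $ r)) \<and>
      (\<forall>r<a. (SB *\<^sub>v x j) $ r = (\<Sum>i<\<rho>. RB $$ (i,j) * y i $ r))"
    for x y :: "nat \<Rightarrow> complex vec" and j
  \<comment> \<open>Columns are solved level by level in \<sigma>; distinct columns of equal level
    do not interact.\<close>
  have "\<exists>x y. \<forall>j<\<rho>. \<sigma> j < m \<longrightarrow> P x y j" for m
  proof (induction m)
    case (Suc m)
    then obtain x y where xy: "\<And>j. j < \<rho> \<Longrightarrow> \<sigma> j < m \<Longrightarrow> P x y j" by blast
    define Q where "Q j x' y' \<longleftrightarrow> x' \<in> carrier_vec c \<and> y' \<in> carrier_vec a \<and> V *\<^sub>v x' = col H j \<and>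
      (\<forall>r<a. (SA *\<^sub>v x') $ r = (\<Sum>i\<in>{..<\<rho>}-{j}. RA $$ (i,j) * y i $ r) + RA $$ (j,j) * y' $ r) \<and>
      (\<forall>r<a. (SB *\<^sub>v x') $ r = (\<Sum>i\<in>{..<\<rho>}-{j}. RB $$ (i,j) * y i $ r) + RB $$ (j,j) * y' $ r)" for j x' y'
    have "\<exists>x' y'. Q j x' y'" if j: "j < \<rho>" for j
    proof -
      \<comment> \<open>\<open>f\<close> and \<open>g\<close> collect the off-diagonal
        contributions, which for a column of level \<open>m\<close> involve only columns already
        solved.\<close>
      define f where "f = vec a (\<lambda>r. \<Sum>i\<in>{..<\<rho>}-{j}. RA $$ (i,j) * y i $ r)"
      define g where "g = vec a (\<lambda>r. \<Sum>i\<in>{..<\<rho>}-{j}. RB $$ (i,j) * y i $ r)"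
      have fg: "f \<in> carrier_vec a" "g \<in> carrier_vec a" by (auto simp: f_def g_def)
      have Hj: "col H j \<in> carrier_vec k" using H j by auto
      obtain \<mu> where \<mu>: "point_of_diag \<mu> RA RB j"
        and sol: "\<And>y v. y \<in> carrier_vec a \<Longrightarrow> v \<in> carrier_vec k \<Longrightarrow>
          \<exists>x\<in>carrier_vec c. pencil_at SA SB \<mu> *\<^sub>v x = y \<and> V *\<^sub>v x = v"
        using diag[OF j] by blast
      show ?thesis
      proof (cases \<mu>)
        case (Fin z)
        hence d: "RA $$ (j,j) = z" "RB $$ (j,j) = 1" using \<mu> by (auto simp: point_of_diag_def)
        \<comment> \<open>Subtracting \<open>z\<close> times the second equation from the first
          eliminates the unknown \<open>y'\<close>; afterwards the second equation defines
          it.\<close>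
        have "f - z \<cdot>\<^sub>v g \<in> carrier_vec a" using fg by auto
        from sol[OF this Hj] obtain x' where x': "x' \<in> carrier_vec c"
          "pencil SA SB z *\<^sub>v x' = f - z \<cdot>\<^sub>v g" "V *\<^sub>v x' = col H j" using Fin by auto
        have "pencil SA SB z *\<^sub>v x' = SA *\<^sub>v x' - (z \<cdot>\<^sub>m SB) *\<^sub>v x'"
          unfolding pencil_def using SA SB x' by (intro minus_mult_distrib_mat_vec) auto
        also have "(z \<cdot>\<^sub>m SB) *\<^sub>v x' = z \<cdot>\<^sub>v (SB *\<^sub>v x')" using SB x' by (intro eq_vecI) auto
        finally have e: "SA *\<^sub>v x' - z \<cdot>\<^sub>v (SB *\<^sub>v x') = f - z \<cdot>\<^sub>v g" using x' by simp
        have e': "(SA *\<^sub>v x') $ r - z * (SB *\<^sub>v x') $ r = f $ r - z * g $ r" if "r < a" for r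
          using arg_cong[OF e, of "\<lambda>v. v $ r"] that SA SB fg x' by (simp del: index_mult_mat_vec)
        define y' where "y' = SB *\<^sub>v x' - g"
        have y': "y' \<in> carrier_vec a" "\<And>r. r < a \<Longrightarrow> y' $ r = (SB *\<^sub>v x') $ r - g $ r"
          using SB fg x' by (auto simp: y'_def)
        have "(SA *\<^sub>v x') $ r = f $ r + RA $$ (j,j) * y' $ r \<and> (SB *\<^sub>v x') $ r = g $ r + RB $$ (j,j) * y' $ r"
          if "r < a" for r
          using e'[OF that] by (simp add: y'(2)[OF that] d algebra_simps)
        thus ?thesis using x' y' by (intro exI[of _ x'] exI[of _ y']) (simp add: f_def g_def Q_def)
      next
        case Infty
        hence d: "RA $$ (j,j) = 1" "RB $$ (j,j) = 0" using \<mu> by (auto simp: point_of_diag_def)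
        \<comment> \<open>Here \<open>y'\<close> has coefficient 0 in the second equation, which
          therefore constrains \<open>x'\<close> alone; the first equation then defines
          \<open>y'\<close>.\<close>
        from sol[OF fg(2) Hj] obtain x' where x': "x' \<in> carrier_vec c"
          "SB *\<^sub>v x' = g" "V *\<^sub>v x' = col H j" using Infty by auto
        define y' where "y' = SA *\<^sub>v x' - f"
        have y': "y' \<in> carrier_vec a" "\<And>r. r < a \<Longrightarrow> y' $ r = (SA *\<^sub>v x') $ r - f $ r"
          using SA fg x' by (auto simp: y'_def)
        have "(SA *\<^sub>v x') $ r = f $ r + RA $$ (j,j) * y' $ r \<and> (SB *\<^sub>v x') $ r = g $ r + RB $$ (j,j) * y' $ r"
          if "r < a" for r
          using x'(2) by (simp add: y'(2)[OF that] d algebra_simps)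
        thus ?thesis using x' y' by (intro exI[of _ x'] exI[of _ y']) (simp add: f_def g_def Q_def)
      qed
    qed
    then obtain X' Y' where XY: "\<And>j. j < \<rho> \<Longrightarrow> Q j (X' j) (Y' j)" by metis
    \<comment> \<open>Only columns of level \<open>m\<close> are replaced, so the equations at lower
      levels keep all the terms that enter them.\<close>
    define x2 where "x2 = (\<lambda>j. if \<sigma> j = m then X' j else x j)"
    define y2 where "y2 = (\<lambda>j. if \<sigma> j = m then Y' j else y j)"
    have "P x2 y2 j" if j: "j < \<rho>" "\<sigma> j < Suc m" for j
    proof (cases "\<sigma> j = m")
      case True
      have s: "(\<Sum>i<\<rho>. R $$ (i,j) * y2 i $ r) = (\<Sum>i\<in>{..<\<rho>}-{j}. R $$ (i,j) * y i $ r) + R $$ (j,j) * Y' j $ r"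
        if "R = RA \<or> R = RB" for R r
      proof -
        have "(\<Sum>i\<in>{..<\<rho>}-{j}. R $$ (i,j) * y2 i $ r) = (\<Sum>i\<in>{..<\<rho>}-{j}. R $$ (i,j) * y i $ r)"
        proof (intro sum.cong refl)
          fix i assume i: "i \<in> {..<\<rho>}-{j}"
          show "R $$ (i,j) * y2 i $ r = R $$ (i,j) * y i $ r"
          proof (cases "R $$ (i,j) = 0")
            case False
            hence "\<sigma> i < \<sigma> j" using tri[of i j] i j that by auto
            thus ?thesis using True by (simp add: y2_def)
          qed simp
        qed
        thus ?thesis using j True by (simp add: sum.remove[of "{..<\<rho>}" j] y2_def)
      qed
      show ?thesis unfolding P_def using XY[OF j(1)] s True by (simp add: Q_def x2_def y2_def del: index_mult_mat_vec)
    next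
      case False
      have s: "(\<Sum>i<\<rho>. R $$ (i,j) * y2 i $ r) = (\<Sum>i<\<rho>. R $$ (i,j) * y i $ r)"
        if "R = RA \<or> R = RB" for R r
      proof (intro sum.cong refl)
        fix i assume i: "i \<in> {..<\<rho>}"
        show "R $$ (i,j) * y2 i $ r = R $$ (i,j) * y i $ r"
        proof (cases "R $$ (i,j) = 0 \<or> i = j")
          case False': False
          hence "\<sigma> i < \<sigma> j" using tri[of i j] i j that by auto
          thus ?thesis using j by (simp add: y2_def)
        qed (use False in \<open>auto simp: y2_def\<close>)
      qed
      have "P x y j" using xy j False by simp
      thus ?thesis unfolding P_def using s False by (simp add: x2_def y2_def del: index_mult_mat_vec)
    qed
    thus ?case by blast
  qed auto
  then obtain x y where "\<And>j. j < \<rho> \<Longrightarrow> \<sigma> j < Suc (Max (\<sigma> ` {..<\<rho>})) \<Longrightarrow> P x y j" by metis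
  moreover have "\<sigma> j < Suc (Max (\<sigma> ` {..<\<rho>}))" if "j < \<rho>" for j
    using that by (intro le_imp_less_Suc Max_ge) auto
  ultimately have P: "\<And>j. j < \<rho> \<Longrightarrow> P x y j" by blast
  define X where "X = mat c \<rho> (\<lambda>(i,j). x j $ i)"
  define Y where "Y = mat a \<rho> (\<lambda>(i,j). y j $ i)"
  have X: "X \<in> carrier_mat c \<rho>" and Y: "Y \<in> carrier_mat a \<rho>" by (auto simp: X_def Y_def)
  have colX: "col X j = x j" if "j < \<rho>" for j
    using P[OF that] that by (intro eq_vecI) (auto simp: X_def P_def)
  have YR: "(Y * R) $$ (r,j) = (\<Sum>i<\<rho>. R $$ (i,j) * y i $ r)" if "R \<in> carrier_mat \<rho> \<rho>" "r < a" "j < \<rho>" for R r j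
  proof -
    have "(Y * R) $$ (r,j) = (\<Sum>i\<in>{0..<\<rho>}. Y $$ (r,i) * R $$ (i,j))"
      using that Y by (simp add: scalar_prod_def)
    thus ?thesis using that by (simp add: Y_def atLeast0LessThan mult.commute)
  qed
  have SX: "(S * X) $$ (r,j) = (S *\<^sub>v x j) $ r" if "S \<in> carrier_mat a c" "r < a" "j < \<rho>" for S r j
    using that X colX by simp
  have "SA * X = Y * RA" "SB * X = Y * RB"
    using P SA SB RA RB X Y unfolding P_def by (auto intro!: eq_matI simp: SX YR simp del: index_mult_mat(1) index_mult_mat_vec)
  moreover have "V * X = H"
  proof (rule mat_col_eqI)
    fix j assume "j < dim_col H"
    hence j: "j < \<rho>" using H by simp
    show "col (V * X) j = col H j" unfolding col_mult2[OF V X j] colX[OF j] using P[OF j] by (simp add: P_def)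
  qed (use V X H in auto)
  ultimately show thesis using that X Y by blast
qed

section \<open>Deflating subspaces\<close>

lemma pencil_at_mult_right:
  assumes A: "A \<in> carrier_mat n m" and B: "B \<in> carrier_mat n m" and SA: "SA \<in> carrier_mat a c"
    and SB: "SB \<in> carrier_mat a c" and Q: "Q \<in> carrier_mat m c" and R: "R \<in> carrier_mat n a"
    and "A * Q = R * SA" "B * Q = R * SB"
  shows "pencil_at A B \<mu> * Q = R * pencil_at SA SB \<mu>"
proof (cases \<mu>)
  case (Fin z)
  have "pencil A B z * Q = A * Q - (z \<cdot>\<^sub>m B) * Q" unfolding pencil_def
    using A B Q by (intro minus_mult_distrib_mat) auto
  also have "(z \<cdot>\<^sub>m B) * Q = R * (z \<cdot>\<^sub>m SB)"
    using assms by (simp add: mult_smult_assoc_mat[OF B Q] mult_smult_distrib[OF R SB])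
  also have "A * Q - R * (z \<cdot>\<^sub>m SB) = R * pencil SA SB z" unfolding pencil_def \<open>A * Q = R * SA\<close>
    using R SA SB by (intro mult_minus_distrib_mat[symmetric]) auto
  finally show ?thesis using Fin by simp
qed (use assms in auto)

lemma pencil_at_mult_left:
  assumes A: "A \<in> carrier_mat n m" and B: "B \<in> carrier_mat n m" and SA: "SA \<in> carrier_mat a c"
    and SB: "SB \<in> carrier_mat a c" and P: "P \<in> carrier_mat a n" and T: "T \<in> carrier_mat c m"
    and "P * A = SA * T" "P * B = SB * T"
  shows "P * pencil_at A B \<mu> = pencil_at SA SB \<mu> * T"
proof (cases \<mu>)
  case (Fin z)
  have "pencil SA SB z * T = SA * T - (z \<cdot>\<^sub>m SB) * T" unfolding pencil_def
    using SA SB T by (intro minus_mult_distrib_mat) auto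
  also have "(z \<cdot>\<^sub>m SB) * T = P * (z \<cdot>\<^sub>m B)"
    using assms by (simp add: mult_smult_assoc_mat[OF SB T] mult_smult_distrib[OF P B])
  also have "SA * T - P * (z \<cdot>\<^sub>m B) = P * pencil A B z" unfolding pencil_def \<open>P * A = SA * T\<close>[symmetric]
    using P A B by (intro mult_minus_distrib_mat[symmetric]) auto
  finally show ?thesis using Fin by simp
qed (use assms in auto)

lemma pencil_dir_mult_right:
  assumes "A \<in> carrier_mat n m" "B \<in> carrier_mat n m" "SA \<in> carrier_mat a c"
    "SB \<in> carrier_mat a c" "Q \<in> carrier_mat m c" "R \<in> carrier_mat n a"
    "A * Q = R * SA" "B * Q = R * SB"
  shows "pencil_dir A B \<mu> * Q = R * pencil_dir SA SB \<mu>"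
  using assms by (cases \<mu>) auto

text \<open>Entries of the adjugate are signed minors, so continuity needs no division by the
  determinant.\<close>

lemma isCont_adj_mat:
  fixes M :: "complex \<Rightarrow> complex mat"
  assumes M: "\<And>t. M t \<in> carrier_mat c c"
    and cont: "\<And>i j. i < c \<Longrightarrow> j < c \<Longrightarrow> isCont (\<lambda>t. M t $$ (i,j)) x"
    and ij: "i < c" "j < c"
  shows "isCont (\<lambda>t. adj_mat (M t) $$ (i,j)) x"
proof -
  have dim: "dim_row (M t) = c" "dim_col (M t) = c" for t using M[of t] by auto
  have "isCont (\<lambda>t. det (mat_delete (M t) j i)) x"
  proof (rule isCont_det)
    show "mat_delete (M t) j i \<in> carrier_mat (c - 1) (c - 1)" for t
      using mat_delete_carrier[OF M] .
    show "isCont (\<lambda>t. mat_delete (M t) j i $$ (i', j')) x" if "i' < c - 1" "j' < c - 1" for i' j'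
      using that by (auto simp: mat_delete_def dim intro!: cont)
  qed
  thus ?thesis using ij by (simp add: adj_mat_def dim cofactor_def)
qed

text \<open>Where a block has full row rank, each of its kernel vectors continues to nearby points: complete
  the block to a nonsingular matrix and use the adjugate.\<close>

lemma full_row_rank_germ_kernel:
  fixes S S' E F Q R :: "complex mat"
  assumes S: "S \<in> carrier_mat a c" and S': "S' \<in> carrier_mat a c" and G: "G \<in> carrier_mat c a"
    and SG: "S * G = 1\<^sub>m a" and y: "y \<in> carrier_vec c" "S *\<^sub>v y = 0\<^sub>v a"
    and E: "E \<in> carrier_mat n n" and F: "F \<in> carrier_mat n n" and Q: "Q \<in> carrier_mat n c"
    and R: "R \<in> carrier_mat n a" and EQ: "E * Q = R * S" and FQ: "F * Q = R * S'"
  shows "Q *\<^sub>v y \<in> germ_kernel n E F"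
proof -
  have ac: "a \<le> c" by (rule left_inverse_dim_le[OF S G SG])
  obtain W X where W: "W \<in> carrier_mat (c - a) c" and X: "X \<in> carrier_mat c (c - a)"
    and WX: "W * X = 1\<^sub>m (c - a)" "S * X = 0\<^sub>m a (c - a)" "W * G = 0\<^sub>m (c - a) a"
    using complement_matrix[OF S G SG] by metis
  \<comment> \<open>The added rows \<open>W\<close> do not depend on \<open>t\<close>, and at
    \<open>t = 0\<close> the completed matrix has the inverse \<open>hcat G X\<close>.\<close>
  define M where "M = (\<lambda>t. (S + t \<cdot>\<^sub>m S') @\<^sub>r W)"
  have St: "S + t \<cdot>\<^sub>m S' \<in> carrier_mat a c" for t using S S' by auto
  have M: "M t \<in> carrier_mat c c" for t using carrier_append_rows[OF St W] ac by (simp add: M_def)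
  have S0: "S + 0 \<cdot>\<^sub>m S' = S" using S S' by (intro eq_matI) auto
  have "M 0 * hcat G X = 1\<^sub>m c" unfolding M_def S0
    using append_rows_mult_hcat[OF S W G X] SG WX ac by simp
  moreover have "hcat G X \<in> carrier_mat c c" using hcat_carrier[OF G X] ac by simp
  ultimately have "det (M 0) * det (hcat G X) = 1" using det_mult[OF M] by (metis det_one)
  hence d0: "det (M 0) \<noteq> 0" by auto
  \<comment> \<open>Since \<open>S *\<^sub>v y = 0\<close>, the first \<open>a\<close> entries of
    \<open>w\<close> vanish. A vector that \<open>M t\<close> maps to a multiple of \<open>w\<close>
    is thus a null vector of \<open>S + t S'\<close>.\<close>
  define w where "w = M 0 *\<^sub>v y"
  have w: "w \<in> carrier_vec c" unfolding w_def by (rule mult_mat_vec_carrier[OF M y(1)])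
  have w0: "w $ i = 0" if "i < a" for i
    using that mat_mult_append[OF S W y(1)] y W ac unfolding w_def M_def S0 by simp
  \<comment> \<open>With the adjugate in place of the inverse, \<open>M t *\<^sub>v z t\<close> is a
    multiple of \<open>w\<close> even where \<open>M t\<close> is singular. The kernel relation then
    holds for every \<open>t\<close>, as \<open>germ_kernel\<close> demands; the constant factor
    gives \<open>z 0 = y\<close>.\<close>
  define z where "z = (\<lambda>t. (1 / det (M 0)) \<cdot>\<^sub>v (adj_mat (M t) *\<^sub>v w))"
  have adj: "adj_mat (M t) \<in> carrier_mat c c" "M t * adj_mat (M t) = det (M t) \<cdot>\<^sub>m 1\<^sub>m c"
    "adj_mat (M t) * M t = det (M t) \<cdot>\<^sub>m 1\<^sub>m c" for t using adj_mat[OF M] by auto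
  have z: "z t \<in> carrier_vec c" for t using adj(1)[of t] w by (auto simp: z_def)
  have one: "(r \<cdot>\<^sub>m 1\<^sub>m c) *\<^sub>v v = r \<cdot>\<^sub>v v" if "v \<in> carrier_vec c" for r :: complex and v
  proof -
    have "(r \<cdot>\<^sub>m 1\<^sub>m c) *\<^sub>v v = r \<cdot>\<^sub>v (1\<^sub>m c *\<^sub>v v)" using that by (intro eq_vecI) auto
    thus ?thesis using that by simp
  qed
  have Mz: "M t *\<^sub>v z t = (1 / det (M 0) * det (M t)) \<cdot>\<^sub>v w" for t
  proof -
    have "M t *\<^sub>v (adj_mat (M t) *\<^sub>v w) = det (M t) \<cdot>\<^sub>v w"
      using assoc_mult_mat_vec[OF M adj(1) w, of t t] adj(2)[of t] one[OF w] by metis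
    moreover have "adj_mat (M t) *\<^sub>v w \<in> carrier_vec c" using adj(1)[of t] w by auto
    ultimately show ?thesis unfolding z_def by (simp add: mult_mat_vec[OF M] smult_smult_assoc)
  qed
  have Sz: "(S + t \<cdot>\<^sub>m S') *\<^sub>v z t = 0\<^sub>v a" for t
  proof (rule eq_vecI)
    fix i assume "i < dim_vec (0\<^sub>v a :: complex vec)"
    hence i: "i < a" by simp
    have "(S + t \<cdot>\<^sub>m S') *\<^sub>v z t \<in> carrier_vec a" "W *\<^sub>v z t \<in> carrier_vec (c - a)"
      using mult_mat_vec_carrier[OF St z] mult_mat_vec_carrier[OF W z] by auto
    hence "((S + t \<cdot>\<^sub>m S') *\<^sub>v z t) $ i = (M t *\<^sub>v z t) $ i"
      unfolding M_def mat_mult_append[OF St W z] using i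
      by (simp add: carrier_vecD del: index_mult_mat_vec dim_mult_mat_vec)
    also have "\<dots> = 0" unfolding Mz using i w w0[OF i] ac by simp
    finally show "((S + t \<cdot>\<^sub>m S') *\<^sub>v z t) $ i = 0\<^sub>v a $ i" using i by simp
  qed (use S S' in auto)
  have "z 0 = y"
  proof -
    have "adj_mat (M 0) *\<^sub>v w = det (M 0) \<cdot>\<^sub>v y" unfolding w_def
      using assoc_mult_mat_vec[OF adj(1) M y(1), of 0 0] adj(3)[of 0] one[OF y(1)] by metis
    thus ?thesis using d0 by (simp add: z_def smult_smult_assoc)
  qed
  moreover have "(E + t \<cdot>\<^sub>m F) *\<^sub>v (Q *\<^sub>v z t) = 0\<^sub>v n" for t
  proof -
    have "(E + t \<cdot>\<^sub>m F) * Q = E * Q + (t \<cdot>\<^sub>m F) * Q" using E F Q by (intro add_mult_distrib_mat) auto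
    also have "\<dots> = R * (S + t \<cdot>\<^sub>m S')" using E F Q R S S' EQ FQ
      by (simp add: mult_smult_assoc_mat[OF F Q] mult_smult_distrib[OF R S'] mult_add_distrib_mat[of _ n a _ c])
    finally have "(E + t \<cdot>\<^sub>m F) *\<^sub>v (Q *\<^sub>v z t) = (R * (S + t \<cdot>\<^sub>m S')) *\<^sub>v z t"
      using E F Q z[of t] by (simp add: assoc_mult_mat_vec[of _ n n _ c, symmetric])
    also have "\<dots> = R *\<^sub>v ((S + t \<cdot>\<^sub>m S') *\<^sub>v z t)" by (rule assoc_mult_mat_vec[OF R St z])
    finally show ?thesis unfolding Sz mult_mat_zero_vec[OF R] .
  qed
  moreover have "isCont (\<lambda>t. (Q *\<^sub>v z t) $ i) 0" if "i < n" for i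
  proof -
    have "isCont (\<lambda>t. M t $$ (i,j)) 0" if "i < c" "j < c" for i j
    proof (cases "i < a")
      case True
      hence "M t $$ (i,j) = S $$ (i,j) + t * S' $$ (i,j)" for t
        using that S S' W by (simp add: M_def append_rows_def)
      thus ?thesis by (simp add: continuous_intros)
    next
      case False
      hence "M t $$ (i,j) = W $$ (i - a,j)" for t
        using that S S' W by (simp add: M_def append_rows_def)
      thus ?thesis by simp
    qed
    hence adjc: "isCont (\<lambda>t. adj_mat (M t) $$ (i,j)) 0" if "i < c" "j < c" for i j
      using that by (intro isCont_adj_mat[OF M]) auto
    have zj: "z t $ j = 1 / det (M 0) * (\<Sum>l\<in>{0..<c}. adj_mat (M t) $$ (j,l) * w $ l)" if "j < c" for j t
      using that adj(1)[of t] w by (simp add: z_def scalar_prod_def)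
    have "(Q *\<^sub>v z t) $ i = (\<Sum>j\<in>{0..<c}. Q $$ (i,j) * (1 / det (M 0) * (\<Sum>l\<in>{0..<c}. adj_mat (M t) $$ (j,l) * w $ l)))" for t
      using that Q z[of t] zj by (simp add: scalar_prod_def)
    thus ?thesis using adjc d0 by (auto intro!: continuous_intros)
  qed
  ultimately show ?thesis unfolding germ_kernel_def using Q z
    by (intro CollectI exI[of _ "\<lambda>t. Q *\<^sub>v z t"]) auto
qed

lemma add_minus_cancel_vec:
  "x \<in> carrier_vec n \<Longrightarrow> y \<in> carrier_vec n \<Longrightarrow> x + (y - x) = (y :: 'a :: ab_group_add vec)"
  by (rule eq_vecI) auto

text \<open>\<open>G *\<^sub>v y\<close> solves the first equation, and the
  \<open>k\<close>-dimensional kernel of the block, with basis \<open>X\<close>, is free for the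
  second. There \<open>W\<close> acts by the square matrix \<open>W * Q * X\<close>. A null vector
  of it would produce a nonzero element of the germ kernel annihilated by \<open>W\<close>, contrary
  to \<open>inj\<close>.\<close>

lemma full_row_rank_solvable:
  fixes A B SA SB Q R T W :: "complex mat"
  assumes A: "A \<in> carrier_mat n n" and B: "B \<in> carrier_mat n n"
    and SA: "SA \<in> carrier_mat a (a + k)" and SB: "SB \<in> carrier_mat a (a + k)"
    and Q: "Q \<in> carrier_mat n (a + k)" and R: "R \<in> carrier_mat n a"
    and T: "T \<in> carrier_mat (a + k) n" and TQ: "T * Q = 1\<^sub>m (a + k)"
    and AQ: "A * Q = R * SA" and BQ: "B * Q = R * SB"
    and W: "W \<in> carrier_mat k n" and G: "G \<in> carrier_mat (a + k) a" and SG: "pencil_at SA SB \<mu> * G = 1\<^sub>m a"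
    and inj: "\<And>x. x \<in> germ_kernel n (pencil_at A B \<mu>) (pencil_dir A B \<mu>) \<Longrightarrow> W *\<^sub>v x = 0\<^sub>v k \<Longrightarrow> x = 0\<^sub>v n"
    and y: "y \<in> carrier_vec a" and v: "v \<in> carrier_vec k"
  shows "\<exists>x\<in>carrier_vec (a + k). pencil_at SA SB \<mu> *\<^sub>v x = y \<and> (W * Q) *\<^sub>v x = v"
proof -
  define S where "S = pencil_at SA SB \<mu>"
  have S: "S \<in> carrier_mat a (a + k)" unfolding S_def by (rule pencil_at_carrier[OF SA SB])
  have SG: "S * G = 1\<^sub>m a" using SG by (simp add: S_def)
  obtain W' X where W': "W' \<in> carrier_mat k (a + k)" and X: "X \<in> carrier_mat (a + k) k"
    and WX: "W' * X = 1\<^sub>m k" "S * X = 0\<^sub>m a k"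
    using complement_matrix[OF S G SG] by (metis add_diff_cancel_left')
  have WQ: "W * Q \<in> carrier_mat k (a + k)" using W Q by auto
  have K: "W * Q * X \<in> carrier_mat k k" using WQ X by auto
  have "det (W * Q * X) \<noteq> 0"
  proof
    assume "det (W * Q * X) = 0"
    then obtain u where u: "u \<in> carrier_vec k" "u \<noteq> 0\<^sub>v k" "(W * Q * X) *\<^sub>v u = 0\<^sub>v k"
      using det_0_iff_vec_prod_zero_field[OF K] by blast
    have Xu: "X *\<^sub>v u \<in> carrier_vec (a + k)" using X u by auto
    have "S *\<^sub>v (X *\<^sub>v u) = 0\<^sub>v a"
      using assoc_mult_mat_vec[OF S X u(1)] WX(2) zero_mat_mult_vec[OF u(1), of a] by simp
    hence "Q *\<^sub>v (X *\<^sub>v u) \<in> germ_kernel n (pencil_at A B \<mu>) (pencil_dir A B \<mu>)"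
      using pencil_at_mult_right[OF A B SA SB Q R AQ BQ] pencil_dir_mult_right[OF A B SA SB Q R AQ BQ]
      by (intro full_row_rank_germ_kernel[OF S pencil_dir_carrier[OF SA SB] G SG Xu _
            pencil_at_carrier[OF A B] pencil_dir_carrier[OF A B] Q R]) (auto simp: S_def)
    moreover have "W *\<^sub>v (Q *\<^sub>v (X *\<^sub>v u)) = 0\<^sub>v k"
      using u assoc_mult_mat_vec[OF W Q Xu] assoc_mult_mat_vec[OF WQ X u(1)] by simp
    ultimately have "Q *\<^sub>v (X *\<^sub>v u) = 0\<^sub>v n" by (rule inj)
    hence "X *\<^sub>v u = 0\<^sub>v (a + k)" by (rule left_inverse_mult_zero[OF T Q TQ Xu])
    hence "u = 0\<^sub>v k" by (rule left_inverse_mult_zero[OF W' X WX(1) u(1)])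
    thus False using u by simp
  qed
  then obtain K' where K': "K' \<in> carrier_mat k k" "(W * Q * X) * K' = 1\<^sub>m k"
    using det_nonzero_inverse[OF K] by metis
  \<comment> \<open>Coordinates along \<open>X\<close> of the amount by which
    \<open>G *\<^sub>v y\<close> misses the second equation.\<close>
  define u where "u = K' *\<^sub>v (v - (W * Q) *\<^sub>v (G *\<^sub>v y))"
  have Gy: "G *\<^sub>v y \<in> carrier_vec (a + k)" using G y by auto
  have WQGy: "(W * Q) *\<^sub>v (G *\<^sub>v y) \<in> carrier_vec k" using WQ Gy by auto
  have vv: "v - (W * Q) *\<^sub>v (G *\<^sub>v y) \<in> carrier_vec k" using v WQGy by auto
  have u: "u \<in> carrier_vec k" using K' vv by (auto simp: u_def)
  have Xu: "X *\<^sub>v u \<in> carrier_vec (a + k)" using X u by auto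
  have "S *\<^sub>v (G *\<^sub>v y + X *\<^sub>v u) = S *\<^sub>v (G *\<^sub>v y) + S *\<^sub>v (X *\<^sub>v u)"
    by (rule mult_add_distrib_mat_vec[OF S Gy Xu])
  also have "S *\<^sub>v (G *\<^sub>v y) = y" by (rule left_inverse_inj[OF S G SG y])
  also have "S *\<^sub>v (X *\<^sub>v u) = 0\<^sub>v a"
    using assoc_mult_mat_vec[OF S X u] WX(2) zero_mat_mult_vec[OF u, of a] by simp
  finally have 1: "S *\<^sub>v (G *\<^sub>v y + X *\<^sub>v u) = y" using y by simp
  have "(W * Q) *\<^sub>v (G *\<^sub>v y + X *\<^sub>v u) = (W * Q) *\<^sub>v (G *\<^sub>v y) + (W * Q) *\<^sub>v (X *\<^sub>v u)"
    by (rule mult_add_distrib_mat_vec[OF WQ Gy Xu])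
  also have "(W * Q) *\<^sub>v (X *\<^sub>v u) = (W * Q * X) *\<^sub>v u" by (rule assoc_mult_mat_vec[OF WQ X u, symmetric])
  also have "\<dots> = v - (W * Q) *\<^sub>v (G *\<^sub>v y)" unfolding u_def by (rule left_inverse_inj[OF K K'(1,2) vv])
  also have "(W * Q) *\<^sub>v (G *\<^sub>v y) + (v - (W * Q) *\<^sub>v (G *\<^sub>v y)) = v"
    by (rule add_minus_cancel_vec[OF WQGy v])
  finally have 2: "(W * Q) *\<^sub>v (G *\<^sub>v y + X *\<^sub>v u) = v" .
  show ?thesis using 1 2 unfolding S_def by (intro bexI[of _ "G *\<^sub>v y + X *\<^sub>v u"] conjI) (auto intro: add_carrier_vec Gy Xu)
qed

text \<open>Correcting \<open>Q1\<close> by \<open>Q2 * X\<close> and \<open>R1\<close> by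
  \<open>R2 * Y\<close> keeps the intertwining with \<open>R\<close> as soon as
  \<open>S X = Y R\<close>, and the condition on \<open>W\<close> becomes the inhomogeneous equation
  \<open>(W * Q2) * X = - (W * Q1)\<close>. The order \<sigma> is left open because the transposed
  problem is triangular in the opposite direction.\<close>

lemma deflating_right:
  fixes A B RA RB SA SB Q1 Q2 R1 R2 T W :: "complex mat" and \<sigma> :: "nat \<Rightarrow> nat"
  assumes A: "A \<in> carrier_mat n n" and B: "B \<in> carrier_mat n n"
    and SA: "SA \<in> carrier_mat a (a + k)" and SB: "SB \<in> carrier_mat a (a + k)"
    and RA: "RA \<in> carrier_mat \<rho> \<rho>" and RB: "RB \<in> carrier_mat \<rho> \<rho>"
    and Q1: "Q1 \<in> carrier_mat n \<rho>" and R1: "R1 \<in> carrier_mat n \<rho>"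
    and Q2: "Q2 \<in> carrier_mat n (a + k)" and R2: "R2 \<in> carrier_mat n a"
    and T: "T \<in> carrier_mat (a + k) n" and TQ: "T * Q2 = 1\<^sub>m (a + k)"
    and AQ: "A * Q1 = R1 * RA" "B * Q1 = R1 * RB" "A * Q2 = R2 * SA" "B * Q2 = R2 * SB"
    and W: "W \<in> carrier_mat k n"
    and tri: "\<And>i j. i < \<rho> \<Longrightarrow> j < \<rho> \<Longrightarrow> i \<noteq> j \<Longrightarrow> RA $$ (i,j) \<noteq> 0 \<or> RB $$ (i,j) \<noteq> 0 \<Longrightarrow> \<sigma> i < \<sigma> j"
    and diag: "\<And>j. j < \<rho> \<Longrightarrow> \<exists>\<mu>. point_of_diag \<mu> RA RB j \<and>
      (\<exists>G\<in>carrier_mat (a + k) a. pencil_at SA SB \<mu> * G = 1\<^sub>m a) \<and>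
      (\<forall>x\<in>germ_kernel n (pencil_at A B \<mu>) (pencil_dir A B \<mu>). W *\<^sub>v x = 0\<^sub>v k \<longrightarrow> x = 0\<^sub>v n)"
  obtains X Y where "X \<in> carrier_mat (a + k) \<rho>" "Y \<in> carrier_mat a \<rho>"
    "A * (Q1 + Q2 * X) = (R1 + R2 * Y) * RA" "B * (Q1 + Q2 * X) = (R1 + R2 * Y) * RB"
    "W * (Q1 + Q2 * X) = 0\<^sub>m k \<rho>"
proof -
  have WQ: "W * Q2 \<in> carrier_mat k (a + k)" using W Q2 by auto
  have H: "- (W * Q1) \<in> carrier_mat k \<rho>" using W Q1 by auto
  have diag': "\<exists>\<mu>. point_of_diag \<mu> RA RB j \<and>
      (\<forall>y\<in>carrier_vec a. \<forall>v\<in>carrier_vec k. \<exists>x\<in>carrier_vec (a + k). pencil_at SA SB \<mu> *\<^sub>v x = y \<and> (W * Q2) *\<^sub>v x = v)"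
    if j: "j < \<rho>" for j
  proof -
    obtain \<mu> G where \<mu>: "point_of_diag \<mu> RA RB j" and G: "G \<in> carrier_mat (a + k) a" "pencil_at SA SB \<mu> * G = 1\<^sub>m a"
      and inj: "\<And>x. x \<in> germ_kernel n (pencil_at A B \<mu>) (pencil_dir A B \<mu>) \<Longrightarrow> W *\<^sub>v x = 0\<^sub>v k \<Longrightarrow> x = 0\<^sub>v n"
      using diag[OF j] by blast
    show ?thesis
      using full_row_rank_solvable[OF A B SA SB Q2 R2 T TQ AQ(3,4) W G inj] \<mu>
      by blast
  qed
  have "\<exists>X Y. X \<in> carrier_mat (a + k) \<rho> \<and> Y \<in> carrier_mat a \<rho> \<and> SA * X = Y * RA \<and> SB * X = Y * RB \<and>
    (W * Q2) * X = - (W * Q1)"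
  proof (rule triangular_sylvester[OF SA SB WQ RA RB H])
    fix i j assume "i < \<rho>" "j < \<rho>" "i \<noteq> j" "RA $$ (i,j) \<noteq> 0 \<or> RB $$ (i,j) \<noteq> 0"
    thus "\<sigma> i < \<sigma> j" by (rule tri)
  next
    fix X Y assume "X \<in> carrier_mat (a + k) \<rho>" "Y \<in> carrier_mat a \<rho>" "SA * X = Y * RA" "SB * X = Y * RB"
      "(W * Q2) * X = - (W * Q1)"
    thus "\<exists>X Y. X \<in> carrier_mat (a + k) \<rho> \<and> Y \<in> carrier_mat a \<rho> \<and> SA * X = Y * RA \<and> SB * X = Y * RB \<and>
      (W * Q2) * X = - (W * Q1)" by blast
  qed (rule diag')
  then obtain X Y where X: "X \<in> carrier_mat (a + k) \<rho>" and Y: "Y \<in> carrier_mat a \<rho>"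
    and XY: "SA * X = Y * RA" "SB * X = Y * RB" and WX: "(W * Q2) * X = - (W * Q1)"
    by blast
  have main: "M * (Q1 + Q2 * X) = (R1 + R2 * Y) * RM"
    if "M \<in> carrier_mat n n" "RM \<in> carrier_mat \<rho> \<rho>" "SM \<in> carrier_mat a (a + k)" "M * Q1 = R1 * RM" "M * Q2 = R2 * SM"
      "SM * X = Y * RM" for M RM SM
  proof -
    have "M * (Q1 + Q2 * X) = M * Q1 + M * (Q2 * X)"
      using that Q1 Q2 X by (intro mult_add_distrib_mat) auto
    also have "M * (Q2 * X) = (M * Q2) * X" using that Q2 X by (intro assoc_mult_mat[symmetric]) auto
    also have "\<dots> = R2 * (SM * X)" unfolding that(5) using that R2 X by (intro assoc_mult_mat) auto
    also have "\<dots> = (R2 * Y) * RM" unfolding that(6) using that R2 Y by (intro assoc_mult_mat[symmetric]) auto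
    also have "M * Q1 + (R2 * Y) * RM = (R1 + R2 * Y) * RM" unfolding that(4)
      using that R1 R2 Y by (intro add_mult_distrib_mat[symmetric]) auto
    finally show ?thesis .
  qed
  have "W * (Q1 + Q2 * X) = W * Q1 + W * (Q2 * X)"
    using W Q1 Q2 X by (intro mult_add_distrib_mat) auto
  also have "W * (Q2 * X) = - (W * Q1)" using WX assoc_mult_mat[OF W Q2 X] by simp
  also have "W * Q1 + - (W * Q1) = 0\<^sub>m k \<rho>" using W Q1 by (intro eq_matI) auto
  finally have "W * (Q1 + Q2 * X) = 0\<^sub>m k \<rho>" .
  with that[OF X Y main[OF A RA SA AQ(1,3) XY(1)] main[OF B RB SB AQ(2,4) XY(2)]] show thesis by blast
qed

lemma invertible_mat_of_inverse:
  fixes A :: "'a :: field mat"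
  assumes "A \<in> carrier_mat n n" "B \<in> carrier_mat n n" "A * B = 1\<^sub>m n"
  shows "invertible_mat A"
  using assms(1,2,3) mat_mult_left_right_inverse[OF assms] unfolding invertible_mat_def inverts_mat_def square_mat.simps
  by (metis carrier_matD)

lemma diag_block_mat_pair:
  "diag_block_mat [A, B] =
    four_block_mat A (0\<^sub>m (dim_row A) (dim_col B)) (0\<^sub>m (dim_row B) (dim_col A)) B"
  by (subst diag_block_mat.simps(2)) (simp only: diag_block_mat_singleton Let_def)

text \<open>With complements \<open>X'\<close> of \<open>X\<close> and \<open>Z'\<close> of
  \<open>Z\<close>, the off-diagonal blocks vanish: \<open>Z L X' = R W X' = 0\<close> and
  \<open>Z' L X = Z' Y R = 0\<close>. The last conjunct returns null vectors of the complementary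
  block to the whole pencil and records that \<open>W\<close> annihilates them, from which
  disjointness of the spectra is derived.\<close>

lemma decouple:
  fixes A B RA RB X Y Z W :: "complex mat"
  assumes A: "A \<in> carrier_mat n n" and B: "B \<in> carrier_mat n n"
    and RA: "RA \<in> carrier_mat \<rho> \<rho>" and RB: "RB \<in> carrier_mat \<rho> \<rho>"
    and X: "X \<in> carrier_mat n \<rho>" and Y: "Y \<in> carrier_mat n \<rho>"
    and Z: "Z \<in> carrier_mat \<rho> n" and W: "W \<in> carrier_mat \<rho> n"
    and AX: "A * X = Y * RA" "B * X = Y * RB" and ZA: "Z * A = RA * W" "Z * B = RB * W"
    and ZY: "Z * Y = 1\<^sub>m \<rho>" and WX: "W * X = 1\<^sub>m \<rho>"
  shows "\<exists>P Q RA' RB'. P \<in> carrier_mat n n \<and> invertible_mat P \<and> Q \<in> carrier_mat n n \<and> invertible_mat Q \<and>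
    RA' \<in> carrier_mat (n - \<rho>) (n - \<rho>) \<and> RB' \<in> carrier_mat (n - \<rho>) (n - \<rho>) \<and>
    (\<forall>z. P * pencil A B z * Q = diag_block_mat [pencil RA RB z, pencil RA' RB' z]) \<and>
    (\<forall>\<mu> g. g \<in> carrier_vec (n - \<rho>) \<longrightarrow> g \<noteq> 0\<^sub>v (n - \<rho>) \<longrightarrow> pencil_at RA' RB' \<mu> *\<^sub>v g = 0\<^sub>v (n - \<rho>) \<longrightarrow>
       (\<exists>x\<in>mat_kernel (pencil_at A B \<mu>). x \<noteq> 0\<^sub>v n \<and> W *\<^sub>v x = 0\<^sub>v \<rho>))"
proof -
  define r where "r = n - \<rho>"
  have rn: "\<rho> + r = n" using left_inverse_dim_le[OF W X WX] by (simp add: r_def)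
  obtain W' X' where W': "W' \<in> carrier_mat r n" and X': "X' \<in> carrier_mat n r"
    and W'X': "W' * X' = 1\<^sub>m r" "W * X' = 0\<^sub>m \<rho> r" "W' * X = 0\<^sub>m r \<rho>"
    unfolding r_def using complement_matrix[OF W X WX] by metis
  obtain Z' Y' where Z': "Z' \<in> carrier_mat r n" and Y': "Y' \<in> carrier_mat n r"
    and Z'Y': "Z' * Y' = 1\<^sub>m r" "Z * Y' = 0\<^sub>m \<rho> r" "Z' * Y = 0\<^sub>m r \<rho>" and YZ: "Y * Z + Y' * Z' = 1\<^sub>m n"
    unfolding r_def using complement_matrix[OF Z Y ZY] by metis
  define P where "P = Z @\<^sub>r Z'"
  define Q where "Q = hcat X X'"
  define RA' where "RA' = Z' * A * X'"
  define RB' where "RB' = Z' * B * X'"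
  have P: "P \<in> carrier_mat n n" unfolding P_def using carrier_append_rows[OF Z Z'] rn by simp
  have Q: "Q \<in> carrier_mat n n" unfolding Q_def using hcat_carrier[OF X X'] rn by simp
  have RA': "RA' \<in> carrier_mat r r" and RB': "RB' \<in> carrier_mat r r" using A B X' Z' by (auto simp: RA'_def RB'_def)
  have "P * hcat Y Y' = 1\<^sub>m n" unfolding P_def append_rows_mult_hcat[OF Z Z' Y Y'] using Z'Y' ZY rn by simp
  hence iP: "invertible_mat P" using P hcat_carrier[OF Y Y'] rn by (intro invertible_mat_of_inverse) auto
  have WW: "W @\<^sub>r W' \<in> carrier_mat n n" using carrier_append_rows[OF W W'] rn by simp
  have "(W @\<^sub>r W') * Q = 1\<^sub>m n" unfolding Q_def append_rows_mult_hcat[OF W W' X X'] using W'X' WX rn by simp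
  from mat_mult_left_right_inverse[OF WW Q this] have iQ: "invertible_mat Q"
    by (intro invertible_mat_of_inverse[OF Q WW])
  have RL: "Z' * pencil_at A B \<mu> * X' = pencil_at RA' RB' \<mu>" for \<mu>
  proof (cases \<mu>)
    case (Fin z)
    have "Z' * pencil A B z = Z' * A - Z' * (z \<cdot>\<^sub>m B)" unfolding pencil_def using Z' A B by (intro mult_minus_distrib_mat) auto
    also have "\<dots> * X' = Z' * A * X' - Z' * (z \<cdot>\<^sub>m B) * X'" using Z' A B X' by (intro minus_mult_distrib_mat) auto
    also have "Z' * (z \<cdot>\<^sub>m B) * X' = z \<cdot>\<^sub>m (Z' * B * X')" using Z' B X'
      by (simp add: mult_smult_distrib[OF Z' B] mult_smult_assoc_mat[of _ r n _ r])
    finally show ?thesis using Fin by (simp add: pencil_def RA'_def RB'_def)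
  qed (simp add: RB'_def)
  have LX: "pencil_at A B \<mu> * X = Y * pencil_at RA RB \<mu>" for \<mu>
    by (rule pencil_at_mult_right[OF A B RA RB X Y AX])
  have ZL: "Z * pencil_at A B \<mu> = pencil_at RA RB \<mu> * W" for \<mu>
    by (rule pencil_at_mult_left[OF A B RA RB Z W ZA])
  have split: "P * pencil A B z * Q = diag_block_mat [pencil RA RB z, pencil RA' RB' z]" for z
  proof -
    define L where "L = pencil_at A B (Fin z)"
    define R where "R = pencil_at RA RB (Fin z)"
    have L: "L \<in> carrier_mat n n" unfolding L_def by (rule pencil_at_carrier[OF A B])
    have R: "R \<in> carrier_mat \<rho> \<rho>" unfolding R_def by (rule pencil_at_carrier[OF RA RB])
    have ZL': "Z * L \<in> carrier_mat \<rho> n" "Z' * L \<in> carrier_mat r n" using Z Z' L by auto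
    have "P * L * Q = four_block_mat (Z * L * X) (Z * L * X') (Z' * L * X) (Z' * L * X')"
      unfolding P_def Q_def append_rows_mult[OF Z Z' L] by (rule append_rows_mult_hcat[OF ZL' X X'])
    also have "Z * L * X = R" unfolding L_def ZL R_def[symmetric] using assoc_mult_mat[OF R W X] WX R by simp
    also have "Z * L * X' = 0\<^sub>m \<rho> r" unfolding L_def ZL R_def[symmetric] using assoc_mult_mat[OF R W X'] W'X' R by simp
    also have "Z' * L * X = 0\<^sub>m r \<rho>"
      using assoc_mult_mat[OF Z' L X] LX[of "Fin z"] assoc_mult_mat[OF Z' Y R] Z'Y' R by (simp add: L_def R_def)
    also have "Z' * L * X' = pencil RA' RB' z" unfolding L_def RL by simp
    finally show ?thesis using R pencil_carrier[OF RA' RB', of z] by (simp add: L_def R_def diag_block_mat_pair del: diag_block_mat.simps)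
  qed
  \<comment> \<open>\<open>L X' g\<close> is annihilated by \<open>Z\<close> because
    \<open>W X' = 0\<close>, and by \<open>Z'\<close> because of the choice of \<open>g\<close>. As
    \<open>Y Z + Y' Z' = 1\<close>, it is zero.\<close>
  have ker: "\<exists>x\<in>mat_kernel (pencil_at A B \<mu>). x \<noteq> 0\<^sub>v n \<and> W *\<^sub>v x = 0\<^sub>v \<rho>"
    if g: "g \<in> carrier_vec r" "g \<noteq> 0\<^sub>v r" "pencil_at RA' RB' \<mu> *\<^sub>v g = 0\<^sub>v r" for \<mu> g
  proof (intro bexI conjI)
    define L where "L = pencil_at A B \<mu>"
    have L: "L \<in> carrier_mat n n" unfolding L_def by (rule pencil_at_carrier[OF A B])
    have R: "pencil_at RA RB \<mu> \<in> carrier_mat \<rho> \<rho>" by (rule pencil_at_carrier[OF RA RB])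
    have Xg: "X' *\<^sub>v g \<in> carrier_vec n" using X' g by auto
    have LXg: "L *\<^sub>v (X' *\<^sub>v g) \<in> carrier_vec n" using L Xg by auto
    show W0: "W *\<^sub>v (X' *\<^sub>v g) = 0\<^sub>v \<rho>" using assoc_mult_mat_vec[OF W X' g(1)] W'X' zero_mat_mult_vec[OF g(1), of \<rho>] by simp
    show "X' *\<^sub>v g \<noteq> 0\<^sub>v n" using left_inverse_mult_zero[OF W' X' W'X'(1) g(1)] g(2) by blast
    have ZL': "Z' * L \<in> carrier_mat r n" using Z' L by auto
    have "Z' *\<^sub>v (L *\<^sub>v (X' *\<^sub>v g)) = (Z' * L * X') *\<^sub>v g"
      using assoc_mult_mat_vec[OF Z' L Xg] assoc_mult_mat_vec[OF ZL' X' g(1)] by simp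
    also have "\<dots> = 0\<^sub>v r" unfolding L_def RL by (rule g(3))
    finally have 1: "Z' *\<^sub>v (L *\<^sub>v (X' *\<^sub>v g)) = 0\<^sub>v r" .
    have "Z *\<^sub>v (L *\<^sub>v (X' *\<^sub>v g)) = (pencil_at RA RB \<mu> * W) *\<^sub>v (X' *\<^sub>v g)"
      using assoc_mult_mat_vec[OF Z L Xg] ZL by (simp add: L_def)
    also have "\<dots> = 0\<^sub>v \<rho>" using assoc_mult_mat_vec[OF R W Xg] W0 mult_mat_zero_vec[OF R] by simp
    finally have 2: "Z *\<^sub>v (L *\<^sub>v (X' *\<^sub>v g)) = 0\<^sub>v \<rho>" .
    have "L *\<^sub>v (X' *\<^sub>v g) = (Y * Z + Y' * Z') *\<^sub>v (L *\<^sub>v (X' *\<^sub>v g))" unfolding YZ using LXg by simp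
    also have "\<dots> = (Y * Z) *\<^sub>v (L *\<^sub>v (X' *\<^sub>v g)) + (Y' * Z') *\<^sub>v (L *\<^sub>v (X' *\<^sub>v g))"
      using Y Z Y' Z' LXg by (intro add_mult_distrib_mat_vec) auto
    also have "\<dots> = 0\<^sub>v n" unfolding assoc_mult_mat_vec[OF Y Z LXg] assoc_mult_mat_vec[OF Y' Z' LXg] 1 2
      using mult_mat_zero_vec[OF Y] mult_mat_zero_vec[OF Y'] by simp
    finally show "X' *\<^sub>v g \<in> mat_kernel (pencil_at A B \<mu>)" using Xg unfolding L_def
      by (intro mat_kernelI[OF pencil_at_carrier[OF A B]])
  qed
  show ?thesis
    unfolding r_def[symmetric]
    by (intro exI[of _ P] exI[of _ Q] exI[of _ RA'] exI[of _ RB'] conjI allI impI P iP Q iQ RA' RB' split ker)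
qed

section \<open>Kronecker block form\<close>

text \<open>Inclusion of \<open>m\<close> coordinates at offset \<open>s\<close>; the transpose is
  the matching coordinate projection. Products with them cut out column and row blocks.\<close>

definition incl_mat :: "nat \<Rightarrow> nat \<Rightarrow> nat \<Rightarrow> complex mat" where
  "incl_mat n s m = mat n m (\<lambda>(i,j). if i = s + j then 1 else 0)"

lemma incl_mat_carrier [simp]: "incl_mat n s m \<in> carrier_mat n m"
  by (simp add: incl_mat_def)

lemma mult_incl_mat:
  assumes M: "M \<in> carrier_mat r n" and "s + m \<le> n"
  shows "M * incl_mat n s m = mat r m (\<lambda>(i,j). M $$ (i, s + j))"
proof (rule eq_matI)
  fix i j assume "i < dim_row (mat r m (\<lambda>(i,j). M $$ (i, s + j)))" "j < dim_col (mat r m (\<lambda>(i,j). M $$ (i, s + j)))"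
  hence ij: "i < r" "j < m" by auto
  have "(M * incl_mat n s m) $$ (i,j) = (\<Sum>l\<in>{0..<n}. M $$ (i,l) * (if l = s + j then 1 else 0))"
    using ij M by (simp add: scalar_prod_def incl_mat_def)
  also have "\<dots> = M $$ (i, s + j)" using ij assms(2) by (simp add: if_distrib[of "\<lambda>x. _ * x"] cong: if_cong)
  finally show "(M * incl_mat n s m) $$ (i,j) = mat r m (\<lambda>(i,j). M $$ (i, s + j)) $$ (i,j)" using ij by simp
qed (use M in \<open>auto simp: incl_mat_def\<close>)

lemma incl_mat_mult:
  assumes M: "M \<in> carrier_mat m r" and "s + m \<le> n"
  shows "incl_mat n s m * M = mat n r (\<lambda>(i,j). if s \<le> i \<and> i < s + m then M $$ (i - s, j) else 0)" (is "_ = ?N")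
proof (rule eq_matI)
  fix i j assume "i < dim_row ?N" "j < dim_col ?N"
  hence ij: "i < n" "j < r" by auto
  have "(incl_mat n s m * M) $$ (i,j) = (\<Sum>l\<in>{0..<m}. (if i = s + l then 1 else 0) * M $$ (l,j))"
    using ij M by (simp add: scalar_prod_def incl_mat_def)
  also have "\<dots> = (\<Sum>l\<in>{0..<m}. if l = i - s then (if s \<le> i then M $$ (i - s,j) else 0) else 0)"
    by (intro sum.cong) auto
  also have "\<dots> = ?N $$ (i,j)" using ij by auto
  finally show "(incl_mat n s m * M) $$ (i,j) = ?N $$ (i,j)" .
qed (use M in \<open>auto simp: incl_mat_def\<close>)

lemma incl_mat_transpose_mult:
  assumes M: "M \<in> carrier_mat n r" and "s + m \<le> n"
  shows "transpose_mat (incl_mat n s m) * M = mat m r (\<lambda>(i,j). M $$ (s + i, j))"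
proof -
  have "transpose_mat (incl_mat n s m) * M = transpose_mat (transpose_mat M * incl_mat n s m)"
    using M by (subst transpose_mult[of _ r n _ m]) auto
  also have "\<dots> = mat m r (\<lambda>(i,j). M $$ (s + i, j))"
    using M assms(2) by (subst mult_incl_mat[of _ r]) (auto intro!: eq_matI)
  finally show ?thesis .
qed

lemma mult_incl_mat_transpose:
  assumes M: "M \<in> carrier_mat r m" and "s + m \<le> n"
  shows "M * transpose_mat (incl_mat n s m) = mat r n (\<lambda>(i,j). if s \<le> j \<and> j < s + m then M $$ (i, j - s) else 0)"
proof -
  have "M * transpose_mat (incl_mat n s m) = transpose_mat (incl_mat n s m * transpose_mat M)"
    using M by (subst transpose_mult[of _ n m _ r]) auto
  also have "\<dots> = mat r n (\<lambda>(i,j). if s \<le> j \<and> j < s + m then M $$ (i, j - s) else 0)"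
    using M assms(2) by (subst incl_mat_mult[of _ m r]) (auto intro!: eq_matI)
  finally show ?thesis .
qed

lemma incl_mat_orth:
  assumes "s + m \<le> n" "s' + m' \<le> n" "s + m \<le> s' \<or> s' + m' \<le> s"
  shows "transpose_mat (incl_mat n s m) * incl_mat n s' m' = 0\<^sub>m m m'"
  using assms by (subst incl_mat_transpose_mult[of _ n m']) (auto intro!: eq_matI simp: incl_mat_def)

lemma incl_mat_left_inverse:
  assumes "s + m \<le> n"
  shows "transpose_mat (incl_mat n s m) * incl_mat n s m = 1\<^sub>m m"
  using assms by (subst incl_mat_transpose_mult[of _ n m]) (auto intro!: eq_matI simp: incl_mat_def)

lemma incl_mat_sum:
  assumes "n = r + s + t"
  shows "incl_mat n 0 r * transpose_mat (incl_mat n 0 r) + incl_mat n r s * transpose_mat (incl_mat n r s) +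
    incl_mat n (r + s) t * transpose_mat (incl_mat n (r + s) t) = 1\<^sub>m n"
  using assms by (simp add: mult_incl_mat_transpose[of _ n]) (auto intro!: eq_matI simp: incl_mat_def)

section \<open>Block diagonal matrices with three rectangular blocks\<close>

definition blocks3 :: "complex mat \<Rightarrow> complex mat \<Rightarrow> complex mat \<Rightarrow> complex mat" where
  "blocks3 R S T = diag_block_mat [R, S, T]"

lemma blocks3_carrier:
  assumes "R \<in> carrier_mat r r'" "S \<in> carrier_mat s s'" "T \<in> carrier_mat t t'"
  shows "blocks3 R S T \<in> carrier_mat (r + s + t) (r' + s' + t')"
  using assms unfolding blocks3_def by (intro carrier_matI) (simp_all add: dim_diag_block_mat del: diag_block_mat.simps)

lemma blocks3_index:
  assumes "R \<in> carrier_mat r r'" "S \<in> carrier_mat s s'" "T \<in> carrier_mat t t'"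
    and "i < r + s + t" "j < r' + s' + t'"
  shows "blocks3 R S T $$ (i,j) = (if i < r \<and> j < r' then R $$ (i,j)
     else if r \<le> i \<and> i < r + s \<and> r' \<le> j \<and> j < r' + s' then S $$ (i - r, j - r')
     else if r + s \<le> i \<and> r' + s' \<le> j then T $$ (i - (r + s), j - (r' + s')) else 0)"
proof -
  have "blocks3 R S T = four_block_mat R (0\<^sub>m r (s' + t')) (0\<^sub>m (s + t) r')
     (four_block_mat S (0\<^sub>m s t') (0\<^sub>m t s') T)"
    unfolding blocks3_def using assms
    by (subst diag_block_mat.simps(2)) (simp add: diag_block_mat_pair Let_def del: diag_block_mat.simps)
  thus ?thesis using assms by (auto simp: not_less)
qed

text \<open>The blocks may be rectangular, so row and column offsets differ and each block needs a
  separate inclusion on either side.\<close>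

lemma blocks3_mult_incl:
  assumes R: "R \<in> carrier_mat r r'" and S: "S \<in> carrier_mat s s'" and T: "T \<in> carrier_mat t t'"
    and n: "n = r + s + t" and n': "n' = r' + s' + t'"
  shows "blocks3 R S T * incl_mat n' 0 r' = incl_mat n 0 r * R"
    "blocks3 R S T * incl_mat n' r' s' = incl_mat n r s * S"
    "blocks3 R S T * incl_mat n' (r' + s') t' = incl_mat n (r + s) t * T"
    "transpose_mat (incl_mat n 0 r) * blocks3 R S T = R * transpose_mat (incl_mat n' 0 r')"
    "transpose_mat (incl_mat n r s) * blocks3 R S T = S * transpose_mat (incl_mat n' r' s')"
    "transpose_mat (incl_mat n (r + s) t) * blocks3 R S T = T * transpose_mat (incl_mat n' (r' + s') t')"
proof -
  note D = blocks3_carrier[OF R S T] and I = blocks3_index[OF R S T]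
  show "blocks3 R S T * incl_mat n' 0 r' = incl_mat n 0 r * R"
    using n n' by (simp add: mult_incl_mat[OF D] incl_mat_mult[OF R]) (auto intro!: eq_matI simp: I)
  show "blocks3 R S T * incl_mat n' r' s' = incl_mat n r s * S"
    using n n' by (simp add: mult_incl_mat[OF D] incl_mat_mult[OF S]) (auto intro!: eq_matI simp: I)
  show "blocks3 R S T * incl_mat n' (r' + s') t' = incl_mat n (r + s) t * T"
    using n n' by (simp add: mult_incl_mat[OF D] incl_mat_mult[OF T]) (auto intro!: eq_matI simp: I)
  show "transpose_mat (incl_mat n 0 r) * blocks3 R S T = R * transpose_mat (incl_mat n' 0 r')"
    using n n' by (simp add: incl_mat_transpose_mult[OF D] mult_incl_mat_transpose[OF R]) (auto intro!: eq_matI simp: I)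
  show "transpose_mat (incl_mat n r s) * blocks3 R S T = S * transpose_mat (incl_mat n' r' s')"
    using n n' by (simp add: incl_mat_transpose_mult[OF D] mult_incl_mat_transpose[OF S]) (auto intro!: eq_matI simp: I)
  show "transpose_mat (incl_mat n (r + s) t) * blocks3 R S T = T * transpose_mat (incl_mat n' (r' + s') t')"
    using n n' by (simp add: incl_mat_transpose_mult[OF D] mult_incl_mat_transpose[OF T]) (auto intro!: eq_matI simp: I)
qed

section \<open>Products with the perturbed coefficients\<close>

lemma perturbation_mult_right:
  fixes M U D W X :: "complex mat"
  assumes M: "M \<in> carrier_mat n n" and U: "U \<in> carrier_mat n k" and D: "D \<in> carrier_mat k k"
    and W: "W \<in> carrier_mat k n" and X: "X \<in> carrier_mat n r" and WX: "W * X = 0\<^sub>m k r"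
  shows "(M + \<tau> \<cdot>\<^sub>m (U * D * W)) * X = M * X"
proof -
  have UD: "U * D \<in> carrier_mat n k" and UDW: "U * D * W \<in> carrier_mat n n" using U D W by auto
  have "(M + \<tau> \<cdot>\<^sub>m (U * D * W)) * X = M * X + (\<tau> \<cdot>\<^sub>m (U * D * W)) * X"
    using M UDW X by (intro add_mult_distrib_mat) auto
  also have "(\<tau> \<cdot>\<^sub>m (U * D * W)) * X = \<tau> \<cdot>\<^sub>m ((U * D) * (W * X))"
    using mult_smult_assoc_mat[OF UDW X] assoc_mult_mat[OF UD W X] by simp
  also have "\<dots> = 0\<^sub>m n r" unfolding WX right_mult_zero_mat[OF UD] by (intro eq_matI) auto
  finally show ?thesis using M X by simp
qed

lemma perturbation_mult_left:
  fixes M U D W Z :: "complex mat"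
  assumes M: "M \<in> carrier_mat n n" and U: "U \<in> carrier_mat n k" and D: "D \<in> carrier_mat k k"
    and W: "W \<in> carrier_mat k n" and Z: "Z \<in> carrier_mat r n" and ZU: "Z * U = 0\<^sub>m r k"
  shows "Z * (M + \<tau> \<cdot>\<^sub>m (U * D * W)) = Z * M"
proof -
  have UD: "U * D \<in> carrier_mat n k" and UDW: "U * D * W \<in> carrier_mat n n" using U D W by auto
  have "Z * (M + \<tau> \<cdot>\<^sub>m (U * D * W)) = Z * M + Z * (\<tau> \<cdot>\<^sub>m (U * D * W))"
    using M UDW Z by (intro mult_add_distrib_mat) auto
  also have "Z * (\<tau> \<cdot>\<^sub>m (U * D * W)) = \<tau> \<cdot>\<^sub>m ((Z * U) * D * W)"
    using mult_smult_distrib[OF Z UDW] assoc_mult_mat[OF Z UD W] assoc_mult_mat[OF Z U D] by simp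
  also have "\<dots> = 0\<^sub>m r n" unfolding ZU left_mult_zero_mat[OF D] left_mult_zero_mat[OF W] by (intro eq_matI) auto
  finally show ?thesis using M Z by simp
qed

lemma pencil_at_perturbed:
  fixes A B U DA DB W :: "complex mat"
  assumes A: "A \<in> carrier_mat n n" and B: "B \<in> carrier_mat n n" and U: "U \<in> carrier_mat n k"
    and DA: "DA \<in> carrier_mat k k" and DB: "DB \<in> carrier_mat k k" and W: "W \<in> carrier_mat k n"
  shows "pencil_at (A + \<tau> \<cdot>\<^sub>m (U * DA * W)) (B + \<tau> \<cdot>\<^sub>m (U * DB * W)) \<mu> =
    pencil_at A B \<mu> + \<tau> \<cdot>\<^sub>m (U * pencil_at DA DB \<mu> * W)"
proof (cases \<mu>)
  case (Fin z)
  have X: "U * DA * W \<in> carrier_mat n n" "U * DB * W \<in> carrier_mat n n" using U DA DB W by auto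
  have "U * pencil DA DB z * W = U * DA * W - z \<cdot>\<^sub>m (U * DB * W)"
    unfolding pencil_def using U DA DB W
    by (simp add: mult_minus_distrib_mat[of _ n k _ k] minus_mult_distrib_mat[of _ n k _ _ n]
        mult_smult_distrib[of _ n k _ k] mult_smult_assoc_mat[of _ n k _ n])
  thus ?thesis using Fin A B X U W by (auto simp: pencil_def algebra_simps intro!: eq_matI)
qed auto

text \<open>\<open>S\<close> and \<open>T\<close> are the parts of the Kronecker form consisting of the blocks \<open>L\<^sub>m\<close> and
  \<open>L\<^sub>n\<^sup>T\<close>; only their full rank at every point, including infinity, matters.\<close>

locale kronecker_blocks =
  fixes A B P Q Pi Qi RA RB SA SB TA TB :: "complex mat" and n \<rho> a b p q :: nat
  assumes A: "A \<in> carrier_mat n n" and B: "B \<in> carrier_mat n n"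
    and P: "P \<in> carrier_mat n n" and Q: "Q \<in> carrier_mat n n"
    and Pi: "Pi \<in> carrier_mat n n" and Qi: "Qi \<in> carrier_mat n n"
    and PiP: "Pi * P = 1\<^sub>m n" and QiQ: "Qi * Q = 1\<^sub>m n"
    and RA: "RA \<in> carrier_mat \<rho> \<rho>" and RB: "RB \<in> carrier_mat \<rho> \<rho>"
    and SA: "SA \<in> carrier_mat a (a + p)" and SB: "SB \<in> carrier_mat a (a + p)"
    and TA: "TA \<in> carrier_mat (b + q) b" and TB: "TB \<in> carrier_mat (b + q) b"
    and rows: "n = \<rho> + a + (b + q)" and cols: "n = \<rho> + (a + p) + b"
    and PAQ: "P * A * Q = blocks3 RA SA TA" and PBQ: "P * B * Q = blocks3 RB SB TB"
    and S_full: "\<And>\<mu>. \<exists>G\<in>carrier_mat (a + p) a. pencil_at SA SB \<mu> * G = 1\<^sub>m a"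
    and T_full: "\<And>\<mu>. \<exists>G\<in>carrier_mat b (b + q). G * pencil_at TA TB \<mu> = 1\<^sub>m b"
    and R_upper: "\<And>i j. j < i \<Longrightarrow> i < \<rho> \<Longrightarrow> RA $$ (i,j) = 0" "\<And>i j. j < i \<Longrightarrow> i < \<rho> \<Longrightarrow> RB $$ (i,j) = 0"
    and R_diag: "\<And>j. j < \<rho> \<Longrightarrow> \<exists>\<mu>. point_of_diag \<mu> RA RB j"
begin

lemma PPi: "P * Pi = 1\<^sub>m n" and QQi: "Q * Qi = 1\<^sub>m n"
  using mat_mult_left_right_inverse[OF Pi P PiP] mat_mult_left_right_inverse[OF Qi Q QiQ] by auto

text \<open>Index 1 belongs to \<open>R\<close>, 2 to \<open>S\<close>, 3 to \<open>T\<close>. The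
  families \<open>C\<close> and \<open>D\<close> come from the inverses of \<open>P\<close> and
  \<open>Q\<close>, so that \<open>P1\<close>, \<open>P2\<close>, \<open>P3\<close> are dual to the
  former and \<open>D1\<close>, \<open>D2\<close>, \<open>D3\<close> to \<open>Q1\<close>,
  \<open>Q2\<close>, \<open>Q3\<close>.\<close>

definition "Q1 = Q * incl_mat n 0 \<rho>"
definition "Q2 = Q * incl_mat n \<rho> (a + p)"
definition "Q3 = Q * incl_mat n (\<rho> + (a + p)) b"
definition "C1 = Pi * incl_mat n 0 \<rho>"
definition "C2 = Pi * incl_mat n \<rho> a"
definition "C3 = Pi * incl_mat n (\<rho> + a) (b + q)"
definition "P1 = transpose_mat (incl_mat n 0 \<rho>) * P"
definition "P2 = transpose_mat (incl_mat n \<rho> a) * P"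
definition "P3 = transpose_mat (incl_mat n (\<rho> + a) (b + q)) * P"
definition "D1 = transpose_mat (incl_mat n 0 \<rho>) * Qi"
definition "D2 = transpose_mat (incl_mat n \<rho> (a + p)) * Qi"
definition "D3 = transpose_mat (incl_mat n (\<rho> + (a + p)) b) * Qi"

lemma block_carriers:
  "Q1 \<in> carrier_mat n \<rho>" "Q2 \<in> carrier_mat n (a + p)" "Q3 \<in> carrier_mat n b"
  "C1 \<in> carrier_mat n \<rho>" "C2 \<in> carrier_mat n a" "C3 \<in> carrier_mat n (b + q)"
  "P1 \<in> carrier_mat \<rho> n" "P2 \<in> carrier_mat a n" "P3 \<in> carrier_mat (b + q) n"
  "D1 \<in> carrier_mat \<rho> n" "D2 \<in> carrier_mat (a + p) n" "D3 \<in> carrier_mat b n"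
  unfolding Q1_def Q2_def Q3_def C1_def C2_def C3_def P1_def P2_def P3_def D1_def D2_def D3_def
  by (auto intro!: mult_carrier_mat[of _ _ n] P Q Pi Qi)

lemma DQ_mult:
  assumes "X \<in> carrier_mat n r" "Y \<in> carrier_mat n s"
  shows "(transpose_mat X * Qi) * (Q * Y) = transpose_mat X * Y"
    "(transpose_mat X * P) * (Pi * Y) = transpose_mat X * Y"
proof -
  have X: "transpose_mat X \<in> carrier_mat r n" using assms by auto
  have "(transpose_mat X * Qi) * (Q * Y) = transpose_mat X * (Qi * (Q * Y))"
    using assms(2) Q by (intro assoc_mult_mat[OF X Qi]) auto
  also have "Qi * (Q * Y) = Y" using assoc_mult_mat[OF Qi Q assms(2)] QiQ assms(2) by simp
  finally show "(transpose_mat X * Qi) * (Q * Y) = transpose_mat X * Y" .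
  have "(transpose_mat X * P) * (Pi * Y) = transpose_mat X * (P * (Pi * Y))"
    using assms(2) Pi by (intro assoc_mult_mat[OF X P]) auto
  also have "P * (Pi * Y) = Y" using assoc_mult_mat[OF P Pi assms(2)] PPi assms(2) by simp
  finally show "(transpose_mat X * P) * (Pi * Y) = transpose_mat X * Y" .
qed

lemma block_inverses:
  "D1 * Q1 = 1\<^sub>m \<rho>" "D1 * Q2 = 0\<^sub>m \<rho> (a + p)" "D2 * Q2 = 1\<^sub>m (a + p)"
  "D3 * Q1 = 0\<^sub>m b \<rho>" "D3 * Q2 = 0\<^sub>m b (a + p)"
  "P1 * C1 = 1\<^sub>m \<rho>" "P1 * C2 = 0\<^sub>m \<rho> a" "P3 * C1 = 0\<^sub>m (b + q) \<rho>" "P3 * C2 = 0\<^sub>m (b + q) a"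
  "P3 * C3 = 1\<^sub>m (b + q)"
  unfolding Q1_def Q2_def Q3_def C1_def C2_def C3_def P1_def P2_def P3_def D1_def D2_def D3_def
    DQ_mult[OF incl_mat_carrier incl_mat_carrier]
  using rows cols by (auto intro!: incl_mat_orth incl_mat_left_inverse)

lemma QD_sum: "Q1 * D1 + Q2 * D2 + Q3 * D3 = 1\<^sub>m n"
proof -
  let ?I = "incl_mat n 0 \<rho>" let ?J = "incl_mat n \<rho> (a + p)" let ?K = "incl_mat n (\<rho> + (a + p)) b"
  have e: "(Q * X) * (transpose_mat X * Qi) = Q * (X * transpose_mat X) * Qi" if "X \<in> carrier_mat n r" for X r
    using that Q Qi by (simp add: assoc_mult_mat[of _ n n _ r _ n] assoc_mult_mat[of _ n n _ n _ n] assoc_mult_mat[of _ n r _ n _ n])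
  have c: "X * transpose_mat X \<in> carrier_mat n n" if "X \<in> carrier_mat n r" for X :: "complex mat" and r
    using that by auto
  have "Q1 * D1 + Q2 * D2 + Q3 * D3 =
    Q * (?I * transpose_mat ?I + ?J * transpose_mat ?J + ?K * transpose_mat ?K) * Qi"
    unfolding Q1_def Q2_def Q3_def D1_def D2_def D3_def e[OF incl_mat_carrier]
    using c[OF incl_mat_carrier] Q Qi
    by (simp add: mult_add_distrib_mat[of _ n n _ n] add_mult_distrib_mat[of _ n n _ _ n])
  also have "\<dots> = 1\<^sub>m n" unfolding incl_mat_sum[OF cols] using Q QQi by simp
  finally show ?thesis .
qed

text \<open>The block form is read on columns as \<open>M * Q = Pi * blocks3 R S T\<close> and on
  rows as \<open>P * M = blocks3 R S T * Qi\<close>; each block then gets its own intertwining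
  relation.\<close>

lemma block_intertwine:
  assumes M: "M \<in> carrier_mat n n" and R: "R \<in> carrier_mat \<rho> \<rho>" and S: "S \<in> carrier_mat a (a + p)"
    and T: "T \<in> carrier_mat (b + q) b" and PMQ: "P * M * Q = blocks3 R S T"
  shows "M * Q1 = C1 * R" "M * Q2 = C2 * S" "P1 * M = R * D1" "P2 * M = S * D2" "P3 * M = T * D3"
proof -
  have D: "blocks3 R S T \<in> carrier_mat n n"
    using blocks3_carrier[OF R S T] by (simp only: rows[symmetric] cols[symmetric])
  note bl = blocks3_mult_incl[OF R S T rows cols]
  have PM': "P * M \<in> carrier_mat n n" and MQ': "M * Q \<in> carrier_mat n n"
    by (rule mult_carrier_mat[OF P M], rule mult_carrier_mat[OF M Q])
  have "Pi * (P * M * Q) = M * Q"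
    unfolding assoc_mult_mat[OF P M Q] assoc_mult_mat[OF Pi P MQ', symmetric] PiP by (rule left_mult_one_mat[OF MQ'])
  hence MQ: "M * Q = Pi * blocks3 R S T" unfolding PMQ by (rule sym)
  have "(P * M * Q) * Qi = P * M"
    unfolding assoc_mult_mat[OF PM' Q Qi] QQi by (rule right_mult_one_mat[OF PM'])
  hence PM: "P * M = blocks3 R S T * Qi" unfolding PMQ by (rule sym)
  have 1: "M * (Q * X) = (Pi * Y) * Z"
    if X: "X \<in> carrier_mat n r" "Y \<in> carrier_mat n s" "Z \<in> carrier_mat s r" "blocks3 R S T * X = Y * Z" for X Y Z r s
  proof -
    have "M * (Q * X) = Pi * (blocks3 R S T * X)"
      using assoc_mult_mat[OF M Q X(1)] assoc_mult_mat[OF Pi D X(1)] MQ by simp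
    thus ?thesis unfolding X(4) using assoc_mult_mat[OF Pi X(2,3)] by simp
  qed
  have 2: "(X * P) * M = Z * (Y * Qi)"
    if X: "X \<in> carrier_mat r n" "Y \<in> carrier_mat s n" "Z \<in> carrier_mat r s" "X * blocks3 R S T = Z * Y" for X Y Z r s
  proof -
    have "(X * P) * M = (X * blocks3 R S T) * Qi"
      using assoc_mult_mat[OF X(1) P M] assoc_mult_mat[OF X(1) D Qi] PM by simp
    thus ?thesis unfolding X(4) using assoc_mult_mat[OF X(3,2) Qi] by simp
  qed
  show "M * Q1 = C1 * R" unfolding Q1_def C1_def by (rule 1[OF _ _ R bl(1)]) auto
  show "M * Q2 = C2 * S" unfolding Q2_def C2_def by (rule 1[OF _ _ S bl(2)]) auto
  show "P1 * M = R * D1" unfolding P1_def D1_def by (rule 2[OF _ _ R bl(4)]) auto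
  show "P2 * M = S * D2" unfolding P2_def D2_def by (rule 2[OF _ _ S bl(5)]) auto
  show "P3 * M = T * D3" unfolding P3_def D3_def by (rule 2[OF _ _ T bl(6)]) auto
qed

lemmas A_blocks = block_intertwine[OF A RA SA TA PAQ]
lemmas B_blocks = block_intertwine[OF B RB SB TB PBQ]

abbreviation E where "E \<equiv> pencil_at A B"
abbreviation R where "R \<equiv> pencil_at RA RB"
abbreviation S where "S \<equiv> pencil_at SA SB"
abbreviation T where "T \<equiv> pencil_at TA TB"

lemma E_carrier: "E \<mu> \<in> carrier_mat n n" and R_carrier: "R \<mu> \<in> carrier_mat \<rho> \<rho>"
  and S_carrier: "S \<mu> \<in> carrier_mat a (a + p)" and T_carrier: "T \<mu> \<in> carrier_mat (b + q) b"
  using A B RA RB SA SB TA TB by (auto intro: pencil_at_carrier)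

lemma E_blocks:
  "E \<mu> * Q1 = C1 * R \<mu>" "E \<mu> * Q2 = C2 * S \<mu>"
  "P1 * E \<mu> = R \<mu> * D1" "P2 * E \<mu> = S \<mu> * D2" "P3 * E \<mu> = T \<mu> * D3"
  using pencil_at_mult_right[OF A B RA RB block_carriers(1,4) A_blocks(1) B_blocks(1)]
    pencil_at_mult_right[OF A B SA SB block_carriers(2,5) A_blocks(2) B_blocks(2)]
    pencil_at_mult_left[OF A B RA RB block_carriers(7,10) A_blocks(3) B_blocks(3)]
    pencil_at_mult_left[OF A B SA SB block_carriers(8,11) A_blocks(4) B_blocks(4)]
    pencil_at_mult_left[OF A B TA TB block_carriers(9,12) A_blocks(5) B_blocks(5)]
  by auto

lemma p_eq_q: "p = q" using rows cols by simp

text \<open>\<open>S \<mu>\<close> has a kernel of dimension \<open>p\<close> at every point.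
  \<open>Q2\<close> embeds it into the kernel of the pencil, without any regular component.\<close>

lemma singular_null_basis:
  obtains N Y where "N \<in> carrier_mat n p" "Y \<in> carrier_mat p n" "Y * N = 1\<^sub>m p" "E \<mu> * N = 0\<^sub>m n p"
    "D1 * N = 0\<^sub>m \<rho> p"
proof -
  obtain G where G: "G \<in> carrier_mat (a + p) a" "S \<mu> * G = 1\<^sub>m a" using S_full by blast
  obtain W X where W: "W \<in> carrier_mat p (a + p)" and X: "X \<in> carrier_mat (a + p) p"
    and WX: "W * X = 1\<^sub>m p" "S \<mu> * X = 0\<^sub>m a p"
    using complement_matrix[OF S_carrier G] by (metis add_diff_cancel_left')
  note c = block_carriers
  have "(W * D2) * (Q2 * X) = W * (D2 * (Q2 * X))" using c X by (intro assoc_mult_mat[OF W c(11)]) auto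
  also have "D2 * (Q2 * X) = X" using assoc_mult_mat[OF c(11,2) X] block_inverses(3) X by simp
  finally have 1: "(W * D2) * (Q2 * X) = 1\<^sub>m p" using WX by simp
  have "E \<mu> * (Q2 * X) = C2 * (S \<mu> * X)"
    using assoc_mult_mat[OF E_carrier c(2) X, of \<mu>] assoc_mult_mat[OF c(5) S_carrier X, of \<mu>] E_blocks(2)[of \<mu>] by simp
  hence 2: "E \<mu> * (Q2 * X) = 0\<^sub>m n p" using WX c by simp
  have 3: "D1 * (Q2 * X) = 0\<^sub>m \<rho> p" using assoc_mult_mat[OF c(10,2) X] block_inverses(2) X by simp
  show thesis by (rule that[OF _ _ 1 2 3]) (use c W X in auto)
qed

lemma det_R: "det (R \<mu>) = (\<Prod>j<\<rho>. R \<mu> $$ (j,j))"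
proof -
  have "upper_triangular (R \<mu>)"
    using RA RB R_upper by (cases \<mu>) (auto simp: pencil_def)
  from det_upper_triangular[OF this R_carrier] show ?thesis
    using R_carrier[of \<mu>] by (simp add: diag_mat_def prod.distinct_set_conv_list[symmetric] atLeast0LessThan)
qed

text \<open>Avoiding the diagonal entries of \<open>RA\<close> is enough, since a diagonal pair
  belonging to infinity gives the constant entry 1.\<close>

lemma R_nonsingular: "\<exists>z. det (R (Fin z)) \<noteq> 0"
proof -
  have "finite ((\<lambda>j. RA $$ (j,j)) ` {..<\<rho>})" by simp
  then obtain z where z: "z \<notin> (\<lambda>j. RA $$ (j,j)) ` {..<\<rho>}" using ex_new_if_finite[OF infinite_UNIV_char_0] by blast
  have "R (Fin z) $$ (j,j) \<noteq> 0" if j: "j < \<rho>" for j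
  proof -
    obtain \<mu> where "point_of_diag \<mu> RA RB j" using R_diag[OF j] by blast
    thus ?thesis using j z RA RB by (cases \<mu>) (auto simp: point_of_diag_def pencil_def)
  qed
  thus ?thesis unfolding det_R by (intro exI[of _ z]) auto
qed

lemma R_diag_singular:
  assumes "j < \<rho>" "point_of_diag \<mu> RA RB j"
  shows "det (R \<mu>) = 0"
proof -
  have "R \<mu> $$ (j,j) = 0" using assms RA RB by (cases \<mu>) (auto simp: point_of_diag_def pencil_def)
  thus ?thesis unfolding det_R using assms(1) by auto
qed

text \<open>The row relations send null vectors to null vectors of each block, and
  \<open>T \<mu>\<close> is injective at every point.\<close>

lemma block_null:
  assumes N: "N \<in> carrier_mat n m" and EN: "E \<mu> * N = 0\<^sub>m n m"
  shows "R \<mu> * (D1 * N) = 0\<^sub>m \<rho> m" "S \<mu> * (D2 * N) = 0\<^sub>m a m" "D3 * N = 0\<^sub>m b m"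
proof -
  note c = block_carriers
  show "R \<mu> * (D1 * N) = 0\<^sub>m \<rho> m"
    using assoc_mult_mat[OF R_carrier c(10) N, of \<mu>] assoc_mult_mat[OF c(7) E_carrier N, of \<mu>] E_blocks(3)[of \<mu>] EN c by simp
  show "S \<mu> * (D2 * N) = 0\<^sub>m a m"
    using assoc_mult_mat[OF S_carrier c(11) N, of \<mu>] assoc_mult_mat[OF c(8) E_carrier N, of \<mu>] E_blocks(4)[of \<mu>] EN c by simp
  have T0: "T \<mu> * (D3 * N) = 0\<^sub>m (b + q) m"
    using assoc_mult_mat[OF T_carrier c(12) N, of \<mu>] assoc_mult_mat[OF c(9) E_carrier N, of \<mu>] E_blocks(5)[of \<mu>] EN c by simp
  obtain G where G: "G \<in> carrier_mat b (b + q)" "G * T \<mu> = 1\<^sub>m b" using T_full by blast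
  have "D3 * N = (G * T \<mu>) * (D3 * N)" using G c N by simp
  also have "\<dots> = G * (T \<mu> * (D3 * N))" using c N by (intro assoc_mult_mat[OF G(1) T_carrier]) auto
  also have "\<dots> = 0\<^sub>m b m" unfolding T0 using G by simp
  finally show "D3 * N = 0\<^sub>m b m" .
qed

lemma mrank_E_le: "mrank (E \<mu>) \<le> n - p" "p \<le> n"
proof -
  obtain N Y where N: "N \<in> carrier_mat n p" "Y \<in> carrier_mat p n" "Y * N = 1\<^sub>m p" "E \<mu> * N = 0\<^sub>m n p"
    by (rule singular_null_basis)
  from nullity_bound[OF E_carrier N] show "p \<le> n" by simp
  moreover have "mrank (E \<mu>) \<le> n" by (rule mrank_nullspace[OF E_carrier])
  ultimately show "mrank (E \<mu>) \<le> n - p" using nullity_bound[OF E_carrier N] by simp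
qed

text \<open>Where \<open>R\<close> is nonsingular, the kernel lies in the range of \<open>Q2\<close>
  and corresponds to the kernel of \<open>S\<close>, of dimension \<open>p\<close>. The opposite
  bound holds at all points by \<open>mrank_E_le\<close>.\<close>

lemma nrank_blocks: "nrank A B = n - p"
proof -
  obtain z where z: "det (R (Fin z)) \<noteq> 0" using R_nonsingular by blast
  let ?\<mu> = "Fin z"
  define r where "r = n - mrank (E ?\<mu>)"
  obtain N Y where N: "N \<in> carrier_mat n r" and Y: "Y \<in> carrier_mat r n"
    and YN: "Y * N = 1\<^sub>m r" and ran: "mrange N = mat_kernel (E ?\<mu>)" and le: "mrank (E ?\<mu>) \<le> n"
    unfolding r_def using mrank_nullspace[OF E_carrier] by metis
  have EN: "E ?\<mu> * N = 0\<^sub>m n r"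
  proof (rule mat_col_eqI)
    fix j assume "j < dim_col (0\<^sub>m n r :: complex mat)"
    hence j: "j < r" by simp
    have "col N j = N *\<^sub>v unit_vec r j" using j N by (metis carrier_matD(2) mat_mult_unit_vec)
    hence "col N j \<in> mrange N" unfolding mrange_def using N by auto
    hence "E ?\<mu> *\<^sub>v col N j = 0\<^sub>v n" unfolding ran mat_kernel[OF E_carrier] by simp
    thus "col (E ?\<mu> * N) j = col (0\<^sub>m n r) j" unfolding col_mult2[OF E_carrier N j] using j by simp
  qed (use E_carrier[of ?\<mu>] N in auto)
  note c = block_carriers and z0 = block_null[OF N EN]
  obtain Ri where Ri: "Ri \<in> carrier_mat \<rho> \<rho>" "Ri * R ?\<mu> = 1\<^sub>m \<rho>" using det_nonzero_inverse[OF R_carrier z] by metis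
  have D1N: "D1 * N = 0\<^sub>m \<rho> r"
  proof -
    have "D1 * N = (Ri * R ?\<mu>) * (D1 * N)" using Ri c N by simp
    also have "\<dots> = Ri * (R ?\<mu> * (D1 * N))" using c N by (intro assoc_mult_mat[OF Ri(1) R_carrier]) auto
    also have "\<dots> = 0\<^sub>m \<rho> r" unfolding z0 using Ri by simp
    finally show ?thesis .
  qed
  have "N = (Q1 * D1 + Q2 * D2 + Q3 * D3) * N" unfolding QD_sum using N by simp
  also have "\<dots> = Q1 * (D1 * N) + Q2 * (D2 * N) + Q3 * (D3 * N)"
    using c N by (simp add: add_mult_distrib_mat[of _ n n _ _ r] assoc_mult_mat[of _ n \<rho> _ n _ r]
        assoc_mult_mat[of _ n "a + p" _ n _ r] assoc_mult_mat[of _ n b _ n _ r])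
  also have "\<dots> = Q2 * (D2 * N)" unfolding D1N z0(3) using c N by simp
  finally have NQ: "N = Q2 * (D2 * N)" .
  have D2N: "D2 * N \<in> carrier_mat (a + p) r" using c N by auto
  have "(Y * Q2) * (D2 * N) = Y * (Q2 * (D2 * N))" using Y c D2N by (intro assoc_mult_mat) auto
  hence "(Y * Q2) * (D2 * N) = 1\<^sub>m r" unfolding NQ[symmetric] YN .
  moreover have "Y * Q2 \<in> carrier_mat r (a + p)" using Y c by auto
  ultimately have "r \<le> a + p - mrank (S ?\<mu>)" using nullity_bound[OF S_carrier D2N] z0(2) by blast
  moreover obtain G where G: "G \<in> carrier_mat (a + p) a" "S ?\<mu> * G = 1\<^sub>m a" using S_full by blast
  have "mrank (1\<^sub>m a * S ?\<mu>) = a"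
    by (rule mrank_eq[of "1\<^sub>m a" a a _ "a + p" "1\<^sub>m a" G]) (use G S_carrier[of "Fin z"] in auto)
  hence "mrank (S ?\<mu>) = a" using S_carrier[of ?\<mu>] by simp
  ultimately have "n - p \<le> mrank (E ?\<mu>)" using le by (simp add: r_def)
  hence "n - p \<le> nrank A B" using nrank_attained(1)[OF A B, of z] by simp
  moreover obtain w where "mrank (pencil A B w) = nrank A B" using nrank_attained(2)[OF A B] by blast
  hence "nrank A B \<le> n - p" using mrank_E_le(1)[of "Fin w"] by simp
  ultimately show ?thesis by simp
qed

text \<open>A null vector \<open>u\<close> of \<open>R \<mu>\<close> gives the kernel vector
  \<open>Q1 *\<^sub>v u\<close>, which \<open>D1\<close> separates from the \<open>p\<close> kernel
  vectors of the singular part. The nullity then exceeds its normal value \<open>p\<close>.\<close>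

lemma R_singular_eigenvalue:
  assumes "det (R \<mu>) = 0"
  shows "\<mu> \<in> eigenvalues A B"
proof -
  note c = block_carriers
  obtain u where u: "u \<in> carrier_vec \<rho>" "u \<noteq> 0\<^sub>v \<rho>" "R \<mu> *\<^sub>v u = 0\<^sub>v \<rho>"
    using assms det_0_iff_vec_prod_zero_field[OF R_carrier] by blast
  obtain N Y where N: "N \<in> carrier_mat n p" and Y: "Y \<in> carrier_mat p n" and YN: "Y * N = 1\<^sub>m p"
    and EN: "E \<mu> * N = 0\<^sub>m n p" and D1N: "D1 * N = 0\<^sub>m \<rho> p"
    by (rule singular_null_basis)
  have y: "Q1 *\<^sub>v u \<in> carrier_vec n" using c u by auto
  have Ey: "E \<mu> *\<^sub>v (Q1 *\<^sub>v u) = 0\<^sub>v n"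
    using assoc_mult_mat_vec[OF E_carrier c(1) u(1), of \<mu>] assoc_mult_mat_vec[OF c(4) R_carrier u(1), of \<mu>]
      E_blocks(1)[of \<mu>] u(3) mult_mat_zero_vec[OF c(4)] by simp
  have "Q1 *\<^sub>v u \<notin> mrange N"
  proof
    assume "Q1 *\<^sub>v u \<in> mrange N"
    then obtain v where v: "v \<in> carrier_vec p" "Q1 *\<^sub>v u = N *\<^sub>v v" using N by (auto simp: mrange_def)
    have "u = D1 *\<^sub>v (Q1 *\<^sub>v u)" by (rule left_inverse_inj[OF c(10,1) block_inverses(1) u(1), symmetric])
    also have "\<dots> = 0\<^sub>v \<rho>" unfolding v(2) using assoc_mult_mat_vec[OF c(10) N v(1)] D1N zero_mat_mult_vec[OF v(1)] by simp
    finally show False using u by simp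
  qed
  then obtain Y' N' where Y': "Y' \<in> carrier_mat (Suc p) n" and N': "N' \<in> carrier_mat n (Suc p)"
    and YN': "Y' * N' = 1\<^sub>m (Suc p)" and col: "\<And>j. j < p \<Longrightarrow> col N' j = col N j"
    and colp: "col N' p = Q1 *\<^sub>v u - N *\<^sub>v (Y *\<^sub>v (Q1 *\<^sub>v u))"
    using left_inverse_extend[OF Y N YN y] by metis
  have "E \<mu> * N' = 0\<^sub>m n (Suc p)"
  proof (rule mat_col_eqI)
    fix j assume "j < dim_col (0\<^sub>m n (Suc p) :: complex mat)"
    hence j: "j < Suc p" by simp
    have "E \<mu> *\<^sub>v col N' j = 0\<^sub>v n"
    proof (cases "j < p")
      case True
      thus ?thesis using col_mult2[OF E_carrier N True, of \<mu>] EN col[OF True] by simp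
    next
      case False
      hence "j = p" using j by simp
      have w: "Y *\<^sub>v (Q1 *\<^sub>v u) \<in> carrier_vec p" using Y y by auto
      have "E \<mu> *\<^sub>v (N *\<^sub>v (Y *\<^sub>v (Q1 *\<^sub>v u))) = 0\<^sub>v n"
        using assoc_mult_mat_vec[OF E_carrier N w, of \<mu>] EN zero_mat_mult_vec[OF w] by simp
      thus ?thesis unfolding \<open>j = p\<close> colp using Ey y N w
        by (subst mult_minus_distrib_mat_vec[OF E_carrier]) auto
    qed
    thus "col (E \<mu> * N') j = col (0\<^sub>m n (Suc p)) j" unfolding col_mult2[OF E_carrier N' j] using j by simp
  qed (use E_carrier[of \<mu>] N' in auto)
  from nullity_bound[OF E_carrier N' Y' YN' this] have "mrank (E \<mu>) < n - p" by simp
  thus ?thesis unfolding eigenvalues_def nrank_blocks by simp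
qed

text \<open>The component of \<open>x\<close> along \<open>Q3\<close> is zero because
  \<open>T \<mu>\<close> is injective, so the correction by \<open>W3\<close> has no effect on
  \<open>x\<close> and the regular component vanishes too. What remains is \<open>Q2\<close> applied
  to a null vector of \<open>S \<mu>\<close>, which continues to nearby points.\<close>

lemma regular_part_kernel:
  assumes x: "x \<in> mat_kernel (E \<mu>)" and W3: "W3 \<in> carrier_mat \<rho> b" and "(D1 + W3 * D3) *\<^sub>v x = 0\<^sub>v \<rho>"
  shows "x \<in> germ_kernel n (E \<mu>) (pencil_dir A B \<mu>)"
proof -
  note c = block_carriers
  have x: "x \<in> carrier_vec n" "E \<mu> *\<^sub>v x = 0\<^sub>v n" using x by (auto simp: mat_kernel[OF E_carrier])
  have Dx: "D1 *\<^sub>v x \<in> carrier_vec \<rho>" "D2 *\<^sub>v x \<in> carrier_vec (a + p)" "D3 *\<^sub>v x \<in> carrier_vec b" using c x by auto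
  have T0: "T \<mu> *\<^sub>v (D3 *\<^sub>v x) = 0\<^sub>v (b + q)"
    using assoc_mult_mat_vec[OF T_carrier c(12) x(1), of \<mu>] assoc_mult_mat_vec[OF c(9) E_carrier x(1), of \<mu>]
      E_blocks(5)[of \<mu>] x(2) mult_mat_zero_vec[OF c(9)] by simp
  have S0: "S \<mu> *\<^sub>v (D2 *\<^sub>v x) = 0\<^sub>v a"
    using assoc_mult_mat_vec[OF S_carrier c(11) x(1), of \<mu>] assoc_mult_mat_vec[OF c(8) E_carrier x(1), of \<mu>]
      E_blocks(4)[of \<mu>] x(2) mult_mat_zero_vec[OF c(8)] by simp
  obtain G where G: "G \<in> carrier_mat b (b + q)" "G * T \<mu> = 1\<^sub>m b" using T_full by blast
  have D3x: "D3 *\<^sub>v x = 0\<^sub>v b" by (rule left_inverse_mult_zero[OF G(1) T_carrier G(2) Dx(3) T0])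
  have "(D1 + W3 * D3) *\<^sub>v x = D1 *\<^sub>v x + (W3 * D3) *\<^sub>v x"
    using c W3 x by (intro add_mult_distrib_mat_vec) auto
  also have "(W3 * D3) *\<^sub>v x = 0\<^sub>v \<rho>" using assoc_mult_mat_vec[OF W3 c(12) x(1)] D3x mult_mat_zero_vec[OF W3] by simp
  finally have D1x: "D1 *\<^sub>v x = 0\<^sub>v \<rho>" using assms(3) Dx by simp
  have "x = (Q1 * D1 + Q2 * D2 + Q3 * D3) *\<^sub>v x" unfolding QD_sum using x by simp
  also have "\<dots> = Q1 *\<^sub>v (D1 *\<^sub>v x) + Q2 *\<^sub>v (D2 *\<^sub>v x) + Q3 *\<^sub>v (D3 *\<^sub>v x)"
    using c x by (simp add: add_mult_distrib_mat_vec[of _ n n] assoc_mult_mat_vec[of _ n \<rho> _ n]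
        assoc_mult_mat_vec[of _ n "a + p" _ n] assoc_mult_mat_vec[of _ n b _ n])
  also have "\<dots> = Q2 *\<^sub>v (D2 *\<^sub>v x)" unfolding D1x D3x mult_mat_zero_vec[OF c(1)] mult_mat_zero_vec[OF c(3)]
    using c Dx by simp
  finally have xQ: "x = Q2 *\<^sub>v (D2 *\<^sub>v x)" .
  obtain H where H: "H \<in> carrier_mat (a + p) a" "S \<mu> * H = 1\<^sub>m a" using S_full by blast
  have "Q2 *\<^sub>v (D2 *\<^sub>v x) \<in> germ_kernel n (E \<mu>) (pencil_dir A B \<mu>)"
    by (rule full_row_rank_germ_kernel[OF S_carrier pencil_dir_carrier[OF SA SB] H Dx(2) S0
          E_carrier pencil_dir_carrier[OF A B] c(2,5) E_blocks(2)
          pencil_dir_mult_right[OF A B SA SB c(2,5) A_blocks(2) B_blocks(2)]])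
  thus ?thesis unfolding xQ[symmetric] .
qed

lemma transpose_mult_eq:
  fixes X Y Z V :: "complex mat"
  assumes "X \<in> carrier_mat r s" "Y \<in> carrier_mat s t" "Z \<in> carrier_mat r u" "V \<in> carrier_mat u t" "X * Y = Z * V"
  shows "transpose_mat Y * transpose_mat X = transpose_mat V * transpose_mat Z"
proof -
  have "transpose_mat Y * transpose_mat X = transpose_mat (X * Y)" by (rule transpose_mult[OF assms(1,2), symmetric])
  also have "\<dots> = transpose_mat V * transpose_mat Z" unfolding assms(5) by (rule transpose_mult[OF assms(3,4)])
  finally show ?thesis .
qed

lemma mult_add_mult_eq:
  fixes L M N X :: "complex mat"
  assumes "L \<in> carrier_mat r n" "M \<in> carrier_mat n s" "N \<in> carrier_mat n t" "X \<in> carrier_mat t s"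
    "L * N = 0\<^sub>m r t"
  shows "L * (M + N * X) = L * M"
proof -
  have "N * X \<in> carrier_mat n s" by (rule mult_carrier_mat[OF assms(3,4)])
  hence "L * (M + N * X) = L * M + L * (N * X)" by (rule mult_add_distrib_mat[OF assms(1,2)])
  also have "L * (N * X) = (L * N) * X" by (rule assoc_mult_mat[OF assms(1,3,4), symmetric])
  also have "\<dots> = 0\<^sub>m r s" unfolding assms(5) by (rule left_mult_zero_mat[OF assms(4)])
  also have "L * M + 0\<^sub>m r s = L * M" using mult_carrier_mat[OF assms(1,2)] by (rule right_add_zero_mat)
  finally show ?thesis .
qed

text \<open>The left correction is obtained from \<open>deflating_right\<close> for the transposed
  pencil, with \<open>T\<close> in the role of \<open>S\<close>. The point \<open>z0\<close> serves
  to hand regularity down from the perturbed pencil to the complement of \<open>R\<close>.\<close>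

lemma regular_part_preserved:
  fixes U W DA DB :: "complex mat"
  assumes U: "U \<in> carrier_mat n p" and W: "W \<in> carrier_mat p n"
    and DA: "DA \<in> carrier_mat p p" and DB: "DB \<in> carrier_mat p p" and \<tau>: "\<tau> \<noteq> 0"
    and nonsing: "\<And>\<mu>. \<mu> \<in> eigenvalues A B \<Longrightarrow> det (pencil_at DA DB \<mu>) \<noteq> 0"
    and goodR: "\<And>\<mu>. \<mu> \<in> eigenvalues A B \<Longrightarrow> good_right n p A B \<mu> W"
    and goodL: "\<And>\<mu>. \<mu> \<in> eigenvalues A B \<Longrightarrow> good_right n p (transpose_mat A) (transpose_mat B) \<mu> (transpose_mat U)"
    and At_def: "At = A + \<tau> \<cdot>\<^sub>m (U * DA * W)" and Bt_def: "Bt = B + \<tau> \<cdot>\<^sub>m (U * DB * W)"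
    and regular: "det (pencil At Bt z0) \<noteq> 0"
  shows "\<exists>P Q RA' RB'. P \<in> carrier_mat n n \<and> invertible_mat P \<and> Q \<in> carrier_mat n n \<and> invertible_mat Q \<and>
    (\<forall>z. P * pencil At Bt z * Q = diag_block_mat [pencil RA RB z, pencil RA' RB' z]) \<and>
    regular_pencil RA' RB' \<and> eigenvalues RA' RB' \<inter> eigenvalues RA RB = {}"
proof -
  note c = block_carriers
  have At: "At \<in> carrier_mat n n" and Bt: "Bt \<in> carrier_mat n n"
    unfolding At_def Bt_def using A B U W DA DB by auto
  have eig: "\<mu> \<in> eigenvalues A B" if "j < \<rho>" "point_of_diag \<mu> RA RB j" for \<mu> j
    by (rule R_singular_eigenvalue[OF R_diag_singular[OF that]])
  have "\<exists>X2 Y2. X2 \<in> carrier_mat (a + p) \<rho> \<and> Y2 \<in> carrier_mat a \<rho> \<and>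
    A * (Q1 + Q2 * X2) = (C1 + C2 * Y2) * RA \<and> B * (Q1 + Q2 * X2) = (C1 + C2 * Y2) * RB \<and>
    W * (Q1 + Q2 * X2) = 0\<^sub>m p \<rho>"
  proof (rule deflating_right[OF A B SA SB RA RB c(1,4,2,5,11) block_inverses(3) A_blocks(1) B_blocks(1)
        A_blocks(2) B_blocks(2) W, of id])
    fix i j assume "i < \<rho>" "j < \<rho>" "i \<noteq> j" "RA $$ (i,j) \<noteq> 0 \<or> RB $$ (i,j) \<noteq> 0"
    thus "id i < id j" using R_upper[of j i] by (metis id_apply linorder_neqE_nat)
  next
    fix j assume j: "j < \<rho>"
    obtain \<mu> where \<mu>: "point_of_diag \<mu> RA RB j" using R_diag[OF j] by blast
    show "\<exists>\<mu>. point_of_diag \<mu> RA RB j \<and> (\<exists>G\<in>carrier_mat (a + p) a. S \<mu> * G = 1\<^sub>m a) \<and>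
      (\<forall>x\<in>germ_kernel n (E \<mu>) (pencil_dir A B \<mu>). W *\<^sub>v x = 0\<^sub>v p \<longrightarrow> x = 0\<^sub>v n)"
      using \<mu> S_full[of \<mu>] goodR[OF eig[OF j \<mu>]] unfolding good_right_def by blast
  qed blast
  then obtain X2 Y2 where X2: "X2 \<in> carrier_mat (a + p) \<rho>" and Y2: "Y2 \<in> carrier_mat a \<rho>"
    and AX: "A * (Q1 + Q2 * X2) = (C1 + C2 * Y2) * RA" "B * (Q1 + Q2 * X2) = (C1 + C2 * Y2) * RB"
    and WX: "W * (Q1 + Q2 * X2) = 0\<^sub>m p \<rho>" by blast
  define X where "X = Q1 + Q2 * X2"
  define Y where "Y = C1 + C2 * Y2"
  have X: "X \<in> carrier_mat n \<rho>" and Y: "Y \<in> carrier_mat n \<rho>" using c X2 Y2 by (auto simp: X_def Y_def)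
  have tc: "transpose_mat P1 \<in> carrier_mat n \<rho>" "transpose_mat D1 \<in> carrier_mat n \<rho>"
    "transpose_mat P3 \<in> carrier_mat n (b + p)" "transpose_mat D3 \<in> carrier_mat n b"
    "transpose_mat C3 \<in> carrier_mat (b + p) n" "transpose_mat U \<in> carrier_mat p n"
    "transpose_mat A \<in> carrier_mat n n" "transpose_mat B \<in> carrier_mat n n"
    "transpose_mat TA \<in> carrier_mat b (b + p)" "transpose_mat TB \<in> carrier_mat b (b + p)"
    "transpose_mat RA \<in> carrier_mat \<rho> \<rho>" "transpose_mat RB \<in> carrier_mat \<rho> \<rho>"
    using c U A B TA TB RA RB p_eq_q by auto
  have CP: "transpose_mat C3 * transpose_mat P3 = 1\<^sub>m (b + p)"
    using transpose_mult[OF c(9,6)] block_inverses(10) p_eq_q by simp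
  \<comment> \<open>Transposition makes the regular part lower triangular, so its columns are
    ordered backwards by \<open>\<rho> - j\<close>.\<close>
  have "\<exists>X2 Y2. X2 \<in> carrier_mat (b + p) \<rho> \<and> Y2 \<in> carrier_mat b \<rho> \<and>
    transpose_mat A * (transpose_mat P1 + transpose_mat P3 * X2) = (transpose_mat D1 + transpose_mat D3 * Y2) * transpose_mat RA \<and>
    transpose_mat B * (transpose_mat P1 + transpose_mat P3 * X2) = (transpose_mat D1 + transpose_mat D3 * Y2) * transpose_mat RB \<and>
    transpose_mat U * (transpose_mat P1 + transpose_mat P3 * X2) = 0\<^sub>m p \<rho>"
  proof (rule deflating_right[OF tc(7-12) tc(1-5) CP transpose_mult_eq[OF c(7) A RA c(10) A_blocks(3)]
      transpose_mult_eq[OF c(7) B RB c(10) B_blocks(3)] transpose_mult_eq[OF c(9) A TA c(12) A_blocks(5)]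
      transpose_mult_eq[OF c(9) B TB c(12) B_blocks(5)] tc(6), of "\<lambda>j. \<rho> - j"])
    fix i j assume ij: "i < \<rho>" "j < \<rho>" "i \<noteq> j" "transpose_mat RA $$ (i,j) \<noteq> 0 \<or> transpose_mat RB $$ (i,j) \<noteq> 0"
    hence "RA $$ (j,i) \<noteq> 0 \<or> RB $$ (j,i) \<noteq> 0" using RA RB by auto
    hence "j < i" using R_upper[of i j] ij by (metis linorder_neqE_nat)
    thus "\<rho> - i < \<rho> - j" using ij by simp
  next
    fix j assume j: "j < \<rho>"
    obtain \<mu> where \<mu>: "point_of_diag \<mu> RA RB j" using R_diag[OF j] by blast
    have 1: "point_of_diag \<mu> (transpose_mat RA) (transpose_mat RB) j"
      using \<mu> j RA RB by (cases \<mu>) (auto simp: point_of_diag_def)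
    obtain G where G: "G \<in> carrier_mat b (b + q)" "G * T \<mu> = 1\<^sub>m b" using T_full by blast
    have "pencil_at (transpose_mat TA) (transpose_mat TB) \<mu> * transpose_mat G = 1\<^sub>m b"
      unfolding pencil_at_transpose[OF TA TB] using transpose_mult[OF G(1) T_carrier, of \<mu>] G(2) by simp
    moreover have "transpose_mat G \<in> carrier_mat (b + p) b" using G p_eq_q by simp
    ultimately show "\<exists>\<mu>. point_of_diag \<mu> (transpose_mat RA) (transpose_mat RB) j \<and>
      (\<exists>G\<in>carrier_mat (b + p) b. pencil_at (transpose_mat TA) (transpose_mat TB) \<mu> * G = 1\<^sub>m b) \<and>
      (\<forall>x\<in>germ_kernel n (pencil_at (transpose_mat A) (transpose_mat B) \<mu>) (pencil_dir (transpose_mat A) (transpose_mat B) \<mu>).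
        transpose_mat U *\<^sub>v x = 0\<^sub>v p \<longrightarrow> x = 0\<^sub>v n)"
      using 1 goodL[OF eig[OF j \<mu>]] unfolding good_right_def by blast
  qed blast
  then obtain Z3 W3 where Z3: "Z3 \<in> carrier_mat (b + p) \<rho>" and W3: "W3 \<in> carrier_mat b \<rho>"
    and AZ: "transpose_mat A * (transpose_mat P1 + transpose_mat P3 * Z3) = (transpose_mat D1 + transpose_mat D3 * W3) * transpose_mat RA"
      "transpose_mat B * (transpose_mat P1 + transpose_mat P3 * Z3) = (transpose_mat D1 + transpose_mat D3 * W3) * transpose_mat RB"
    and UZ: "transpose_mat U * (transpose_mat P1 + transpose_mat P3 * Z3) = 0\<^sub>m p \<rho>" by blast
  define Z where "Z = P1 + transpose_mat Z3 * P3"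
  define V where "V = D1 + transpose_mat W3 * D3"
  have Z3': "transpose_mat Z3 \<in> carrier_mat \<rho> (b + q)" and W3': "transpose_mat W3 \<in> carrier_mat \<rho> b"
    using Z3 W3 p_eq_q by auto
  have Z: "Z \<in> carrier_mat \<rho> n" and V: "V \<in> carrier_mat \<rho> n" using c Z3' W3' by (auto simp: Z_def V_def)
  have ZT: "transpose_mat Z = transpose_mat P1 + transpose_mat P3 * Z3"
    unfolding Z_def using c Z3' transpose_mult[OF Z3' c(9)] by (subst transpose_add) auto
  have VT: "transpose_mat V = transpose_mat D1 + transpose_mat D3 * W3"
    unfolding V_def using c W3' transpose_mult[OF W3' c(12)] by (subst transpose_add) auto
  have ZM: "Z * M = RM * V" if "M \<in> carrier_mat n n" "RM \<in> carrier_mat \<rho> \<rho>"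
    "transpose_mat M * transpose_mat Z = transpose_mat V * transpose_mat RM" for M RM
  proof -
    have "transpose_mat (Z * M) = transpose_mat (RM * V)"
      using transpose_mult[OF Z that(1)] transpose_mult[OF that(2) V] that(3) by simp
    thus ?thesis by (metis transpose_transpose)
  qed
  have ZA: "Z * A = RA * V" "Z * B = RB * V"
    using AZ ZM[OF A RA] ZM[OF B RB] unfolding ZT VT by auto
  have ZU: "Z * U = 0\<^sub>m \<rho> p"
    using transpose_mult[OF Z U] UZ unfolding ZT by (metis transpose_transpose transpose_carrier_mat zero_transpose_mat)
  \<comment> \<open>The right correction runs along \<open>C2\<close> and the left one along
    \<open>P3\<close>. Since \<open>P1 * C2\<close>, \<open>P3 * C1\<close> and
    \<open>P3 * C2\<close> are zero, the normalisation \<open>P1 * C1 = 1\<close> is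
    unaffected.\<close>
  have ZY: "Z * Y = 1\<^sub>m \<rho>"
  proof -
    have P1Y: "P1 * Y = 1\<^sub>m \<rho>" and P3Y: "P3 * Y = 0\<^sub>m (b + q) \<rho>"
      unfolding Y_def mult_add_mult_eq[OF c(7,4,5) Y2 block_inverses(7)] mult_add_mult_eq[OF c(9,4,5) Y2 block_inverses(9)]
      by (rule block_inverses)+
    have "Z * Y = P1 * Y + (transpose_mat Z3 * P3) * Y"
      unfolding Z_def using c Z3' Y by (intro add_mult_distrib_mat) auto
    also have "(transpose_mat Z3 * P3) * Y = 0\<^sub>m \<rho> \<rho>" unfolding assoc_mult_mat[OF Z3' c(9) Y] P3Y using Z3' by simp
    finally show ?thesis unfolding P1Y by simp
  qed
  have VX: "V * X = 1\<^sub>m \<rho>"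
  proof -
    have D1X: "D1 * X = 1\<^sub>m \<rho>" and D3X: "D3 * X = 0\<^sub>m b \<rho>"
      unfolding X_def mult_add_mult_eq[OF c(10,1,2) X2 block_inverses(2)] mult_add_mult_eq[OF c(12,1,2) X2 block_inverses(5)]
      by (rule block_inverses)+
    have "V * X = D1 * X + (transpose_mat W3 * D3) * X"
      unfolding V_def using c W3' X by (intro add_mult_distrib_mat) auto
    also have "(transpose_mat W3 * D3) * X = 0\<^sub>m \<rho> \<rho>" unfolding assoc_mult_mat[OF W3' c(12) X] D3X using W3' by simp
    finally show ?thesis unfolding D1X by simp
  qed
  have WX: "W * X = 0\<^sub>m p \<rho>" using WX by (simp add: X_def)
  have AtX: "At * X = Y * RA" "Bt * X = Y * RB"
    unfolding At_def Bt_def perturbation_mult_right[OF A U DA W X WX] perturbation_mult_right[OF B U DB W X WX]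
    using AX by (auto simp: X_def Y_def)
  have ZAt: "Z * At = RA * V" "Z * Bt = RB * V"
    unfolding At_def Bt_def perturbation_mult_left[OF A U DA W Z ZU] perturbation_mult_left[OF B U DB W Z ZU]
    using ZA by auto
  obtain P' Q' RA' RB' where P': "P' \<in> carrier_mat n n" "invertible_mat P'" and Q': "Q' \<in> carrier_mat n n" "invertible_mat Q'"
    and R': "RA' \<in> carrier_mat (n - \<rho>) (n - \<rho>)" "RB' \<in> carrier_mat (n - \<rho>) (n - \<rho>)"
    and split: "\<forall>z. P' * pencil At Bt z * Q' = diag_block_mat [pencil RA RB z, pencil RA' RB' z]"
    and ker: "\<forall>\<mu> g. g \<in> carrier_vec (n - \<rho>) \<longrightarrow> g \<noteq> 0\<^sub>v (n - \<rho>) \<longrightarrow> pencil_at RA' RB' \<mu> *\<^sub>v g = 0\<^sub>v (n - \<rho>) \<longrightarrow>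
       (\<exists>x\<in>mat_kernel (pencil_at At Bt \<mu>). x \<noteq> 0\<^sub>v n \<and> V *\<^sub>v x = 0\<^sub>v \<rho>)"
    using decouple[OF At Bt RA RB X Y Z V AtX ZAt ZY VX] by (elim exE conjE) (rule that)
  have ker': "\<exists>x\<in>mat_kernel (pencil_at At Bt \<mu>). x \<noteq> 0\<^sub>v n \<and> V *\<^sub>v x = 0\<^sub>v \<rho>"
    if det0: "det (pencil_at RA' RB' \<mu>) = 0" for \<mu>
  proof -
    obtain g where "g \<in> carrier_vec (n - \<rho>)" "g \<noteq> 0\<^sub>v (n - \<rho>)" "pencil_at RA' RB' \<mu> *\<^sub>v g = 0\<^sub>v (n - \<rho>)"
      using det0 det_0_iff_vec_prod_zero_field[OF pencil_at_carrier[OF R', of \<mu>]] by blast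
    thus ?thesis using ker[rule_format, of g \<mu>] by simp
  qed
  have Ec: "pencil_at At Bt \<mu> \<in> carrier_mat n n" for \<mu> by (rule pencil_at_carrier[OF At Bt])
  \<comment> \<open>A null vector of the complement at \<open>z0\<close> would lift to a null vector
    of the perturbed pencil there.\<close>
  have "det (pencil RA' RB' z0) \<noteq> 0"
  proof
    assume "det (pencil RA' RB' z0) = 0"
    then obtain x where "x \<in> mat_kernel (pencil_at At Bt (Fin z0))" "x \<noteq> 0\<^sub>v n" using ker'[of "Fin z0"] by auto
    hence "x \<in> carrier_vec n" "x \<noteq> 0\<^sub>v n" "pencil At Bt z0 *\<^sub>v x = 0\<^sub>v n"
      using mat_kernelD[OF Ec[of "Fin z0"]] by auto
    thus False using regular det_0_iff_vec_prod_zero_field[OF Ec[of "Fin z0"]] by auto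
  qed
  hence reg: "regular_pencil RA' RB'" using R' unfolding regular_pencil_def square_pencil_def by blast
  have "eigenvalues RA' RB' \<inter> eigenvalues RA RB = {}"
  proof (rule ccontr)
    assume "\<not> ?thesis"
    then obtain \<mu> where \<mu>: "\<mu> \<in> eigenvalues RA' RB'" "\<mu> \<in> eigenvalues RA RB" by blast
    \<comment> \<open>The normal rank is at most the size of the matrices, so an eigenvalue of
      either square pencil makes its determinant vanish.\<close>
    have "mrank (R \<mu>) < \<rho>" using \<mu>(2) nrank_attained(3)[OF RA RB] by (simp add: eigenvalues_def)
    hence "det (R \<mu>) = 0" using mrank_det[OF R_carrier, of \<mu>] by auto
    hence eig: "\<mu> \<in> eigenvalues A B" by (rule R_singular_eigenvalue)
    have "mrank (pencil_at RA' RB' \<mu>) < n - \<rho>" using \<mu>(1) nrank_attained(3)[OF R'] by (simp add: eigenvalues_def)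
    hence "det (pencil_at RA' RB' \<mu>) = 0" using mrank_det[OF pencil_at_carrier[OF R'], of \<mu>] by auto
    then obtain x where x: "x \<in> mat_kernel (pencil_at At Bt \<mu>)" "x \<noteq> 0\<^sub>v n" "V *\<^sub>v x = 0\<^sub>v \<rho>" using ker' by blast
    have "mat_kernel (pencil_at At Bt \<mu>) = {x \<in> mat_kernel (E \<mu>). W *\<^sub>v x = 0\<^sub>v p}"
      unfolding At_def Bt_def pencil_at_perturbed[OF A B U DA DB W]
      by (rule good_right_perturbed_kernel[OF A B U pencil_at_carrier[OF DA DB] W nonsing[OF eig] \<tau> goodL[OF eig]])
    hence "x \<in> mat_kernel (E \<mu>)" "W *\<^sub>v x = 0\<^sub>v p" using x by auto
    moreover have "x \<in> germ_kernel n (E \<mu>) (pencil_dir A B \<mu>)"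
      by (rule regular_part_kernel[OF calculation(1) W3' x(3)[unfolded V_def]])
    ultimately show False using goodR[OF eig] x(2) unfolding good_right_def by blast
  qed
  thus ?thesis
    by (intro exI[of _ P'] exI[of _ Q'] exI[of _ RA'] exI[of _ RB'] conjI P' Q' split reg)
qed

end

section \<open>From the Kronecker canonical form to its blocks\<close>

text \<open>The coefficient of \<open>- z\<close> in \<open>L_block j z\<close>, which is also the
  value of the block at infinity.\<close>

definition L_inf :: "nat \<Rightarrow> complex mat" where
  "L_inf j = mat j (j + 1) (\<lambda>(r,c). if c = r then 1 else 0)"

lemma L_block_carrier: "L_block j z \<in> carrier_mat j (Suc j)" and L_inf_carrier: "L_inf j \<in> carrier_mat j (Suc j)"
  by (auto simp: L_block_def L_inf_def)

lemma L_block_pencil: "L_block j z = pencil (L_block j 0) (L_inf j) z"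
  by (intro eq_matI) (auto simp: L_block_def L_inf_def pencil_def)

lemma L_block_right_inverse: "\<exists>G\<in>carrier_mat (Suc j) j. L_block j z * G = 1\<^sub>m j"
proof
  \<comment> \<open>Column \<open>r\<close> solves the recurrence
    \<open>g (i + 1) - z * g i = (if i = r then 1 else 0)\<close> with
    \<open>g 0 = 0\<close>.\<close>
  define G where "G = mat (Suc j) j (\<lambda>(c,r). if r < c then z ^ (c - 1 - r) else 0)"
  show G: "G \<in> carrier_mat (Suc j) j" by (simp add: G_def)
  show "L_block j z * G = 1\<^sub>m j"
  proof (rule eq_matI)
    fix i r assume "i < dim_row (1\<^sub>m j :: complex mat)" "r < dim_col (1\<^sub>m j :: complex mat)"
    hence ir: "i < j" "r < j" by auto
    have "(L_block j z * G) $$ (i,r) = (\<Sum>c\<in>{0..<Suc j}. (if c = i + 1 then 1 else if c = i then - z else 0) * G $$ (c,r))"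
      using ir G by (simp add: scalar_prod_def L_block_def del: sum.op_ivl_Suc)
    also have "\<dots> = (\<Sum>c\<in>{0..<Suc j}. (if c = i + 1 then G $$ (c,r) else 0) + (if c = i then - z * G $$ (c,r) else 0))"
      by (intro sum.cong) auto
    also have "\<dots> = G $$ (i + 1, r) - z * G $$ (i, r)"
      unfolding sum.distrib using ir by simp
    also have "\<dots> = 1\<^sub>m j $$ (i,r)"
    proof (cases r i rule: linorder_cases)
      case less
      have "z ^ (i - r) = z * z ^ (i - 1 - r)" using less
        by (metis Suc_diff_Suc diff_Suc_eq_diff_pred power_Suc)
      thus ?thesis using ir less by (simp add: G_def)
    qed (use ir in \<open>auto simp: G_def\<close>)
    finally show "(L_block j z * G) $$ (i,r) = 1\<^sub>m j $$ (i,r)" .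
  qed (use G in \<open>auto simp: L_block_def\<close>)
qed

lemma L_inf_right_inverse: "\<exists>G\<in>carrier_mat (Suc j) j. L_inf j * G = 1\<^sub>m j"
proof
  show "L_inf j * transpose_mat (L_inf j) = 1\<^sub>m j"
  proof (rule eq_matI)
    fix i r assume "i < dim_row (1\<^sub>m j :: complex mat)" "r < dim_col (1\<^sub>m j :: complex mat)"
    hence ir: "i < j" "r < j" by auto
    have "(L_inf j * transpose_mat (L_inf j)) $$ (i,r) =
      (\<Sum>c\<in>{0..<Suc j}. (if c = i then 1 else 0) * (if c = r then 1 else 0))"
      using ir by (simp add: scalar_prod_def L_inf_def del: sum.op_ivl_Suc)
    also have "\<dots> = (\<Sum>c\<in>{0..<Suc j}. if c = i then (if i = r then 1 else 0) else 0)"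
      by (intro sum.cong) auto
    also have "\<dots> = 1\<^sub>m j $$ (i,r)" using ir by simp
    finally show "(L_inf j * transpose_mat (L_inf j)) $$ (i,r) = 1\<^sub>m j $$ (i,r)" .
  qed (auto simp: L_inf_def)
qed (auto simp: L_inf_def)

lemma diag_block_mat_Cons:
  "diag_block_mat (M # Ms) = four_block_mat M (0\<^sub>m (dim_row M) (dim_col (diag_block_mat Ms)))
     (0\<^sub>m (dim_row (diag_block_mat Ms)) (dim_col M)) (diag_block_mat Ms)"
  by (simp add: Let_def)

lemma diag_block_mat_map_carrier:
  assumes "\<And>m. f m \<in> carrier_mat m (Suc m)"
  shows "diag_block_mat (map f ms) \<in> carrier_mat (sum_list ms) (sum_list ms + length ms)"
proof -
  have "dim_row (f m) = m" "dim_col (f m) = Suc m" for m using assms[of m] by auto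
  hence "map (dim_row \<circ> f) ms = ms" "sum_list (map (dim_col \<circ> f) ms) = sum_list ms + length ms"
    by (induction ms) auto
  thus ?thesis by (intro carrier_matI) (auto simp: dim_diag_block_mat)
qed

lemma diag_block_mat_pencil:
  assumes f: "\<And>m. f m \<in> carrier_mat m (Suc m)" and g: "\<And>m. g m \<in> carrier_mat m (Suc m)"
  shows "diag_block_mat (map (\<lambda>m. pencil (f m) (g m) z) ms) = pencil (diag_block_mat (map f ms)) (diag_block_mat (map g ms)) z"
proof (induction ms)
  case (Cons m ms)
  have d: "dim_row (f m) = m" "dim_row (g m) = m" "dim_col (f m) = Suc m" "dim_col (g m) = Suc m"
    using f[of m] g[of m] by auto
  have D: "diag_block_mat (map f ms) \<in> carrier_mat (sum_list ms) (sum_list ms + length ms)"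
    "diag_block_mat (map g ms) \<in> carrier_mat (sum_list ms) (sum_list ms + length ms)"
    by (rule diag_block_mat_map_carrier[OF f], rule diag_block_mat_map_carrier[OF g])
  have "pencil (diag_block_mat (map f ms)) (diag_block_mat (map g ms)) z \<in> carrier_mat (sum_list ms) (sum_list ms + length ms)"
    by (rule pencil_carrier[OF D])
  thus ?case using D d unfolding list.map diag_block_mat_Cons Cons.IH
    by (auto simp: pencil_def intro!: eq_matI)
qed (auto simp: pencil_def intro!: eq_matI)

lemma diag_block_mat_right_inverse:
  fixes f :: "nat \<Rightarrow> complex mat"
  assumes f: "\<And>m. f m \<in> carrier_mat m (Suc m)" and inv: "\<And>m. \<exists>G\<in>carrier_mat (Suc m) m. f m * G = 1\<^sub>m m"
  shows "\<exists>G\<in>carrier_mat (sum_list ms + length ms) (sum_list ms). diag_block_mat (map f ms) * G = 1\<^sub>m (sum_list ms)"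
proof (induction ms)
  case Nil
  show ?case by (intro bexI[of _ "0\<^sub>m 0 0"]) auto
next
  case (Cons m ms)
  let ?s = "sum_list ms" and ?c = "sum_list ms + length ms"
  obtain H where H: "H \<in> carrier_mat ?c ?s" "diag_block_mat (map f ms) * H = 1\<^sub>m ?s" using Cons.IH by blast
  obtain G where G: "G \<in> carrier_mat (Suc m) m" "f m * G = 1\<^sub>m m" using inv by blast
  have D: "diag_block_mat (map f ms) \<in> carrier_mat ?s ?c" by (rule diag_block_mat_map_carrier[OF f])
  have fm: "dim_row (f m) = m" "dim_col (f m) = Suc m" using f[of m] by auto
  have "four_block_mat (f m) (0\<^sub>m m ?c) (0\<^sub>m ?s (Suc m)) (diag_block_mat (map f ms)) *
    four_block_mat G (0\<^sub>m (Suc m) ?s) (0\<^sub>m ?c m) H =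
    four_block_mat (f m * G + 0\<^sub>m m ?c * 0\<^sub>m ?c m) (f m * 0\<^sub>m (Suc m) ?s + 0\<^sub>m m ?c * H)
      (0\<^sub>m ?s (Suc m) * G + diag_block_mat (map f ms) * 0\<^sub>m ?c m) (0\<^sub>m ?s (Suc m) * 0\<^sub>m (Suc m) ?s + diag_block_mat (map f ms) * H)"
    using D H G f[of m] by (intro mult_four_block_mat) auto
  also have "\<dots> = 1\<^sub>m (m + ?s)" unfolding G H(2) using D H G f[of m] by (simp add: four_block_one_mat)
  finally have "diag_block_mat (map f (m # ms)) * four_block_mat G (0\<^sub>m (Suc m) ?s) (0\<^sub>m ?c m) H = 1\<^sub>m (sum_list (m # ms))"
    using D fm unfolding list.map diag_block_mat_Cons by simp
  moreover have "four_block_mat G (0\<^sub>m (Suc m) ?s) (0\<^sub>m ?c m) H \<in>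
      carrier_mat (sum_list (m # ms) + length (m # ms)) (sum_list (m # ms))" using G H by auto
  ultimately show ?case by blast
qed

lemma L_blocks_pencil:
  "diag_block_mat (map (\<lambda>m. L_block m z) ms) =
    pencil (diag_block_mat (map (\<lambda>m. L_block m 0) ms)) (diag_block_mat (map L_inf ms)) z"
  unfolding diag_block_mat_pencil[of "\<lambda>m. L_block m 0" L_inf, OF L_block_carrier L_inf_carrier, symmetric]
  by (simp only: L_block_pencil[symmetric])

lemma L_blocks_full_rank:
  "\<exists>G\<in>carrier_mat (sum_list ms + length ms) (sum_list ms).
    pencil_at (diag_block_mat (map (\<lambda>m. L_block m 0) ms)) (diag_block_mat (map L_inf ms)) \<mu> * G = 1\<^sub>m (sum_list ms)"
proof (cases \<mu>)
  case (Fin z)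
  have "diag_block_mat (map (\<lambda>m. L_block m z) ms) = pencil (diag_block_mat (map (\<lambda>m. L_block m 0) ms)) (diag_block_mat (map L_inf ms)) z"
    by (rule L_blocks_pencil)
  thus ?thesis using diag_block_mat_right_inverse[of "\<lambda>m. L_block m z", OF L_block_carrier L_block_right_inverse, of ms] Fin by simp
next
  case Infty
  thus ?thesis using diag_block_mat_right_inverse[of L_inf, OF L_inf_carrier L_inf_right_inverse, of ms] by simp
qed

lemma transpose_diag_block_mat:
  "transpose_mat (diag_block_mat Ms) = diag_block_mat (map transpose_mat Ms)"
proof (induction Ms)
  case (Cons M Ms)
  show ?case unfolding list.map diag_block_mat_Cons Cons.IH[symmetric]
    by (subst transpose_four_block_mat[of _ "dim_row M" "dim_col M" _ "dim_col (diag_block_mat Ms)" _ "dim_row (diag_block_mat Ms)"]) auto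
qed auto

lemma invertible_mat_inverse:
  fixes M :: "'a :: field mat"
  assumes "M \<in> carrier_mat n n" "invertible_mat M"
  obtains N where "N \<in> carrier_mat n n" "N * M = 1\<^sub>m n"
proof -
  obtain N where N: "M * N = 1\<^sub>m (dim_row M)" "N * M = 1\<^sub>m (dim_row N)"
    using assms(2) unfolding invertible_mat_def inverts_mat_def by blast
  have "dim_col N = n" using arg_cong[OF N(1), of dim_col] assms(1) by simp
  moreover have "dim_row N = n" using arg_cong[OF N(2), of dim_col] assms(1) by simp
  ultimately show thesis using that[of N] N(2) by auto
qed

text \<open>Serves to show that a nilpotent upper triangular matrix has zero diagonal: on the
  diagonal, taking powers is entrywise.\<close>

lemma upper_triangular_pow:
  fixes M :: "'a :: comm_ring_1 mat"
  assumes M: "M \<in> carrier_mat n n" and upper: "\<And>i j. j < i \<Longrightarrow> i < n \<Longrightarrow> M $$ (i,j) = 0"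
  shows "i < n \<Longrightarrow> j \<le> i \<Longrightarrow> (M ^\<^sub>m l) $$ (i,j) = (if j = i then (M $$ (i,i)) ^ l else 0)"
proof (induction l arbitrary: i j)
  case (Suc l)
  have Ml: "M ^\<^sub>m l \<in> carrier_mat n n" using M by simp
  have "(M ^\<^sub>m Suc l) $$ (i,j) = (\<Sum>s\<in>{0..<n}. (M ^\<^sub>m l) $$ (i,s) * M $$ (s,j))"
    using Suc.prems M Ml by (simp add: scalar_prod_def)
  also have "\<dots> = (\<Sum>s\<in>{0..<n}. if s = i then (if j = i then (M $$ (i,i)) ^ Suc l else 0) else 0)"
  proof (intro sum.cong refl)
    fix s assume s: "s \<in> {0..<n}"
    show "(M ^\<^sub>m l) $$ (i,s) * M $$ (s,j) = (if s = i then (if j = i then (M $$ (i,i)) ^ Suc l else 0) else 0)"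
    proof (cases s i rule: linorder_cases)
      case less
      thus ?thesis using Suc.IH[of i s] Suc.prems by simp
    next
      case equal
      thus ?thesis using Suc.IH[of i i] Suc.prems upper[of j i] by (auto simp: mult.commute)
    next
      case greater
      thus ?thesis using upper[of j s] Suc.prems s by simp
    qed
  qed
  also have "\<dots> = (if j = i then (M $$ (i,i)) ^ Suc l else 0)" using Suc.prems by simp
  finally show ?case .
qed (use M in auto)

lemma is_jordan_matrix_upper:
  assumes "is_jordan_matrix J"
  shows "J \<in> carrier_mat (dim_row J) (dim_row J)" "j < i \<Longrightarrow> i < dim_row J \<Longrightarrow> J $$ (i,j) = 0"
proof -
  obtain n_as where J: "J = jordan_matrix n_as" using assms unfolding is_jordan_matrix_def by blast
  show "J \<in> carrier_mat (dim_row J) (dim_row J)" unfolding J by (metis jordan_matrix_carrier carrier_matD(1))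
  show "j < i \<Longrightarrow> i < dim_row J \<Longrightarrow> J $$ (i,j) = 0" unfolding J
    using jordan_matrix_upper_triangular[of i n_as j] by simp
qed

lemma blocks3_eq: "diag_block_mat [R, diag_block_mat [S, T]] = blocks3 R S T"
  by (simp only: blocks3_def diag_block_mat_pair diag_block_mat_Cons[of R "[S, T]"])

lemma blocks3_minus:
  assumes "R \<in> carrier_mat r r'" "S \<in> carrier_mat s s'" "T \<in> carrier_mat t t'"
    "R2 \<in> carrier_mat r r'" "S2 \<in> carrier_mat s s'" "T2 \<in> carrier_mat t t'"
  shows "blocks3 R S T - blocks3 R2 S2 T2 = blocks3 (R - R2) (S - S2) (T - T2)"
proof -
  have m: "R - R2 \<in> carrier_mat r r'" "S - S2 \<in> carrier_mat s s'" "T - T2 \<in> carrier_mat t t'" using assms by auto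
  show ?thesis
  proof (rule eq_matI)
    fix i j assume "i < dim_row (blocks3 (R - R2) (S - S2) (T - T2))" "j < dim_col (blocks3 (R - R2) (S - S2) (T - T2))"
    hence ij: "i < r + s + t" "j < r' + s' + t'" using blocks3_carrier[OF m] by auto
    show "(blocks3 R S T - blocks3 R2 S2 T2) $$ (i,j) = blocks3 (R - R2) (S - S2) (T - T2) $$ (i,j)"
      using ij blocks3_carrier[OF assms(1-3)] blocks3_carrier[OF assms(4-6)] assms
      by (simp add: blocks3_index[OF m] blocks3_index[OF assms(1-3)] blocks3_index[OF assms(4-6)]) auto
  qed (use blocks3_carrier[OF m] blocks3_carrier[OF assms(4-6)] in auto)
qed

text \<open>The canonical form is an identity in \<open>z\<close>, whereas the block form needs one
  identity per coefficient. \<open>A\<close> is the value of the pencil at 0 and \<open>B\<close>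
  the difference of its values at 0 and 1. The dimension equations come from comparing the sizes of
  both sides.\<close>

lemma is_regular_part_blocks:
  assumes A: "A \<in> carrier_mat n n" and B: "B \<in> carrier_mat n n" and reg: "is_regular_part A B RA RB"
  shows "\<exists>P Q Pi Qi SA SB TA TB \<rho> a b p q. kronecker_blocks A B P Q Pi Qi RA RB SA SB TA TB n \<rho> a b p q"
proof -
  obtain P Q J N ms ns where reg: "P \<in> carrier_mat (dim_row A) (dim_row A) \<and> invertible_mat P \<and>
        Q \<in> carrier_mat (dim_col A) (dim_col A) \<and> invertible_mat Q \<and>
        is_jordan_matrix J \<and> is_jordan_matrix N \<and>
        (\<exists>l. N ^\<^sub>m l = 0\<^sub>m (dim_row N) (dim_row N)) \<and>
        RA = diag_block_mat [J, 1\<^sub>m (dim_row N)] \<and>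
        RB = diag_block_mat [1\<^sub>m (dim_row J), N] \<and>
        (\<forall>z. P * pencil A B z * Q = diag_block_mat [pencil RA RB z, singular_part ms ns z])"
    using reg unfolding is_regular_part_def by (elim exE) (rule that)
  have P: "P \<in> carrier_mat n n" "invertible_mat P" and Q: "Q \<in> carrier_mat n n" "invertible_mat Q"
    using reg A by (simp_all only: carrier_matD[OF A])
  have J: "is_jordan_matrix J" using reg by (elim conjE)
  have N: "is_jordan_matrix N" using reg by (elim conjE)
  have RA: "RA = diag_block_mat [J, 1\<^sub>m (dim_row N)]" using reg by (elim conjE)
  have RB: "RB = diag_block_mat [1\<^sub>m (dim_row J), N]" using reg by (elim conjE)
  have kcf: "\<forall>z. P * pencil A B z * Q = diag_block_mat [pencil RA RB z, singular_part ms ns z]"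
    using reg by (elim conjE)
  obtain l where Nl: "N ^\<^sub>m l = 0\<^sub>m (dim_row N) (dim_row N)" using reg by (elim conjE exE) (rule that)
  obtain Pi where Pi: "Pi \<in> carrier_mat n n" "Pi * P = 1\<^sub>m n" by (rule invertible_mat_inverse[OF P])
  obtain Qi where Qi: "Qi \<in> carrier_mat n n" "Qi * Q = 1\<^sub>m n" by (rule invertible_mat_inverse[OF Q])
  define d where "d = dim_row J"
  define e where "e = dim_row N"
  have Jc: "J \<in> carrier_mat d d" and Nc: "N \<in> carrier_mat e e"
    unfolding d_def e_def by (rule is_jordan_matrix_upper(1)[OF J], rule is_jordan_matrix_upper(1)[OF N])
  have RA': "RA = four_block_mat J (0\<^sub>m d e) (0\<^sub>m e d) (1\<^sub>m e)" and RB': "RB = four_block_mat (1\<^sub>m d) (0\<^sub>m d e) (0\<^sub>m e d) N"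
    unfolding RA RB diag_block_mat_pair d_def[symmetric] e_def[symmetric] carrier_matD[OF Jc] carrier_matD[OF Nc]
    by simp_all
  have RAc: "RA \<in> carrier_mat (d + e) (d + e)" and RBc: "RB \<in> carrier_mat (d + e) (d + e)"
    unfolding RA' RB' using Jc Nc by auto
  have Jup: "J $$ (i,j) = 0" if "j < i" "i < d" for i j
    using that unfolding d_def by (rule is_jordan_matrix_upper(2)[OF J])
  have Nup: "N $$ (i,j) = 0" if "j < i" "i < e" for i j
    using that unfolding e_def by (rule is_jordan_matrix_upper(2)[OF N])
  \<comment> \<open>Nilpotency clears the diagonal of \<open>N\<close>, so that its diagonal pairs
    belong to the point infinity.\<close>
  have Nd: "N $$ (i,i) = 0" if "i < e" for i
  proof -
    have "N $$ (i,i) ^ l = (N ^\<^sub>m l) $$ (i,i)"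
      using upper_triangular_pow[OF Nc Nup that order.refl, of l] by simp
    also have "\<dots> = 0" unfolding Nl e_def[symmetric] using that by simp
    finally show ?thesis by simp
  qed
  define a where "a = sum_list ms"
  define b where "b = sum_list ns"
  define p where "p = length ms"
  define q where "q = length ns"
  define Sz where "Sz = (\<lambda>z. diag_block_mat (map (\<lambda>m. L_block m z) ms))"
  define Tz where "Tz = (\<lambda>z. diag_block_mat (map (\<lambda>m. L_block m z) ns))"
  define SB where "SB = diag_block_mat (map L_inf ms)"
  define TB where "TB = diag_block_mat (map L_inf ns)"
  have c: "Sz z \<in> carrier_mat a (a + p)" "SB \<in> carrier_mat a (a + p)"
    "Tz z \<in> carrier_mat b (b + q)" "TB \<in> carrier_mat b (b + q)" for z
    unfolding Sz_def SB_def Tz_def TB_def a_def b_def p_def q_def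
    by (rule diag_block_mat_map_carrier, rule L_block_carrier L_inf_carrier)+
  have Sp: "Sz z = pencil (Sz 0) SB z" and Tp: "Tz z = pencil (Tz 0) TB z" for z
    unfolding Sz_def SB_def Tz_def TB_def by (rule L_blocks_pencil)+
  have sing: "singular_part ms ns z = diag_block_mat [Sz z, transpose_mat (Tz z)]" for z
    unfolding singular_part_def Sz_def Tz_def transpose_diag_block_mat diag_block_mat_append diag_block_mat_pair Let_def
    by (simp add: comp_def)
  have kcf': "P * pencil A B z * Q = blocks3 (pencil RA RB z) (Sz z) (transpose_mat (Tz z))" for z
    unfolding kcf[rule_format] sing blocks3_eq ..
  have p0: "pencil X Y 0 = X" if "X \<in> carrier_mat r s" "Y \<in> carrier_mat r s" for X Y :: "complex mat" and r s
    using that by (intro eq_matI) (auto simp: pencil_def)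
  have p1: "X - pencil X Y 1 = Y" if "X \<in> carrier_mat r s" "Y \<in> carrier_mat r s" for X Y :: "complex mat" and r s
    using that by (intro eq_matI) (auto simp: pencil_def)
  have cT: "transpose_mat (Tz z) \<in> carrier_mat (b + q) b" "transpose_mat TB \<in> carrier_mat (b + q) b" for z
    using c(3)[of z] c(4) by auto
  have PAQ: "P * A * Q = blocks3 RA (Sz 0) (transpose_mat (Tz 0))"
    using kcf'[of 0] p0[OF A B] p0[OF RAc RBc] by simp
  have "P * A * Q \<in> carrier_mat n n" using P Q A by auto
  hence dims: "n = d + e + a + (b + q)" "n = d + e + (a + p) + b"
    using blocks3_carrier[OF RAc c(1) cT(1)] unfolding PAQ by (metis carrier_matD)+
  have "P * B * Q = P * A * Q - P * pencil A B 1 * Q"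
  proof -
    have "pencil A B 1 = A - B" using A B by (intro eq_matI) (auto simp: pencil_def)
    hence "P * pencil A B 1 * Q = (P * A - P * B) * Q" by (simp only: mult_minus_distrib_mat[OF P(1) A B])
    also have "\<dots> = P * A * Q - P * B * Q" using P Q A B by (intro minus_mult_distrib_mat) auto
    finally have "P * pencil A B 1 * Q = P * A * Q - P * B * Q" .
    moreover have "P * A * Q \<in> carrier_mat n n" "P * B * Q \<in> carrier_mat n n" using P Q A B by auto
    ultimately show ?thesis by (auto intro!: eq_matI)
  qed
  also have "\<dots> = blocks3 (RA - pencil RA RB 1) (Sz 0 - Sz 1) (transpose_mat (Tz 0) - transpose_mat (Tz 1))"
    unfolding PAQ kcf' by (rule blocks3_minus[OF RAc c(1) cT(1) pencil_carrier[OF RAc RBc] c(1) cT(1)])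
  also have "RA - pencil RA RB 1 = RB" by (rule p1[OF RAc RBc])
  also have "Sz 0 - Sz 1 = SB" unfolding Sp[of 1] by (rule p1[OF c(1,2)])
  also have "transpose_mat (Tz 0) - transpose_mat (Tz 1) = transpose_mat (Tz 0 - Tz 1)"
    using c(3) by (intro eq_matI) (auto simp: carrier_matD[OF c(3)])
  also have "Tz 0 - Tz 1 = TB" unfolding Tp[of 1] by (rule p1[OF c(3,4)])
  finally have PBQ: "P * B * Q = blocks3 RB SB (transpose_mat TB)" .
  have "kronecker_blocks A B P Q Pi Qi RA RB (Sz 0) SB (transpose_mat (Tz 0)) (transpose_mat TB) n (d + e) a b p q"
  proof
    show "\<exists>G\<in>carrier_mat (a + p) a. pencil_at (Sz 0) SB \<mu> * G = 1\<^sub>m a" for \<mu>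
      unfolding Sz_def SB_def a_def p_def by (rule L_blocks_full_rank)
    show "\<exists>G\<in>carrier_mat b (b + q). G * pencil_at (transpose_mat (Tz 0)) (transpose_mat TB) \<mu> = 1\<^sub>m b" for \<mu>
    proof -
      obtain G where G: "G \<in> carrier_mat (b + q) b" "pencil_at (Tz 0) TB \<mu> * G = 1\<^sub>m b"
        using L_blocks_full_rank[of ns \<mu>] unfolding Tz_def TB_def b_def q_def by blast
      have "transpose_mat G * pencil_at (transpose_mat (Tz 0)) (transpose_mat TB) \<mu> = 1\<^sub>m b"
        unfolding pencil_at_transpose[OF c(3,4)] using transpose_mult[OF pencil_at_carrier[OF c(3,4)] G(1), of 0 \<mu>] G(2) by simp
      thus ?thesis using G(1) by (intro bexI[of _ "transpose_mat G"]) auto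
    qed
    fix i j assume ij: "j < i" "i < d + e"
    show "RA $$ (i,j) = 0" unfolding RA' using ij Jup[of j i] carrier_matD[OF Jc] by auto
    show "RB $$ (i,j) = 0" unfolding RB' using ij Nup[of "j - d" "i - d"] carrier_matD[OF Nc] by auto
  next
    fix j assume j: "j < d + e"
    show "\<exists>\<mu>. point_of_diag \<mu> RA RB j"
    proof (cases "j < d")
      case True
      thus ?thesis unfolding RA' RB' using Jc Nc by (intro exI[of _ "Fin (J $$ (j,j))"]) (simp add: point_of_diag_def)
    next
      case False
      thus ?thesis unfolding RA' RB' using Jc Nc Nd[of "j - d"] j by (intro exI[of _ Infty]) (simp add: point_of_diag_def)
    qed
  qed (use A B P Q Pi Qi RAc RBc c cT dims PAQ PBQ in auto)
  thus ?thesis by blast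
qed

section \<open>The perturbed pencil\<close>

lemma mat_adjoint_mult_vec:
  assumes "M \<in> carrier_mat n m" "y \<in> carrier_vec n"
  shows "mat_adjoint M *\<^sub>v y = conjugate (transpose_mat M *\<^sub>v conjugate y)"
proof (rule eq_vecI)
  fix i assume "i < dim_vec (conjugate (transpose_mat M *\<^sub>v conjugate y))"
  hence i: "i < m" using assms by simp
  show "(mat_adjoint M *\<^sub>v y) $ i = conjugate (transpose_mat M *\<^sub>v conjugate y) $ i"
    using i assms by (simp add: mat_adjoint_def mat_of_rows_def scalar_prod_def conjugate_dist_mul sum_conjugate)
qed (use assms in \<open>auto simp: mat_adjoint_def\<close>)

text \<open>Translates from the adjoint of the statement to the transpose, which does not conjugate
  the parameter of the pencil and therefore turns pencils into pencils.\<close>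

lemma mat_adjoint_kernel:
  fixes M :: "complex mat"
  assumes M: "M \<in> carrier_mat n n"
  shows "mat_kernel (mat_adjoint M) = {y \<in> carrier_vec n. conjugate y \<in> mat_kernel (transpose_mat M)}"
proof -
  have Mt: "transpose_mat M \<in> carrier_mat n n" using M by simp
  have "mat_adjoint M *\<^sub>v y = 0\<^sub>v n \<longleftrightarrow> transpose_mat M *\<^sub>v conjugate y = 0\<^sub>v n" if y: "y \<in> carrier_vec n" for y
    unfolding mat_adjoint_mult_vec[OF M y] by (rule conjugate_zero_iff_vec)
  thus ?thesis unfolding mat_kernel[OF mat_adjoint_carrier[OF M]] mat_kernel[OF Mt] by auto
qed

text \<open>Moving \<open>V\<close> across the inner product reduces orthogonality to the equation
  \<open>V\<^sup>* x = 0\<close>.\<close>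

lemma orthogonal_column_space:
  assumes V: "V \<in> carrier_mat n k" and X: "X \<subseteq> carrier_vec n" and XV: "\<And>x. x \<in> X \<Longrightarrow> mat_adjoint V *\<^sub>v x = 0\<^sub>v k"
  shows "orthogonal_sets X (column_space V)"
  unfolding orthogonal_sets_def
proof (intro ballI)
  fix x y assume x: "x \<in> X" and "y \<in> column_space V"
  then obtain w where w: "w \<in> carrier_vec k" "y = V *\<^sub>v w"
    using V unfolding column_space_def carrier_matD(1)[OF V] vec_space.col_space_eq[OF V] by auto
  have xc: "x \<in> carrier_vec n" using x X by blast
  have 0: "transpose_mat V *\<^sub>v conjugate x = 0\<^sub>v k"
    using XV[OF x] unfolding mat_adjoint_mult_vec[OF V xc]
    by (subst (asm) conjugate_zero_iff_vec[of _ k]) (use V xc in auto)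
  have "conjugate x \<bullet> (V *\<^sub>v w) = (transpose_mat V *\<^sub>v conjugate x) \<bullet> w"
    using V w xc by (intro transpose_vec_mult_scalar[symmetric]) auto
  hence "conjugate x \<bullet> y = 0" unfolding 0 w(2) using w(1) by simp
  moreover have yc: "y \<in> carrier_vec n" using V w by auto
  ultimately show "x \<bullet>c y = 0" using conjugate_conjugate_sprod[OF xc yc] by simp
qed

lemma transpose_add_smult:
  fixes M N :: "complex mat"
  assumes "M \<in> carrier_mat n m" "N \<in> carrier_mat n m"
  shows "transpose_mat (M + c \<cdot>\<^sub>m N) = transpose_mat M + c \<cdot>\<^sub>m transpose_mat N"
  using assms by (intro eq_matI) auto

lemma good_right_generic_finite:
  assumes A: "A \<in> carrier_mat n n" and B: "B \<in> carrier_mat n n" and k: "k \<le> n"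
    and nr: "nrank A B = n - k" and fin: "finite S"
    and low: "\<forall>\<mu>\<in>S. mrank (pencil_at A B \<mu>) \<le> n - k"
  shows "\<exists>Ns. finite Ns \<and> (\<forall>N\<in>Ns. N \<in> carrier_mat n k \<and> (\<exists>X\<in>carrier_mat k n. X * N = 1\<^sub>m k)) \<and>
    (\<forall>W\<in>carrier_mat k n. (\<forall>N\<in>Ns. det (W * N) \<noteq> 0) \<longrightarrow> (\<forall>\<mu>\<in>S. good_right n k A B \<mu> W))"
  using fin low
proof (induction S rule: finite_induct)
  case empty
  show ?case by (intro exI[of _ "{}"]) auto
next
  case (insert \<mu> S)
  obtain Ms where Ms: "finite Ms" "\<forall>N\<in>Ms. N \<in> carrier_mat n k \<and> (\<exists>X\<in>carrier_mat k n. X * N = 1\<^sub>m k)"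
    "\<forall>W\<in>carrier_mat k n. (\<forall>N\<in>Ms. det (W * N) \<noteq> 0) \<longrightarrow> (\<forall>\<mu>\<in>S. good_right n k A B \<mu> W)"
    using insert by (metis insertCI)
  show ?case
  proof (rule good_right_generic[OF A B k nr bspec[OF insert.prems insertI1]])
    fix Ns :: "complex mat set"
    assume Ns: "finite Ns" "\<And>N. N \<in> Ns \<Longrightarrow> N \<in> carrier_mat n k \<and> (\<exists>X\<in>carrier_mat k n. X * N = 1\<^sub>m k)"
      "\<And>W. W \<in> carrier_mat k n \<Longrightarrow> (\<And>N. N \<in> Ns \<Longrightarrow> det (W * N) \<noteq> 0) \<Longrightarrow> good_right n k A B \<mu> W"
    show ?case
    proof (intro exI[of _ "Ms \<union> Ns"] conjI ballI impI)
      show "finite (Ms \<union> Ns)" using Ms(1) Ns(1) by simp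
    next
      fix N assume "N \<in> Ms \<union> Ns"
      thus "N \<in> carrier_mat n k" "\<exists>X\<in>carrier_mat k n. X * N = 1\<^sub>m k" using Ms(2) Ns(2) by blast+
    next
      fix W \<nu> assume "W \<in> carrier_mat k n" "\<forall>N\<in>Ms \<union> Ns. det (W * N) \<noteq> 0" "\<nu> \<in> insert \<mu> S"
      thus "good_right n k A B \<nu> W" using Ms(3) Ns(3) by blast
    qed
  qed
qed

theorem theorem4p3:
  fixes A B DA DB :: "complex mat" and n k :: nat
  assumes A: "A \<in> carrier_mat n n" and B: "B \<in> carrier_mat n n"
    and singular: "singular_pencil A B"
    and normal_rank: "k \<le> n" "nrank A B = n - k"
    and DA: "DA \<in> carrier_mat k k" "diagonal_mat DA"
    and DB: "DB \<in> carrier_mat k k" "diagonal_mat DB"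
    and D_regular: "regular_pencil DA DB"
    and D_eigenvalues: "eigenvalues DA DB \<inter> eigenvalues A B = {}"
  shows "holds_generically n k (\<lambda>U V. mrank U = k \<and> mrank V = k \<longrightarrow>
    (let At = perturb A U DA V; Bt = perturb B U DB V in
      \<comment> \<open>1\<close>
      (\<forall>RA RB. is_regular_part A B RA RB \<longrightarrow>
        (\<forall>\<tau>. \<tau> \<noteq> 0 \<longrightarrow>
          (\<exists>P Q RnewA RnewB.
            P \<in> carrier_mat n n \<and> invertible_mat P \<and>
            Q \<in> carrier_mat n n \<and> invertible_mat Q \<and>
            (\<forall>z. P * pencil (At \<tau>) (Bt \<tau>) z * Q =
                 diag_block_mat [pencil RA RB z, pencil RnewA RnewB z]) \<and>
            regular_pencil RnewA RnewB \<and>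
            eigenvalues RnewA RnewB \<inter> eigenvalues RA RB = {}))) \<and>
      \<comment> \<open>2\<close>
      (\<forall>z. Fin z \<in> eigenvalues A B \<longrightarrow>
        (\<forall>\<tau>. \<tau> \<noteq> 0 \<longrightarrow> Fin z \<in> eigenvalues (At \<tau>) (Bt \<tau>)) \<and>
        (\<forall>\<tau> \<sigma>. \<tau> \<noteq> 0 \<and> \<sigma> \<noteq> 0 \<longrightarrow>
          mat_kernel (pencil (At \<tau>) (Bt \<tau>) z) = mat_kernel (pencil (At \<sigma>) (Bt \<sigma>) z) \<and>
          mat_kernel (mat_adjoint (pencil (At \<tau>) (Bt \<tau>) z)) =
            mat_kernel (mat_adjoint (pencil (At \<sigma>) (Bt \<sigma>) z))) \<and>
        (\<forall>\<tau>. \<tau> \<noteq> 0 \<longrightarrow>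
          orthogonal_sets (mat_kernel (pencil (At \<tau>) (Bt \<tau>) z)) (column_space V) \<and>
          (\<forall>x. right_eigenvector (At \<tau>) (Bt \<tau>) (Fin z) x \<longrightarrow> mat_adjoint V *\<^sub>v x = 0\<^sub>v k) \<and>
          orthogonal_sets (mat_kernel (mat_adjoint (pencil (At \<tau>) (Bt \<tau>) z))) (column_space U) \<and>
          (\<forall>y. left_eigenvector (At \<tau>) (Bt \<tau>) (Fin z) y \<longrightarrow> mat_adjoint U *\<^sub>v y = 0\<^sub>v k))) \<and>
      \<comment> \<open>3\<close>
      (Infty \<in> eigenvalues A B \<longrightarrow>
        (\<forall>\<tau>. \<tau> \<noteq> 0 \<longrightarrow> Infty \<in> eigenvalues (At \<tau>) (Bt \<tau>)) \<and>
        (\<forall>\<tau> \<sigma>. \<tau> \<noteq> 0 \<and> \<sigma> \<noteq> 0 \<longrightarrow>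
          mat_kernel (Bt \<tau>) = mat_kernel (Bt \<sigma>) \<and>
          mat_kernel (mat_adjoint (Bt \<tau>)) = mat_kernel (mat_adjoint (Bt \<sigma>))) \<and>
        (\<forall>\<tau>. \<tau> \<noteq> 0 \<longrightarrow>
          orthogonal_sets (mat_kernel (Bt \<tau>)) (column_space V) \<and>
          (\<forall>x. right_eigenvector (At \<tau>) (Bt \<tau>) Infty x \<longrightarrow> mat_adjoint V *\<^sub>v x = 0\<^sub>v k) \<and>
          orthogonal_sets (mat_kernel (mat_adjoint (Bt \<tau>))) (column_space U) \<and>
          (\<forall>y. left_eigenvector (At \<tau>) (Bt \<tau>) Infty y \<longrightarrow> mat_adjoint U *\<^sub>v y = 0\<^sub>v k)))))"
proof -
  \<comment> \<open>Outside \<open>bad\<close> both pencils attain their normal rank. Such a point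
    \<open>z1\<close> joins the eigenvalues as a place to test regularity of the perturbed
    pencil.\<close>
  define bad where "bad = {z. mrank (pencil A B z) < nrank A B} \<union> {z. mrank (pencil DA DB z) < nrank DA DB}"
  have "finite bad" unfolding bad_def using finite_low_nrank[OF A B] finite_low_nrank[OF DA(1) DB(1)] by blast
  then obtain z1 where "z1 \<notin> bad" using ex_new_if_finite[OF infinite_UNIV_char_0] by blast
  hence z1: "mrank (pencil A B z1) = n - k" "mrank (pencil DA DB z1) = k"
    using nrank_attained(1)[OF A B, of z1] nrank_attained(1)[OF DA(1) DB(1), of z1]
      nrank_regular[OF DA(1) DB(1) D_regular] normal_rank(2) by (auto simp: bad_def)
  \<comment> \<open>At eigenvalues of the original pencil this is the disjointness hypothesis, at
    \<open>z1\<close> the choice of \<open>z1\<close>.\<close>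
  have D_nonsing: "det (pencil_at DA DB \<mu>) \<noteq> 0" if "\<mu> \<in> insert (Fin z1) (eigenvalues A B)" for \<mu>
  proof -
    have c: "pencil_at DA DB \<mu> \<in> carrier_mat k k" by (rule pencil_at_carrier[OF DA(1) DB(1)])
    have "mrank (pencil_at DA DB \<mu>) \<le> k" by (rule mrank_nullspace[OF c])
    moreover have "\<not> mrank (pencil_at DA DB \<mu>) < k"
      using that z1(2) D_eigenvalues nrank_regular[OF DA(1) DB(1) D_regular] by (auto simp: eigenvalues_def)
    ultimately show ?thesis using mrank_det[OF c] by simp
  qed
  let ?pts = "insert (Fin z1) (eigenvalues A B)"
  let ?A = "transpose_mat A" let ?B = "transpose_mat B"
  have At: "?A \<in> carrier_mat n n" and Bt: "?B \<in> carrier_mat n n" using A B by auto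
  have low: "\<forall>\<mu>\<in>?pts. mrank (pencil_at A B \<mu>) \<le> n - k"
    using z1(1) normal_rank(2) by (auto simp: eigenvalues_def)
  have fin: "finite ?pts" using finite_eigenvalues[OF A B] by simp
  obtain NR where NR: "finite NR" "\<forall>N\<in>NR. N \<in> carrier_mat n k \<and> (\<exists>X\<in>carrier_mat k n. X * N = 1\<^sub>m k)"
    "\<forall>W\<in>carrier_mat k n. (\<forall>N\<in>NR. det (W * N) \<noteq> 0) \<longrightarrow> (\<forall>\<mu>\<in>?pts. good_right n k A B \<mu> W)"
    using good_right_generic_finite[OF A B normal_rank fin low] by (elim exE conjE) (rule that)
  have nrT: "nrank ?A ?B = n - k" unfolding nrank_transpose[OF A B] by (rule normal_rank(2))
  have lowT: "\<forall>\<mu>\<in>?pts. mrank (pencil_at ?A ?B \<mu>) \<le> n - k"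
    unfolding pencil_at_transpose[OF A B] mrank_transpose by (rule low)
  obtain NL where NL: "finite NL" "\<forall>N\<in>NL. N \<in> carrier_mat n k \<and> (\<exists>X\<in>carrier_mat k n. X * N = 1\<^sub>m k)"
    "\<forall>W\<in>carrier_mat k n. (\<forall>N\<in>NL. det (W * N) \<noteq> 0) \<longrightarrow> (\<forall>\<mu>\<in>?pts. good_right n k ?A ?B \<mu> W)"
    using good_right_generic_finite[OF At Bt normal_rank(1) nrT fin lowT] by (elim exE conjE) (rule that)
  show ?thesis
  \<comment> \<open>The conditions on \<open>U\<close> arise for the transposed pencil as
    \<open>det (U\<^sup>T N) \<noteq> 0\<close>; transposing the fixed matrices brings them to the
    form \<open>det (C * U) \<noteq> 0\<close>.\<close>
  proof (rule holds_genericallyI[of "transpose_mat ` NL" NR])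
    show "finite (transpose_mat ` NL)" "finite NR" using NL(1) NR(1) by auto
    show "N \<in> carrier_mat n k \<and> (\<exists>X\<in>carrier_mat k n. X * N = 1\<^sub>m k)" if "N \<in> NR" for N using NR(2) that by blast
  next
    fix C assume "C \<in> transpose_mat ` NL"
    then obtain N X where N: "C = transpose_mat N" "N \<in> carrier_mat n k" and X: "X \<in> carrier_mat k n" "X * N = 1\<^sub>m k"
      using NL(2) by blast
    have "C * transpose_mat X = 1\<^sub>m k" unfolding N(1) using transpose_mult[OF X(1) N(2)] X(2) by simp
    thus "C \<in> carrier_mat k n \<and> (\<exists>X\<in>carrier_mat n k. C * X = 1\<^sub>m k)" using N X(1) by auto
  next
    fix U V assume U: "U \<in> carrier_mat n k" and V: "V \<in> carrier_mat n k"
      and dU: "\<And>C. C \<in> transpose_mat ` NL \<Longrightarrow> det (C * U) \<noteq> 0"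
      and dV: "\<And>N. N \<in> NR \<Longrightarrow> det (mat_adjoint V * N) \<noteq> 0"
    define W where "W = mat_adjoint V"
    have W: "W \<in> carrier_mat k n" unfolding W_def by (rule mat_adjoint_carrier[OF V])
    have Ut: "transpose_mat U \<in> carrier_mat k n" and Wt: "transpose_mat W \<in> carrier_mat n k" using U W by auto
    have goodR: "good_right n k A B \<mu> W" if "\<mu> \<in> ?pts" for \<mu>
      using NR(3)[rule_format, OF W _ that] dV unfolding W_def by blast
    have "det (transpose_mat U * N) \<noteq> 0" if N: "N \<in> NL" for N
    proof -
      have Nc: "N \<in> carrier_mat n k" using NL(2) N by blast
      have "det (transpose_mat N * U) \<noteq> 0" using dU N by blast
      moreover have "transpose_mat (transpose_mat U * N) = transpose_mat N * U"
        using transpose_mult[OF Ut Nc] by simp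
      moreover have "transpose_mat U * N \<in> carrier_mat k k" using Ut Nc by auto
      ultimately show ?thesis using det_transpose by metis
    qed
    hence goodL: "good_right n k ?A ?B \<mu> (transpose_mat U)" if "\<mu> \<in> ?pts" for \<mu>
      using NL(3)[rule_format, OF Ut _ that] by blast
    define AA where "AA = perturb A U DA V"
    define BB where "BB = perturb B U DB V"
    have AA: "AA \<tau> = A + \<tau> \<cdot>\<^sub>m (U * DA * W)" and BB: "BB \<tau> = B + \<tau> \<cdot>\<^sub>m (U * DB * W)" for \<tau>
      by (simp_all add: AA_def BB_def perturb_def W_def)
    have AAc: "AA \<tau> \<in> carrier_mat n n" and BBc: "BB \<tau> \<in> carrier_mat n n" for \<tau>
      unfolding AA BB using A B U W DA DB by auto
    have Lc: "pencil_at (AA \<tau>) (BB \<tau>) \<mu> \<in> carrier_mat n n" for \<tau> \<mu> by (rule pencil_at_carrier[OF AAc BBc])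
    have L: "pencil_at (AA \<tau>) (BB \<tau>) \<mu> = pencil_at A B \<mu> + \<tau> \<cdot>\<^sub>m (U * pencil_at DA DB \<mu> * W)" for \<tau> \<mu>
      unfolding AA BB by (rule pencil_at_perturbed[OF A B U DA(1) DB(1) W])
    have ker: "mat_kernel (pencil_at (AA \<tau>) (BB \<tau>) \<mu>) = {x \<in> mat_kernel (pencil_at A B \<mu>). W *\<^sub>v x = 0\<^sub>v k}"
      if "\<mu> \<in> ?pts" "\<tau> \<noteq> 0" for \<tau> \<mu>
      unfolding L by (rule good_right_perturbed_kernel[OF A B U pencil_at_carrier[OF DA(1) DB(1)] W D_nonsing[OF that(1)] that(2) goodL[OF that(1)]])
    \<comment> \<open>The transposed perturbation is \<open>W\<^sup>T D\<^sup>T U\<^sup>T\<close>,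
      so the same kernel lemma applies with \<open>U\<close> and \<open>W\<close> exchanged; now
      \<open>goodR\<close> provides the annihilator.\<close>
    have kerT: "mat_kernel (transpose_mat (pencil_at (AA \<tau>) (BB \<tau>) \<mu>)) =
        {x \<in> mat_kernel (pencil_at ?A ?B \<mu>). transpose_mat U *\<^sub>v x = 0\<^sub>v k}"
      if \<mu>: "\<mu> \<in> ?pts" "\<tau> \<noteq> 0" for \<tau> \<mu>
    proof -
      let ?D = "pencil_at DA DB \<mu>"
      have D: "?D \<in> carrier_mat k k" by (rule pencil_at_carrier[OF DA(1) DB(1)])
      have E: "pencil_at A B \<mu> \<in> carrier_mat n n" by (rule pencil_at_carrier[OF A B])
      have Dt: "transpose_mat ?D \<in> carrier_mat k k" "det (transpose_mat ?D) \<noteq> 0"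
        using D D_nonsing[OF \<mu>(1)] det_transpose[OF D] by auto
      have UD: "U * ?D \<in> carrier_mat n k" using U D by auto
      have X: "U * ?D * W \<in> carrier_mat n n" using UD W by auto
      have "transpose_mat (U * ?D * W) = transpose_mat W * (transpose_mat ?D * transpose_mat U)"
        unfolding transpose_mult[OF UD W] transpose_mult[OF U D] ..
      also have "\<dots> = transpose_mat W * transpose_mat ?D * transpose_mat U"
        by (rule assoc_mult_mat[OF Wt Dt(1) Ut, symmetric])
      finally have "transpose_mat (pencil_at (AA \<tau>) (BB \<tau>) \<mu>) =
        pencil_at ?A ?B \<mu> + \<tau> \<cdot>\<^sub>m (transpose_mat W * transpose_mat ?D * transpose_mat U)"
        unfolding L pencil_at_transpose[OF A B] by (simp only: transpose_add_smult[OF E X])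
      thus ?thesis
        using good_right_perturbed_kernel[OF At Bt Wt Dt(1) Ut Dt(2) \<mu>(2), of \<mu>] goodR[OF \<mu>(1)] by simp
    qed
    have kerA: "mat_kernel (mat_adjoint (pencil_at (AA \<tau>) (BB \<tau>) \<mu>)) =
        {y \<in> carrier_vec n. conjugate y \<in> mat_kernel (pencil_at ?A ?B \<mu>) \<and> mat_adjoint U *\<^sub>v y = 0\<^sub>v k}"
      if \<mu>: "\<mu> \<in> ?pts" "\<tau> \<noteq> 0" for \<tau> \<mu>
    proof -
      have "transpose_mat U *\<^sub>v conjugate y = 0\<^sub>v k \<longleftrightarrow> mat_adjoint U *\<^sub>v y = 0\<^sub>v k" if y: "y \<in> carrier_vec n" for y
        unfolding mat_adjoint_mult_vec[OF U y] by (rule conjugate_zero_iff_vec[symmetric])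
      thus ?thesis unfolding mat_adjoint_kernel[OF Lc] kerT[OF \<mu>] by auto
    qed
    \<comment> \<open>At \<open>z1\<close> the original rank is exactly \<open>n - k\<close>. The
      third condition of \<open>good_right\<close> then applies: the original kernel meets that of
      \<open>W\<close> only in 0.\<close>
    have regular: "det (pencil (AA \<tau>) (BB \<tau>) z1) \<noteq> 0" if "\<tau> \<noteq> 0" for \<tau>
    proof
      assume "det (pencil (AA \<tau>) (BB \<tau>) z1) = 0"
      then obtain x where x: "x \<in> carrier_vec n" "x \<noteq> 0\<^sub>v n" "pencil_at (AA \<tau>) (BB \<tau>) (Fin z1) *\<^sub>v x = 0\<^sub>v n"
        using det_0_iff_vec_prod_zero_field[OF Lc, of \<tau> "Fin z1"] by auto
      hence "x \<in> mat_kernel (pencil_at (AA \<tau>) (BB \<tau>) (Fin z1))" by (intro mat_kernelI[OF Lc])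
      hence "x \<in> mat_kernel (pencil_at A B (Fin z1))" "W *\<^sub>v x = 0\<^sub>v k" using ker[of "Fin z1" \<tau>] that by auto
      thus False using goodR[of "Fin z1"] z1(1) x(2) unfolding good_right_def by auto
    qed
    have nr: "nrank (AA \<tau>) (BB \<tau>) = n" if "\<tau> \<noteq> 0" for \<tau>
    proof (rule nrank_regular[OF AAc BBc])
      show "regular_pencil (AA \<tau>) (BB \<tau>)" unfolding regular_pencil_def square_pencil_def
        using AAc BBc regular[OF that] by blast
    qed
    \<comment> \<open>The perturbed pencil has normal rank \<open>n\<close>, so one nonzero kernel
      vector at \<mu> suffices.\<close>
    have eig: "\<mu> \<in> eigenvalues (AA \<tau>) (BB \<tau>)" if \<mu>: "\<mu> \<in> eigenvalues A B" "\<tau> \<noteq> 0" for \<mu> \<tau>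
    proof -
      have "mrank (pencil_at A B \<mu>) < n - k" using \<mu>(1) normal_rank(2) by (simp add: eigenvalues_def)
      then obtain x where "x \<in> mat_kernel (pencil_at A B \<mu>)" "x \<noteq> 0\<^sub>v n" "W *\<^sub>v x = 0\<^sub>v k"
        using low_rank_perturbed_singular[OF pencil_at_carrier[OF A B] W] by blast
      hence "x \<in> mat_kernel (pencil_at (AA \<tau>) (BB \<tau>) \<mu>)" "x \<noteq> 0\<^sub>v n" using ker[of \<mu> \<tau>] \<mu> by auto
      hence "det (pencil_at (AA \<tau>) (BB \<tau>) \<mu>) = 0"
        using det_0_iff_vec_prod_zero_field[OF Lc, of \<tau> \<mu>] mat_kernelD[OF Lc, of x \<tau> \<mu>] by auto
      hence "mrank (pencil_at (AA \<tau>) (BB \<tau>) \<mu>) \<noteq> n" using mrank_det[OF Lc] by blast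
      moreover have "mrank (pencil_at (AA \<tau>) (BB \<tau>) \<mu>) \<le> n" by (rule mrank_nullspace[OF Lc])
      ultimately show ?thesis unfolding eigenvalues_def nr[OF \<mu>(2)] by simp
    qed
    have part1: "\<exists>P Q RnewA RnewB. P \<in> carrier_mat n n \<and> invertible_mat P \<and> Q \<in> carrier_mat n n \<and> invertible_mat Q \<and>
       (\<forall>z. P * pencil (AA \<tau>) (BB \<tau>) z * Q = diag_block_mat [pencil RA RB z, pencil RnewA RnewB z]) \<and>
       regular_pencil RnewA RnewB \<and> eigenvalues RnewA RnewB \<inter> eigenvalues RA RB = {}"
      if R: "is_regular_part A B RA RB" and \<tau>: "\<tau> \<noteq> 0" for RA RB \<tau>
    proof -
      obtain P Q Pi Qi SA SB TA TB \<rho> a b p q where kb: "kronecker_blocks A B P Q Pi Qi RA RB SA SB TA TB n \<rho> a b p q"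
        using is_regular_part_blocks[OF A B R] by blast
      \<comment> \<open>Both \<open>n - p\<close> and \<open>n - k\<close> are the normal rank, with
        \<open>p\<close> and \<open>k\<close> at most \<open>n\<close>; every Kronecker form thus
        has \<open>k\<close> right singular blocks.\<close>
      have "p = k" using kronecker_blocks.nrank_blocks[OF kb] kronecker_blocks.mrank_E_le(2)[OF kb] normal_rank by simp
      show ?thesis
        by (rule kronecker_blocks.regular_part_preserved[OF kb, unfolded \<open>p = k\<close>, OF U W DA(1) DB(1) \<tau> _ _ _ AA BB regular[OF \<tau>]])
          (use D_nonsing goodR goodL in blast)+
    qed
    \<comment> \<open>Stated at an arbitrary point, since statements 2 and 3 are the instances at a
      finite point and at infinity.\<close>
    have points: "(\<forall>\<tau>. \<tau> \<noteq> 0 \<longrightarrow> \<mu> \<in> eigenvalues (AA \<tau>) (BB \<tau>)) \<and>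
        (\<forall>\<tau> \<sigma>. \<tau> \<noteq> 0 \<and> \<sigma> \<noteq> 0 \<longrightarrow>
          mat_kernel (pencil_at (AA \<tau>) (BB \<tau>) \<mu>) = mat_kernel (pencil_at (AA \<sigma>) (BB \<sigma>) \<mu>) \<and>
          mat_kernel (mat_adjoint (pencil_at (AA \<tau>) (BB \<tau>) \<mu>)) = mat_kernel (mat_adjoint (pencil_at (AA \<sigma>) (BB \<sigma>) \<mu>))) \<and>
        (\<forall>\<tau>. \<tau> \<noteq> 0 \<longrightarrow>
          orthogonal_sets (mat_kernel (pencil_at (AA \<tau>) (BB \<tau>) \<mu>)) (column_space V) \<and>
          (\<forall>x. right_eigenvector (AA \<tau>) (BB \<tau>) \<mu> x \<longrightarrow> mat_adjoint V *\<^sub>v x = 0\<^sub>v k) \<and>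
          orthogonal_sets (mat_kernel (mat_adjoint (pencil_at (AA \<tau>) (BB \<tau>) \<mu>))) (column_space U) \<and>
          (\<forall>y. left_eigenvector (AA \<tau>) (BB \<tau>) \<mu> y \<longrightarrow> mat_adjoint U *\<^sub>v y = 0\<^sub>v k))"
      if \<mu>: "\<mu> \<in> eigenvalues A B" for \<mu>
    proof (intro conjI allI impI)
      have \<mu>': "\<mu> \<in> ?pts" using \<mu> by blast
      fix \<tau> :: complex assume \<tau>: "\<tau> \<noteq> 0"
      show "\<mu> \<in> eigenvalues (AA \<tau>) (BB \<tau>)" by (rule eig[OF \<mu> \<tau>])
      show "orthogonal_sets (mat_kernel (pencil_at (AA \<tau>) (BB \<tau>) \<mu>)) (column_space V)"
        using ker[OF \<mu>' \<tau>] mat_kernel_carrier[OF Lc] by (intro orthogonal_column_space[OF V]) (auto simp: W_def)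
      show "orthogonal_sets (mat_kernel (mat_adjoint (pencil_at (AA \<tau>) (BB \<tau>) \<mu>))) (column_space U)"
        unfolding kerA[OF \<mu>' \<tau>] by (intro orthogonal_column_space[OF U]) auto
      show "mat_adjoint V *\<^sub>v x = 0\<^sub>v k" if "right_eigenvector (AA \<tau>) (BB \<tau>) \<mu> x" for x
      proof -
        have "x \<in> mat_kernel (pencil_at (AA \<tau>) (BB \<tau>) \<mu>)"
          using that AAc[of \<tau>] unfolding right_eigenvector_def by (intro mat_kernelI[OF Lc]) auto
        thus ?thesis unfolding ker[OF \<mu>' \<tau>] W_def by simp
      qed
      show "mat_adjoint U *\<^sub>v y = 0\<^sub>v k" if "left_eigenvector (AA \<tau>) (BB \<tau>) \<mu> y" for y
      proof -
        let ?L = "pencil_at (AA \<tau>) (BB \<tau>) \<mu>"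
        have y: "y \<in> carrier_vec n" and yL: "mat_of_row (conjugate y) * ?L = 0\<^sub>m 1 n"
          using that AAc[of \<tau>] unfolding left_eigenvector_def by auto
        \<comment> \<open>The row equation \<open>y\<^sup>* L = 0\<close> is rewritten entrywise as
          a kernel equation for the transpose of \<open>L\<close>.\<close>
        have "transpose_mat ?L *\<^sub>v conjugate y = 0\<^sub>v n"
        proof (rule eq_vecI)
          fix i assume "i < dim_vec (0\<^sub>v n :: complex vec)"
          hence i: "i < n" by simp
          have "(transpose_mat ?L *\<^sub>v conjugate y) $ i = col ?L i \<bullet> conjugate y" using i Lc[of \<tau> \<mu>] by simp
          also have "\<dots> = conjugate y \<bullet> col ?L i" using i Lc[of \<tau> \<mu>] y by (intro comm_scalar_prod[of _ n]) auto
          also have "\<dots> = (mat_of_row (conjugate y) * ?L) $$ (0,i)" using i Lc[of \<tau> \<mu>] y by simp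
          finally show "(transpose_mat ?L *\<^sub>v conjugate y) $ i = 0\<^sub>v n $ i" unfolding yL using i by simp
        qed (use Lc[of \<tau> \<mu>] in auto)
        hence "y \<in> mat_kernel (mat_adjoint ?L)" unfolding mat_adjoint_kernel[OF Lc]
          using y Lc[of \<tau> \<mu>] by (auto intro!: mat_kernelI[of _ n n])
        thus ?thesis unfolding kerA[OF \<mu>' \<tau>] by simp
      qed
    next
      have \<mu>': "\<mu> \<in> ?pts" using \<mu> by blast
      fix \<tau> \<sigma> :: complex assume "\<tau> \<noteq> 0 \<and> \<sigma> \<noteq> 0"
      thus "mat_kernel (pencil_at (AA \<tau>) (BB \<tau>) \<mu>) = mat_kernel (pencil_at (AA \<sigma>) (BB \<sigma>) \<mu>)"
        "mat_kernel (mat_adjoint (pencil_at (AA \<tau>) (BB \<tau>) \<mu>)) = mat_kernel (mat_adjoint (pencil_at (AA \<sigma>) (BB \<sigma>) \<mu>))"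
        using ker[OF \<mu>'] kerA[OF \<mu>'] by auto
    qed
    show "mrank U = k \<and> mrank V = k \<longrightarrow>
    (let At = perturb A U DA V; Bt = perturb B U DB V in
      (\<forall>RA RB. is_regular_part A B RA RB \<longrightarrow>
        (\<forall>\<tau>. \<tau> \<noteq> 0 \<longrightarrow>
          (\<exists>P Q RnewA RnewB.
            P \<in> carrier_mat n n \<and> invertible_mat P \<and>
            Q \<in> carrier_mat n n \<and> invertible_mat Q \<and>
            (\<forall>z. P * pencil (At \<tau>) (Bt \<tau>) z * Q =
                 diag_block_mat [pencil RA RB z, pencil RnewA RnewB z]) \<and>
            regular_pencil RnewA RnewB \<and>
            eigenvalues RnewA RnewB \<inter> eigenvalues RA RB = {}))) \<and>
      (\<forall>z. Fin z \<in> eigenvalues A B \<longrightarrow>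
        (\<forall>\<tau>. \<tau> \<noteq> 0 \<longrightarrow> Fin z \<in> eigenvalues (At \<tau>) (Bt \<tau>)) \<and>
        (\<forall>\<tau> \<sigma>. \<tau> \<noteq> 0 \<and> \<sigma> \<noteq> 0 \<longrightarrow>
          mat_kernel (pencil (At \<tau>) (Bt \<tau>) z) = mat_kernel (pencil (At \<sigma>) (Bt \<sigma>) z) \<and>
          mat_kernel (mat_adjoint (pencil (At \<tau>) (Bt \<tau>) z)) =
            mat_kernel (mat_adjoint (pencil (At \<sigma>) (Bt \<sigma>) z))) \<and>
        (\<forall>\<tau>. \<tau> \<noteq> 0 \<longrightarrow>
          orthogonal_sets (mat_kernel (pencil (At \<tau>) (Bt \<tau>) z)) (column_space V) \<and>
          (\<forall>x. right_eigenvector (At \<tau>) (Bt \<tau>) (Fin z) x \<longrightarrow> mat_adjoint V *\<^sub>v x = 0\<^sub>v k) \<and>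
          orthogonal_sets (mat_kernel (mat_adjoint (pencil (At \<tau>) (Bt \<tau>) z))) (column_space U) \<and>
          (\<forall>y. left_eigenvector (At \<tau>) (Bt \<tau>) (Fin z) y \<longrightarrow> mat_adjoint U *\<^sub>v y = 0\<^sub>v k))) \<and>
      (Infty \<in> eigenvalues A B \<longrightarrow>
        (\<forall>\<tau>. \<tau> \<noteq> 0 \<longrightarrow> Infty \<in> eigenvalues (At \<tau>) (Bt \<tau>)) \<and>
        (\<forall>\<tau> \<sigma>. \<tau> \<noteq> 0 \<and> \<sigma> \<noteq> 0 \<longrightarrow>
          mat_kernel (Bt \<tau>) = mat_kernel (Bt \<sigma>) \<and>
          mat_kernel (mat_adjoint (Bt \<tau>)) = mat_kernel (mat_adjoint (Bt \<sigma>))) \<and>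
        (\<forall>\<tau>. \<tau> \<noteq> 0 \<longrightarrow>
          orthogonal_sets (mat_kernel (Bt \<tau>)) (column_space V) \<and>
          (\<forall>x. right_eigenvector (At \<tau>) (Bt \<tau>) Infty x \<longrightarrow> mat_adjoint V *\<^sub>v x = 0\<^sub>v k) \<and>
          orthogonal_sets (mat_kernel (mat_adjoint (Bt \<tau>))) (column_space U) \<and>
          (\<forall>y. left_eigenvector (At \<tau>) (Bt \<tau>) Infty y \<longrightarrow> mat_adjoint U *\<^sub>v y = 0\<^sub>v k))))"
      unfolding Let_def AA_def[symmetric] BB_def[symmetric]
      by (rule impI, rule conjI, intro allI impI, rule part1, assumption, assumption, rule conjI,
          intro allI impI, rule points[of "Fin z" for z, unfolded pencil_at.simps], assumption,
          rule impI, rule points[of Infty, unfolded pencil_at.simps], assumption)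
  qed
qed

end
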